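(* Let $p=p(n)$ and let $\mathbf{Z}=(\mathbf{Z}_1,\ldots,\mathbf{Z}_n)=(Z_{ij})_{p\times n}$ have i.i.d. real entries with $\mathbb{E}(Z_{11})=0$, $\mathbb{E}(Z_{11}^2)=1$ and $\mathbb{E}(Z_{11}^4)<\infty$. Let $\boldsymbol{\Sigma}=\mathbf{I}$, so that $$\widetilde{\mathbf{S}}_n=\frac{p}{n}\sum_{i=1}^n\frac{\mathbf{Z}_i\mathbf{Z}_i^\top}{|\mathbf{Z}_i|^2}.$$ Suppose $y_n:=p/n\to y\in(0,\infty)$ as $n\to\infty$, and let $$\widetilde{T}_n=\frac{1}{y_n}\sum_{i=1}^p\big(\lambda_i^{\widetilde{\mathbf{S}}_n}\big)^2-n-p .$$ Then $$\frac{\widetilde{T}_n+1}{2}\ \stackrel{D}{\longrightarrow}\ N(0,1).$$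
   Context: $|\mathbf{Z}_i|$ is the Euclidean norm of a vector (with the convention $0/0=0$) and $\lambda_1^{\widetilde{\mathbf{S}}_n},\ldots,\lambda_p^{\widetilde{\mathbf{S}}_n}$ are the eigenvalues of $\widetilde{\mathbf{S}}_n$. The law of $Z_{11}$ does not depend on $n$. Equivalently, $\widetilde{\mathbf{S}}_n=\frac{p}{n}\sum_{i=1}^n\mathbf{Y}_i\mathbf{Y}_i^\top/|\mathbf{Y}_i|^2$ for observations $\mathbf{Y}_i=\omega_i\mathbf{Z}_i$ with arbitrary positive random scalars $\omega_i$. On the event that all $|\mathbf{Z}_i|>0$ (so that $\operatorname{tr}\widetilde{\mathbf{S}}_n=p$), $\widetilde{T}_n=\frac{n}{p}\operatorname{tr}(\widetilde{\mathbf{S}}_n-\mathbf{I})^2-p$. $\stackrel{D}{\longrightarrow}$ denotes convergence in distribution. *)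

theory Defs
  imports "HOL-Probability.Probability" "Jordan_Normal_Form.Char_Poly"
begin

definition col_norm :: "real mat \<Rightarrow> nat \<Rightarrow> real" where
  "col_norm Z i = L2_set (\<lambda>k. Z $$ (k, i)) {..<dim_row Z}"

text \<open>
  The columns of the \<open>p \<times> n\<close> matrix are the observations (indices start at 0).
  Since \<open>x / 0 = 0\<close>, a zero column contributes the zero matrix to the sum,
  which is the convention \<open>0 / 0 = 0\<close>.
\<close>
definition self_normalized_cov :: "real mat \<Rightarrow> real mat" where
  "self_normalized_cov Z =
     mat (dim_row Z) (dim_row Z) (\<lambda>(k, l).
       (real (dim_row Z) / real (dim_col Z)) *
       (\<Sum>i<dim_col Z. Z $$ (k, i) * Z $$ (l, i) / (col_norm Z i)\<^sup>2))"

text \<open>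
  Roots of the characteristic polynomial with algebraic multiplicity. Only real roots are
  collected; for a real symmetric matrix of dimension \<open>p\<close> these are all \<open>p\<close> eigenvalues.
\<close>
definition eigenvalues_mset :: "real mat \<Rightarrow> real multiset" where
  "eigenvalues_mset A = proots (char_poly A)"

definition T_stat :: "real mat \<Rightarrow> real" where
  "T_stat Z =
     (let p = real (dim_row Z); n = real (dim_col Z); y = p / n
      in (1 / y) * (\<Sum>\<^sub># (image_mset (\<lambda>x. x\<^sup>2) (eigenvalues_mset (self_normalized_cov Z)))) - n - p)"

end

theory Submission
  imports Defs "HOL-Real_Asymp.Real_Asymp" "Jordan_Normal_Form.Schur_Decomposition"
begin

text \<open>
  Put \<open>u\<^sub>i = Z\<^sub>i / |Z\<^sub>i|\<close> and \<open>A\<^sub>i = u\<^sub>i u\<^sub>i\<^sup>T - I / p\<close>. Unless some column vanishes,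
  the trace of the squared matrix expands to
  \<open>(T + 1) / 2 = (p / n) \<Sum>\<^sub>j\<^sub><\<^sub>i \<langle>A\<^sub>j, A\<^sub>i\<rangle>\<close>, a U-statistic of the independent matrices \<open>A\<^sub>i\<close>.
  After centring the \<open>A\<^sub>i\<close> it is degenerate, and a central limit theorem of Hall's type applies:
  the characteristic functions of the partial sums are telescoped, and the conditional variances of the
  increments concentrate because the iterated kernel \<open>G\<close> is small in mean square.

  Three facts about a column feed this theorem. The second moment operator of \<open>A\<^sub>1\<close> has norm \<open>O(p\<^sup>-\<^sup>2)\<close>,
  by the variance bound for quadratic forms in independent entries with four moments. The mean of \<open>A\<^sub>1\<close>
  has norm \<open>o(1 / p)\<close>, as it would vanish if the squared norm were replaced by \<open>p\<close>. Finally
  \<open>\<langle>u\<^sub>1, u\<^sub>2\<rangle>\<^sup>2\<close> is close to \<open>\<langle>Z\<^sub>1, Z\<^sub>2\<rangle>\<^sup>2 / p\<^sup>2\<close>, where \<open>\<langle>Z\<^sub>1, Z\<^sub>2\<rangle>\<close> is a sum of \<open>p\<close> independent terms; the classical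
  central limit theorem together with convergence of fourth moments makes its fourth power uniformly
  integrable, which yields both the variance and the Lindeberg condition without an eighth moment.
\<close>

subsection \<open>Eigenvalues of real symmetric matrices\<close>

text \<open>The kernel is close to \<open>X^2 - 1\<close> with \<open>X\<close> the scaled inner
  product of two columns. A fourth moment of the kernel would thus cost eight moments of the
  entries; truncating the kernel at a fixed level takes its place. Self-normalization makes the
  entries of a column dependent. For a skewed law the off-diagonal means of u u^T may differ from
  zero, so the kernel need not be degenerate and its centring has to be paid for. A column may be
  very short or vanish. Since squares are nonnegative, four moments already make a squared norm
  below p / 2 exponentially unlikely, and this beats every power of p that the bounded normalized
  columns can cost. The limiting variance: the second moment of the kernel tends to E (N^2 - 1)^2 =
  2 for a standard normal N, there are n (n - 1) / 2 pairs, and each has weight 1 / n, which gives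
  1. All estimates are explicit in p, n and the truncation level, so that the relation between p and
  n enters only at the end.\<close>

lemma eigenvalue_symmetric_real:
  fixes A :: "real mat" and a :: complex
  assumes A: "A \<in> carrier_mat n n" and sym: "\<And>k l. k < n \<Longrightarrow> l < n \<Longrightarrow> A $$ (k, l) = A $$ (l, k)"
    and ev: "eigenvalue (map_mat complex_of_real A) a"
  shows "Im a = 0"
proof -
  obtain v where v: "v \<in> carrier_vec n" "v \<noteq> 0\<^sub>v n" "map_mat complex_of_real A *\<^sub>v v = a \<cdot>\<^sub>v v"
    using ev A unfolding eigenvalue_def eigenvector_def by auto
  \<comment> \<open>This is the Hermitian form of \<open>A\<close> at \<open>v\<close>: the
    eigenvector equation makes it \<open>a\<close> times the squared norm of \<open>v\<close>, and
    symmetry makes it real.\<close>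
  define s where "s = (\<Sum>k<n. \<Sum>l<n. cnj (v $ k) * complex_of_real (A $$ (k, l)) * v $ l)"
  have Av: "(\<Sum>l<n. complex_of_real (A $$ (k, l)) * v $ l) = a * v $ k" if "k < n" for k
  proof -
    have "(map_mat complex_of_real A *\<^sub>v v) $ k = a * v $ k" using v that by simp
    then show ?thesis using that A v(1) by (simp add: scalar_prod_def lessThan_atLeast0)
  qed
  have "s = (\<Sum>k<n. cnj (v $ k) * (a * v $ k))"
    unfolding s_def by (intro sum.cong) (auto simp: Av[symmetric] sum_distrib_left mult.assoc)
  also have "\<dots> = a * complex_of_real (\<Sum>k<n. (cmod (v $ k))\<^sup>2)"
    unfolding of_real_sum sum_distrib_left
    by (intro sum.cong) (auto simp: complex_norm_square mult_ac simp del: of_real_power)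
  finally have s1: "s = a * complex_of_real (\<Sum>k<n. (cmod (v $ k))\<^sup>2)" .
  have "cnj s = (\<Sum>k<n. \<Sum>l<n. v $ k * complex_of_real (A $$ (k, l)) * cnj (v $ l))"
    unfolding s_def by simp
  also have "\<dots> = (\<Sum>l<n. \<Sum>k<n. v $ k * complex_of_real (A $$ (k, l)) * cnj (v $ l))"
    by (rule sum.swap)
  also have "\<dots> = s" unfolding s_def using sym by (intro sum.cong) (auto simp: mult_ac)
  finally have "Im s = 0" by (metis Reals_cnj_iff complex_is_Real_iff)
  moreover have "(\<Sum>k<n. (cmod (v $ k))\<^sup>2) \<noteq> 0"
  proof
    assume "(\<Sum>k<n. (cmod (v $ k))\<^sup>2) = 0"
    then have "v $ k = 0" if "k < n" for k using that by (subst (asm) sum_nonneg_eq_0_iff) auto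
    then have "v = 0\<^sub>v n" using v(1) by (intro eq_vecI) auto
    then show False using v(2) by simp
  qed
  ultimately show ?thesis unfolding s1 by simp
qed

text \<open>Over the complex numbers the polynomial splits, its roots are eigenvalues and hence
  real, and the embedding of real into complex polynomials is injective. The splitting lets
  \<open>schur_decomposition\<close> run over the reals and shows that collecting only real roots
  loses none.\<close>

lemma char_poly_symmetric_splits:
  fixes A :: "real mat"
  assumes A: "A \<in> carrier_mat n n" and sym: "\<And>k l. k < n \<Longrightarrow> l < n \<Longrightarrow> A $$ (k, l) = A $$ (l, k)"
  shows "\<exists>es. char_poly A = (\<Prod>e\<leftarrow>es. [:- e, 1:])"
proof -
  interpret mp: map_poly_inj_comm_ring_hom complex_of_real ..
  let ?C = "map_mat complex_of_real A"
  have C: "?C \<in> carrier_mat n n" using A by simp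
  have cp: "char_poly ?C = map_poly complex_of_real (char_poly A)"
    by (rule of_real_hom.char_poly_hom[OF A])
  obtain as where as: "char_poly ?C = (\<Prod>a\<leftarrow>as. [:- a, 1:])" using char_poly_factorized[OF C] by blast
  have real: "complex_of_real (Re a) = a" if "a \<in> set as" for a
  proof -
    have "poly (char_poly ?C) a = 0" unfolding as poly_prod_list using that by (auto simp: prod_list_zero_iff)
    then have "eigenvalue ?C a" using eigenvalue_root_char_poly[OF C] by simp
    from eigenvalue_symmetric_real[OF A sym this] show ?thesis by (simp add: complex_eq_iff)
  qed
  have "map_poly complex_of_real (\<Prod>e\<leftarrow>map Re as. [:- e, 1:]) = (\<Prod>a\<leftarrow>as. [:- a, 1:])"
    using real by (simp add: mp.hom_prod_list o_def cong: map_cong)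
  then have "map_poly complex_of_real (char_poly A) = map_poly complex_of_real (\<Prod>e\<leftarrow>map Re as. [:- e, 1:])"
    using as cp by simp
  then show ?thesis by (blast dest: mp.injectivity)
qed

lemma trace_mult_comm:
  fixes X Y :: "'a :: comm_semiring_0 mat"
  assumes "X \<in> carrier_mat n n" "Y \<in> carrier_mat n n"
  shows "(\<Sum>k<n. (X * Y) $$ (k, k)) = (\<Sum>k<n. (Y * X) $$ (k, k))"
proof -
  have "(\<Sum>k<n. (X * Y) $$ (k, k)) = (\<Sum>k<n. \<Sum>l<n. X $$ (k, l) * Y $$ (l, k))"
    using assms by (simp add: scalar_prod_def lessThan_atLeast0)
  also have "\<dots> = (\<Sum>l<n. \<Sum>k<n. X $$ (k, l) * Y $$ (l, k))" by (rule sum.swap)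
  also have "\<dots> = (\<Sum>k<n. (Y * X) $$ (k, k))"
    using assms by (simp add: scalar_prod_def lessThan_atLeast0 mult.commute)
  finally show ?thesis .
qed

lemma proots_prod_linear: "proots (\<Prod>e\<leftarrow>es. [:- e, 1:]) = mset (es :: real list)"
proof (induction es)
  case (Cons e es)
  have "(\<Prod>e\<leftarrow>es. [:- e, 1:]) \<noteq> 0" by (auto simp: prod_list_zero_iff)
  then show ?case using Cons by (simp add: proots_mult del: mult_pCons_left)
qed simp

text \<open>A triangular form \<open>A = P * B * Q\<close> suffices: by cyclicity
  \<open>A * A\<close> and \<open>B * B\<close> have the same trace, and a triangular
  \<open>B\<close> contributes just the squares of its diagonal. Symmetry turns the trace of
  \<open>A * A\<close> into a sum of squared entries.\<close>

lemma sum_squares_eigenvalues: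
  fixes A :: "real mat"
  assumes A: "A \<in> carrier_mat n n" and sym: "\<And>k l. k < n \<Longrightarrow> l < n \<Longrightarrow> A $$ (k, l) = A $$ (l, k)"
  shows "(\<Sum>\<^sub># (image_mset (\<lambda>x. x\<^sup>2) (eigenvalues_mset A))) = (\<Sum>k<n. \<Sum>l<n. (A $$ (k, l))\<^sup>2)"
proof -
  obtain es where es: "char_poly A = (\<Prod>e\<leftarrow>es. [:- e, 1:])"
    using char_poly_symmetric_splits[OF assms] by blast
  obtain B P Q where BPQ: "schur_decomposition A es = (B, P, Q)" by (cases "schur_decomposition A es") auto
  from schur_decomposition[OF A es BPQ]
  have wit: "similar_mat_wit A B P Q" and ut: "upper_triangular B" and diag: "diag_mat B = es" by auto
  note w = similar_mat_witD2[OF A wit]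
  have BQ: "B * Q \<in> carrier_mat n n" using w by simp
  have "A * A = (P * B * Q) * (P * B * Q)" using w(3) by simp
  also have "\<dots> = P * (B * (Q * (P * (B * Q))))"
    using w by (simp add: assoc_mult_mat[of _ n n _ n _ n])
  also have "Q * (P * (B * Q)) = B * Q"
    using w BQ by (simp add: assoc_mult_mat[of Q n n P n "B * Q" n, symmetric])
  finally have AA: "A * A = P * (B * (B * Q))" .
  have "(\<Sum>k<n. \<Sum>l<n. (A $$ (k, l))\<^sup>2) = (\<Sum>k<n. (A * A) $$ (k, k))"
    using A sym by (auto simp: scalar_prod_def lessThan_atLeast0 power2_eq_square intro!: sum.cong)
  also have "\<dots> = (\<Sum>k<n. ((B * (B * Q)) * P) $$ (k, k))"
    unfolding AA using w BQ by (intro trace_mult_comm) auto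
  also have "(B * (B * Q)) * P = B * B * (Q * P)"
    using w by (simp add: assoc_mult_mat[of _ n n _ n _ n])
  also have "\<dots> = B * B" using w by simp
  also have "(\<Sum>k<n. (B * B) $$ (k, k)) = (\<Sum>k<n. (B $$ (k, k))\<^sup>2)"
  proof (intro sum.cong refl)
    fix k assume "k \<in> {..<n}"
    then have k: "k < n" by simp
    have "(B * B) $$ (k, k) = (\<Sum>l<n. B $$ (k, l) * B $$ (l, k))"
      using w k by (simp add: scalar_prod_def lessThan_atLeast0)
    \<comment> \<open>For \<open>l \<noteq> k\<close> one of the two factors lies below the diagonal
      of \<open>B\<close>.\<close>
    also have "\<dots> = (\<Sum>l<n. if l = k then (B $$ (k, k))\<^sup>2 else 0)"
    proof (intro sum.cong refl)
      fix l assume "l \<in> {..<n}"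
      then show "B $$ (k, l) * B $$ (l, k) = (if l = k then (B $$ (k, k))\<^sup>2 else 0)"
        using upper_triangularD[OF ut, of l k] upper_triangularD[OF ut, of k l] k w(5)
        by (cases l k rule: linorder_cases) (auto simp: power2_eq_square)
    qed
    finally show "(B * B) $$ (k, k) = (B $$ (k, k))\<^sup>2" using k by simp
  qed
  also have "\<dots> = (\<Sum>e\<leftarrow>diag_mat B. e\<^sup>2)"
    using w(5) by (simp add: diag_mat_def sum_list_sum_nth o_def lessThan_atLeast0)
  also have "\<dots> = \<Sum>\<^sub># (image_mset (\<lambda>x. x\<^sup>2) (eigenvalues_mset A))"
    unfolding eigenvalues_mset_def es proots_prod_linear diag by (simp flip: mset_map add: sum_mset_sum_list)
  finally show ?thesis ..
qed

subsection \<open>Moments and elementary inequalities\<close>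

text \<open>The cube serves where the argument is small, the square where only two moments are under
  control; the minimum keeps the choice open until an increment is split.\<close>

lemma cmod_iexp_quadratic:
  "cmod (iexp x - (1 + \<i> * x - x\<^sup>2 / 2)) \<le> min (x\<^sup>2) (\<bar>x\<bar> ^ 3)"
proof -
  have eq: "(\<Sum>k\<le>2. (\<i> * x)^k / fact k) = 1 + \<i> * x - x\<^sup>2 / 2"
    by (simp add: numeral_2_eq_2 power2_eq_square algebra_simps flip: mult.assoc)
  have "cmod (iexp x - (1 + \<i> * x - x\<^sup>2 / 2)) \<le> \<bar>x\<bar> ^ 3 / 6"
    using iexp_approx1[of x 2] unfolding eq by (simp add: fact_numeral)
  moreover have "\<bar>x\<bar> ^ 3 / 6 \<le> \<bar>x\<bar> ^ 3" by simp
  moreover have "cmod (iexp x - (1 + \<i> * x - x\<^sup>2 / 2)) \<le> x\<^sup>2"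
    using iexp_approx2[of x 2] unfolding eq by (simp add: fact_numeral)
  ultimately show ?thesis by linarith
qed

text \<open>The larger summand is at least half of the sum in absolute value and decides the case.
  So the truncated part of an increment may be cubed while the rest is only squared.\<close>

lemma min_square_cube_add:
  fixes a b :: real
  shows "min ((a + b)\<^sup>2) (\<bar>a + b\<bar> ^ 3) \<le> 8 * \<bar>a\<bar> ^ 3 + 4 * b\<^sup>2"
proof (cases "\<bar>b\<bar> \<le> \<bar>a\<bar>")
  case True
  then have "\<bar>a + b\<bar> ^ 3 \<le> (2 * \<bar>a\<bar>) ^ 3" by (intro power_mono) auto
  then have "\<bar>a + b\<bar> ^ 3 \<le> 8 * \<bar>a\<bar> ^ 3" by (simp add: power_mult_distrib)
  moreover have "0 \<le> 4 * b\<^sup>2" by simp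
  ultimately show ?thesis by linarith
next
  case False
  then have "\<bar>a + b\<bar> ^ 2 \<le> (2 * \<bar>b\<bar>) ^ 2" by (intro power_mono) auto
  then have "(a + b)\<^sup>2 \<le> 4 * b\<^sup>2" by (simp add: power_mult_distrib)
  moreover have "0 \<le> 8 * \<bar>a\<bar> ^ 3" by simp
  ultimately show ?thesis by linarith
qed

lemma exp_minus_quadratic:
  fixes u :: real assumes "0 \<le> u" shows "\<bar>exp (- u) - (1 - u)\<bar> \<le> u\<^sup>2 / 2"
proof -
  have 1: "1 - u \<le> exp (-u)" using exp_ge_add_one_self[of "-u"] by simp
  have "exp (-u) \<le> 1 - u + u\<^sup>2 / 2"
  proof -
      have "(\<lambda>x. 1 - x + x\<^sup>2/2 - exp (-x)) 0 \<le> (\<lambda>x. 1 - x + x\<^sup>2/2 - exp (-x)) u"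
      proof (rule DERIV_nonneg_imp_nondecreasing[OF assms])
        fix x :: real assume "0 \<le> x" "x \<le> u"
        have "((\<lambda>x. 1 - x + x\<^sup>2/2 - exp (-x)) has_real_derivative (-1 + x + exp (-x))) (at x)"
          by (auto intro!: derivative_eq_intros)
        moreover have "0 \<le> -1 + x + exp (-x)" using exp_ge_add_one_self[of "-x"] by simp
        ultimately show "\<exists>y. ((\<lambda>x. 1 - x + x\<^sup>2/2 - exp (-x)) has_real_derivative y) (at x) \<and> 0 \<le> y" by blast
      qed
    then show ?thesis by auto
  qed
  with 1 show ?thesis by simp
qed

lemma power_le_one_plus_power4:
  fixes x :: real assumes "k \<le> 4" shows "\<bar>x\<bar> ^ k \<le> 1 + x ^ 4"
proof (cases "\<bar>x\<bar> \<le> 1")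
  case True
  then have "\<bar>x\<bar> ^ k \<le> 1" by (simp add: power_le_one)
  then show ?thesis by (simp add: add_increasing2)
next
  case False
  then have "\<bar>x\<bar> ^ k \<le> \<bar>x\<bar> ^ 4" using assms by (intro power_increasing) auto
  then show ?thesis by simp
qed

lemma (in prob_space) integrable_power_le4:
  fixes f :: "'a \<Rightarrow> real"
  assumes [measurable]: "f \<in> borel_measurable M" and "integrable M (\<lambda>x. f x ^ 4)" "k \<le> 4"
  shows "integrable M (\<lambda>x. f x ^ k)"
proof (rule Bochner_Integration.integrable_bound)
  show "integrable M (\<lambda>x. 1 + f x ^ 4)" using assms by simp
  show "AE x in M. norm (f x ^ k) \<le> norm (1 + f x ^ 4)"
    using power_le_one_plus_power4[OF \<open>k \<le> 4\<close>] by (auto simp: power_abs abs_of_nonneg intro!: AE_I2)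
qed simp

lemma power4_add_le: "((a::real) + b) ^ 4 \<le> 8 * (a ^ 4 + b ^ 4)"
proof -
  have 1: "(a + b)\<^sup>2 \<le> 2 * (a\<^sup>2 + b\<^sup>2)"
    using zero_le_power2[of "a - b"] by (simp add: power2_eq_square algebra_simps)
  have 2: "(a\<^sup>2 + b\<^sup>2)\<^sup>2 \<le> 2 * ((a\<^sup>2)\<^sup>2 + (b\<^sup>2)\<^sup>2)"
    using zero_le_power2[of "a\<^sup>2 - b\<^sup>2"] by (simp add: power2_eq_square algebra_simps)
  have "(a + b) ^ 4 = ((a + b)\<^sup>2)\<^sup>2" by (simp flip: power_mult)
  also have "\<dots> \<le> (2 * (a\<^sup>2 + b\<^sup>2))\<^sup>2" using 1 by (intro power_mono) auto
  also have "\<dots> = 4 * (a\<^sup>2 + b\<^sup>2)\<^sup>2" by (simp only: power_mult_distrib) simp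
  also have "\<dots> \<le> 4 * (2 * ((a\<^sup>2)\<^sup>2 + (b\<^sup>2)\<^sup>2))" using 2 by simp
  finally show ?thesis by (simp flip: power_mult)
qed

text \<open>One induction serves all claims, because the step for the fourth power uses the lower
  moments of the partial sum. In the binomial expansion every mixed term with a first power
  vanishes; the term with two squares accumulates to the count of ordered pairs, times 3.\<close>

lemma (in prob_space) moments_sum_indep:
  fixes Y :: "'i \<Rightarrow> 'a \<Rightarrow> real"
  assumes "finite J" and "indep_vars (\<lambda>_. borel) Y J"
    and "\<And>j. j \<in> J \<Longrightarrow> integrable M (\<lambda>\<omega>. Y j \<omega> ^ 4)"
    and "\<And>j. j \<in> J \<Longrightarrow> expectation (Y j) = 0"
    and "\<And>j. j \<in> J \<Longrightarrow> expectation (\<lambda>\<omega>. (Y j \<omega>)\<^sup>2) = s"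
    and "\<And>j. j \<in> J \<Longrightarrow> expectation (\<lambda>\<omega>. Y j \<omega> ^ 4) = q"
  shows "integrable M (\<lambda>\<omega>. (\<Sum>j\<in>J. Y j \<omega>) ^ 4)"
    and "expectation (\<lambda>\<omega>. \<Sum>j\<in>J. Y j \<omega>) = 0"
    and "expectation (\<lambda>\<omega>. (\<Sum>j\<in>J. Y j \<omega>)\<^sup>2) = real (card J) * s"
    and "expectation (\<lambda>\<omega>. (\<Sum>j\<in>J. Y j \<omega>) ^ 4) =
           real (card J) * q + 3 * real (card J) * (real (card J) - 1) * s\<^sup>2"
proof -
  have "integrable M (\<lambda>\<omega>. (\<Sum>j\<in>J. Y j \<omega>) ^ 4) \<and> expectation (\<lambda>\<omega>. \<Sum>j\<in>J. Y j \<omega>) = 0 \<and>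
    expectation (\<lambda>\<omega>. (\<Sum>j\<in>J. Y j \<omega>)\<^sup>2) = real (card J) * s \<and>
    expectation (\<lambda>\<omega>. (\<Sum>j\<in>J. Y j \<omega>) ^ 4) =
           real (card J) * q + 3 * real (card J) * (real (card J) - 1) * s\<^sup>2"
    using assms
  proof (induction J rule: finite_induct)
    case empty
    then show ?case by simp
  next
    case (insert i F)
    let ?S = "\<lambda>\<omega>. \<Sum>j\<in>F. Y j \<omega>" and ?y = "Y i"
    have "indep_vars (\<lambda>_. borel) Y F"
      by (rule indep_vars_subset[OF insert.prems(1)]) auto
    then have IH: "integrable M (\<lambda>\<omega>. ?S \<omega> ^ 4)" "expectation ?S = 0"
      "expectation (\<lambda>\<omega>. (?S \<omega>)\<^sup>2) = real (card F) * s"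
      "expectation (\<lambda>\<omega>. ?S \<omega> ^ 4) = real (card F) * q + 3 * real (card F) * (real (card F) - 1) * s\<^sup>2"
      using insert.IH insert.prems by auto
    have rv: "random_variable borel (Y j)" if "j \<in> insert i F" for j
      using insert.prems(1) that unfolding indep_vars_def2 by auto
    have [measurable]: "random_variable borel ?y" "random_variable borel ?S"
      using rv by (auto intro!: borel_measurable_sum)
    have ind: "indep_var borel ?y borel ?S"
      using indep_vars_sum[OF insert.hyps(1,2) insert.prems(1)] .
    have iy: "integrable M (\<lambda>\<omega>. ?y \<omega> ^ k)" and iS: "integrable M (\<lambda>\<omega>. ?S \<omega> ^ k)" if "k \<le> 4" for k
      using that insert.prems(2)[of i] IH(1) by (auto intro!: integrable_power_le4)
    have prod: "integrable M (\<lambda>\<omega>. ?y \<omega> ^ k * ?S \<omega> ^ l)"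
      "expectation (\<lambda>\<omega>. ?y \<omega> ^ k * ?S \<omega> ^ l) = expectation (\<lambda>\<omega>. ?y \<omega> ^ k) * expectation (\<lambda>\<omega>. ?S \<omega> ^ l)"
      if "k \<le> 4" "l \<le> 4" for k l
    proof -
      have ind': "indep_var borel ((\<lambda>x. x ^ k) \<circ> ?y) borel ((\<lambda>x. x ^ l) \<circ> ?S)"
        by (rule indep_var_compose[OF ind]) auto
      show "integrable M (\<lambda>\<omega>. ?y \<omega> ^ k * ?S \<omega> ^ l)"
        using indep_var_integrable[OF ind'] iy[OF that(1)] iS[OF that(2)] by (simp add: o_def)
      show "expectation (\<lambda>\<omega>. ?y \<omega> ^ k * ?S \<omega> ^ l) = expectation (\<lambda>\<omega>. ?y \<omega> ^ k) * expectation (\<lambda>\<omega>. ?S \<omega> ^ l)"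
        using indep_var_lebesgue_integral[OF ind'] iy[OF that(1)] iS[OF that(2)] by (simp add: o_def)
    qed
    have ey: "expectation ?y = 0" "expectation (\<lambda>\<omega>. (?y \<omega>)\<^sup>2) = s" "expectation (\<lambda>\<omega>. ?y \<omega> ^ 4) = q"
      using insert.prems by auto
    have sum_eq: "(\<Sum>j\<in>insert i F. Y j \<omega>) = ?y \<omega> + ?S \<omega>" for \<omega>
      using insert.hyps by simp
    have "integrable M (\<lambda>\<omega>. (?y \<omega> + ?S \<omega>) ^ 4)"
    proof (rule Bochner_Integration.integrable_bound)
      show "integrable M (\<lambda>\<omega>. 8 * (?y \<omega> ^ 4 + ?S \<omega> ^ 4))" using iy[of 4] iS[of 4] by simp
      show "AE x in M. norm ((?y x + ?S x) ^ 4) \<le> norm (8 * (?y x ^ 4 + ?S x ^ 4))"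
        using power4_add_le by (auto intro!: AE_I2)
    qed simp
    moreover have "expectation (\<lambda>\<omega>. ?y \<omega> + ?S \<omega>) = 0"
      using iy[of 1] iS[of 1] ey IH(2) by simp
    moreover have "expectation (\<lambda>\<omega>. (?y \<omega> + ?S \<omega>)\<^sup>2) = real (card (insert i F)) * s"
    proof -
      have "(\<lambda>\<omega>. (?y \<omega> + ?S \<omega>)\<^sup>2) = (\<lambda>\<omega>. (?y \<omega>)\<^sup>2 + 2 * (?y \<omega> ^ 1 * ?S \<omega> ^ 1) + (?S \<omega>)\<^sup>2)"
        by (auto simp: power2_eq_square algebra_simps)
      moreover have "expectation \<dots> = s + 2 * (expectation (\<lambda>\<omega>. ?y \<omega> ^ 1 * ?S \<omega> ^ 1)) + real (card F) * s"
        using prod(1)[of 1 1] iy[of 2] iS[of 2] IH(3) ey(2) by simp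
      ultimately show ?thesis
        using prod(2)[of 1 1] ey IH(2) insert.hyps by (simp add: algebra_simps)
    qed
    moreover have "expectation (\<lambda>\<omega>. (?y \<omega> + ?S \<omega>) ^ 4) =
           real (card (insert i F)) * q + 3 * real (card (insert i F)) * (real (card (insert i F)) - 1) * s\<^sup>2"
    proof -
      have "(\<lambda>\<omega>. (?y \<omega> + ?S \<omega>) ^ 4) = (\<lambda>\<omega>. ?y \<omega> ^ 4 + 4 * (?y \<omega> ^ 3 * ?S \<omega> ^ 1) + 6 * (?y \<omega> ^ 2 * ?S \<omega> ^ 2)
          + 4 * (?y \<omega> ^ 1 * ?S \<omega> ^ 3) + ?S \<omega> ^ 4)"
        by (rule ext) (simp add: power2_eq_square power3_eq_cube power4_eq_xxxx algebra_simps)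
      moreover have "expectation \<dots> = q + 4 * expectation (\<lambda>\<omega>. ?y \<omega> ^ 3 * ?S \<omega> ^ 1)
          + 6 * expectation (\<lambda>\<omega>. ?y \<omega> ^ 2 * ?S \<omega> ^ 2) + 4 * expectation (\<lambda>\<omega>. ?y \<omega> ^ 1 * ?S \<omega> ^ 3)
          + expectation (\<lambda>\<omega>. ?S \<omega> ^ 4)"
        using prod(1)[of 3 1] prod(1)[of 2 2] prod(1)[of 1 3] iy[of 4] iS[of 4] ey(3) by simp
      ultimately have "expectation (\<lambda>\<omega>. (?y \<omega> + ?S \<omega>) ^ 4) = q + 6 * (s * (real (card F) * s)) +
          (real (card F) * q + 3 * real (card F) * (real (card F) - 1) * s\<^sup>2)"
        using prod(2)[of 3 1] prod(2)[of 2 2] prod(2)[of 1 3] ey IH by simp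
      then show ?thesis using insert.hyps by (simp add: power2_eq_square algebra_simps)
    qed
    ultimately show ?case unfolding sum_eq by blast
  qed
  then show "integrable M (\<lambda>\<omega>. (\<Sum>j\<in>J. Y j \<omega>) ^ 4)"
    and "expectation (\<lambda>\<omega>. \<Sum>j\<in>J. Y j \<omega>) = 0"
    and "expectation (\<lambda>\<omega>. (\<Sum>j\<in>J. Y j \<omega>)\<^sup>2) = real (card J) * s"
    and "expectation (\<lambda>\<omega>. (\<Sum>j\<in>J. Y j \<omega>) ^ 4) =
           real (card J) * q + 3 * real (card J) * (real (card J) - 1) * s\<^sup>2" by blast+
qed

lemma indep_vars_PiM_coordinates:
  assumes "\<And>i. prob_space (N i)"
  shows "prob_space.indep_vars (PiM I N) N (\<lambda>i x. x i) I"
\<comment> \<open>The characterization of independence by product laws asks for a nonempty index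
  set.\<close>
proof (cases "I = {}")
  case True
  interpret prob_space "PiM I N" by (rule prob_space_PiM) (rule assms)
  have "indep_vars N (\<lambda>i x. x i) {}" unfolding indep_vars_def indep_sets_def by auto
  then show ?thesis using True by simp
next
  case False
  interpret prob_space "PiM I N" by (rule prob_space_PiM) (rule assms)
  have "distr (PiM I N) (PiM I N) (\<lambda>x. \<lambda>i\<in>I. x i) = distr (PiM I N) (PiM I N) (\<lambda>x. x)"
    by (intro distr_cong) (auto simp: space_PiM PiE_restrict restrict_PiE_iff)
  also have "\<dots> = PiM I N" by (rule distr_id)
  also have "\<dots> = PiM I (\<lambda>i. distr (PiM I N) (N i) (\<lambda>x. x i))"
    using assms by (intro PiM_cong refl distr_PiM_component[symmetric]) auto
  finally show ?thesis
    using False by (subst indep_vars_iff_distr_eq_PiM') auto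
qed

lemma square_sum_le: "((r::real) + s)\<^sup>2 \<le> 2 * r\<^sup>2 + 2 * s\<^sup>2"
  using zero_le_power2[of "r - s"] by (simp add: power2_eq_square algebra_simps)

lemma integrable_bounded:
  fixes f :: "'c \<Rightarrow> 'd :: {banach, second_countable_topology}"
  assumes "prob_space Q" "f \<in> borel_measurable Q" "\<And>x. x \<in> space Q \<Longrightarrow> norm (f x) \<le> c"
  shows "integrable Q f"
  using assms by (intro finite_measure.integrable_const_bound[where B = c])
    (auto simp: prob_space.finite_measure intro!: AE_I2)

lemma integral_bounded:
  fixes f :: "'c \<Rightarrow> real"
  assumes "prob_space Q" "\<And>x. x \<in> space Q \<Longrightarrow> \<bar>f x\<bar> \<le> c" "0 \<le> c"
  shows "\<bar>\<integral>x. f x \<partial>Q\<bar> \<le> c"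
proof (cases "integrable Q f")
  case True
  interpret Q: prob_space Q by fact
  have "\<bar>\<integral>x. f x \<partial>Q\<bar> \<le> (\<integral>x. \<bar>f x\<bar> \<partial>Q)" by (rule integral_abs_bound)
  also have "\<dots> \<le> (\<integral>x. c \<partial>Q)" using True assms by (intro integral_mono) auto
  finally show ?thesis by (simp add: Q.prob_space)
next
  case False
  then show ?thesis using assms by (simp add: not_integrable_integral_eq)
qed

lemma integral_square_bounded:
  fixes f :: "'c \<Rightarrow> real"
  assumes "prob_space Q" "\<And>x. \<bar>f x\<bar> \<le> c"
  shows "norm (\<integral>x. (f x)\<^sup>2 \<partial>Q) \<le> c\<^sup>2"
  using power_mono[OF assms(2) abs_ge_zero, of _ 2]
  unfolding real_norm_def by (intro integral_bounded[OF assms(1)]) (auto simp del: abs_le_square_iff)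

lemma (in prob_space) expectation_abs_le_sqrt:
  fixes f :: "'a \<Rightarrow> real"
  assumes "f \<in> borel_measurable M" and "integrable M (\<lambda>x. (f x)\<^sup>2)"
  shows "expectation (\<lambda>x. \<bar>f x\<bar>) \<le> sqrt (expectation (\<lambda>x. (f x)\<^sup>2))"
proof -
  have i1: "integrable M (\<lambda>x. \<bar>f x\<bar>)"
    using square_integrable_imp_integrable[OF assms] by simp
  define a where "a = expectation (\<lambda>x. \<bar>f x\<bar>)"
  have "0 \<le> expectation (\<lambda>x. (\<bar>f x\<bar> - a)\<^sup>2)" by (intro integral_nonneg_AE AE_I2) auto
  also have "\<dots> = expectation (\<lambda>x. (f x)\<^sup>2 - 2 * a * \<bar>f x\<bar> + a\<^sup>2)"
    by (simp add: power2_diff algebra_simps)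
  also have "\<dots> = expectation (\<lambda>x. (f x)\<^sup>2) - a\<^sup>2"
    using i1 assms(2) by (simp add: prob_space a_def[symmetric] power2_eq_square)
  finally show ?thesis unfolding a_def[symmetric] by (intro real_le_rsqrt) simp
qed

lemma two_abs_mult_le:
  fixes u w l :: real
  assumes "0 < l"
  shows "2 * \<bar>u * w\<bar> \<le> l * u\<^sup>2 + w\<^sup>2 / l"
proof -
  have "0 \<le> (l * \<bar>u\<bar> - \<bar>w\<bar>)\<^sup>2 / l" using assms by simp
  also have "\<dots> = l * u\<^sup>2 + w\<^sup>2 / l - 2 * \<bar>u * w\<bar>"
    using assms by (simp add: power2_diff power_mult_distrib abs_mult field_simps power2_eq_square)
  finally show ?thesis by simp
qed

text \<open>Interpolates a third absolute moment between a second and a fourth one; the weight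
  \<open>l\<close> is left to be balanced later.\<close>

lemma abs_cube_le:
  fixes a l :: real assumes "0 < l" shows "\<bar>a\<bar> ^ 3 \<le> (l * a\<^sup>2 + a ^ 4 / l) / 2"
  using two_abs_mult_le[OF assms, of a "a\<^sup>2"]
  by (simp add: abs_mult power2_eq_square power3_eq_cube power4_eq_xxxx)

text \<open>The defect at step \<open>m\<close> is later multiplied only by factors of norm at most
  1, so the defects add up instead of being amplified.\<close>

lemma prod_telescope_bound:
  fixes a :: "nat \<Rightarrow> 'z :: real_normed_field"
  assumes "\<And>m. m < n \<Longrightarrow> norm (a (Suc m) - e m * a m) \<le> d" "\<And>m. norm (e m) \<le> 1"
  shows "norm (a n - (\<Prod>m<n. e m) * a 0) \<le> real n * d"
  using assms(1)
proof (induction n)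
  case 0
  then show ?case by simp
next
  case (Suc n)
  have "a (Suc n) - (\<Prod>m<Suc n. e m) * a 0 = (a (Suc n) - e n * a n) + e n * (a n - (\<Prod>m<n. e m) * a 0)"
    by (simp add: algebra_simps)
  also have "norm \<dots> \<le> norm (a (Suc n) - e n * a n) + norm (e n) * norm (a n - (\<Prod>m<n. e m) * a 0)"
    by (rule order.trans[OF norm_triangle_ineq]) (simp add: norm_mult)
  also have "\<dots> \<le> d + 1 * (real n * d)"
    using Suc assms(2) by (intro add_mono mult_mono) auto
  finally show ?case by (simp add: algebra_simps)
qed

lemma square_diff_le: "((r::real) - s)\<^sup>2 \<le> 2 * r\<^sup>2 + 2 * s\<^sup>2"
  using square_sum_le[of r "- s"] by simp

lemma (in prob_space) square_expectation_le:
  fixes f :: "'a \<Rightarrow> real"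
  assumes "integrable M f" "integrable M (\<lambda>x. (f x)\<^sup>2)"
  shows "(expectation f)\<^sup>2 \<le> expectation (\<lambda>x. (f x)\<^sup>2)"
  using variance_eq[OF assms] variance_positive[of f] by simp

lemma bounded_square: "\<bar>u\<bar> \<le> b \<Longrightarrow> norm (u\<^sup>2) \<le> b\<^sup>2" for u b :: real
  using power_mono[of "\<bar>u\<bar>" b 2] by simp

lemma integrable_square_sum:
  fixes f :: "'i \<Rightarrow> 'a \<Rightarrow> real"
  assumes "finite J" "\<And>j. j \<in> J \<Longrightarrow> f j \<in> borel_measurable M"
    and "\<And>j. j \<in> J \<Longrightarrow> integrable M (\<lambda>x. (f j x)\<^sup>2)"
  shows "integrable M (\<lambda>x. (\<Sum>j\<in>J. f j x)\<^sup>2)"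
  using assms
proof (induction J rule: finite_induct)
  case (insert i J)
  show ?case
  proof (rule Bochner_Integration.integrable_bound)
    show "integrable M (\<lambda>x. 2 * (f i x)\<^sup>2 + 2 * (\<Sum>j\<in>J. f j x)\<^sup>2)" using insert by auto
    show "AE x in M. norm ((\<Sum>j\<in>insert i J. f j x)\<^sup>2) \<le> norm (2 * (f i x)\<^sup>2 + 2 * (\<Sum>j\<in>J. f j x)\<^sup>2)"
      using insert(1,2) square_diff_le[of _ "- _"] by (auto intro!: AE_I2 simp: square_diff_le[of _ "- _", simplified])
    show "(\<lambda>x. (\<Sum>j\<in>insert i J. f j x)\<^sup>2) \<in> borel_measurable M"
      using insert.prems by (intro borel_measurable_power borel_measurable_sum) auto
  qed
qed auto

abbreviation above :: "real \<Rightarrow> real \<Rightarrow> real" where "above K u \<equiv> if K < u then u else 0"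

text \<open>Beyond \<open>2 * K\<close> at least half of \<open>u\<close> lies above
  \<open>K\<close>. The right-hand side is a full minus a truncated quantity, so a tail is
  controlled once both of these converge.\<close>

lemma tail_excess_le: "above (2 * K) u \<le> 2 * (u - min u K)" if "0 \<le> u" "0 \<le> K" for u K :: real
  using that by (auto simp: min_def)

subsection \<open>Degenerate U-statistics\<close>

text \<open>The bound \<open>b\<close> secures integrability throughout. In the application it grows
  with the dimension, so the final estimates are kept free of it.\<close>

locale degenerate_kernel = prob_space N for N :: "'b measure" +
  fixes H :: "'b \<Rightarrow> 'b \<Rightarrow> real" and b :: real
  assumes H_meas [measurable]: "case_prod H \<in> borel_measurable (N \<Otimes>\<^sub>M N)"
    and H_bounded: "\<And>x y. \<bar>H x y\<bar> \<le> b"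
    and H_sym: "\<And>x y. H x y = H y x"
    and H_degenerate: "\<And>x. x \<in> space N \<Longrightarrow> (\<integral>y. H x y \<partial>N) = 0"
begin

text \<open>\<open>G\<close> is the kernel of the square of the integral operator with kernel
  \<open>H\<close>. Hence \<open>v\<close> is the trace of the squared operator, which is the second
  moment of \<open>H\<close>, and \<open>g\<close> is the trace of its fourth power.\<close>

definition G :: "'b \<Rightarrow> 'b \<Rightarrow> real" where "G x y = (\<integral>z. H x z * H y z \<partial>N)"
definition v :: real where "v = (\<integral>x. G x x \<partial>N)"
definition w :: real where "w = (\<integral>x. (G x x - v)\<^sup>2 \<partial>N)"
definition g :: real where "g = (\<integral>x. \<integral>y. (G x y)\<^sup>2 \<partial>N \<partial>N)"
definition Htrunc :: "real \<Rightarrow> 'b \<Rightarrow> 'b \<Rightarrow> real" where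
  "Htrunc K x y = (if \<bar>H x y\<bar> \<le> K then H x y else 0)"
definition tail :: "real \<Rightarrow> real" where
  "tail K = (\<integral>x. \<integral>y. (H x y - Htrunc K x y)\<^sup>2 \<partial>N \<partial>N)"

abbreviation P :: "nat \<Rightarrow> (nat \<Rightarrow> 'b) measure" where "P m \<equiv> PiM {..<m} (\<lambda>_. N)"

text \<open>Ordering the points turns the U-statistic into a martingale: the increment pairs the new
  point \<open>y\<close> with the \<open>i\<close> earlier ones. The scale \<open>c\<close> will be
  \<open>1 / real n\<close> and stays fixed while points are added.\<close>

definition incr :: "real \<Rightarrow> nat \<Rightarrow> (nat \<Rightarrow> 'b) \<Rightarrow> 'b \<Rightarrow> real" where
  "incr c i x y = c * (\<Sum>j<i. H (x j) y)"
definition U :: "real \<Rightarrow> nat \<Rightarrow> (nat \<Rightarrow> 'b) \<Rightarrow> real" where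
  "U c m x = (\<Sum>k<m. incr c k x (x k))"

sublocale prodN: product_prob_space "\<lambda>_::nat. N" "UNIV" by unfold_locales
sublocale pairN: pair_prob_space N N by unfold_locales

lemma prob_space_P: "prob_space (P m)"
  by (rule prob_space_PiM) unfold_locales

lemma b_nonneg: "0 \<le> b"
  using H_bounded[of undefined undefined] by linarith

lemma H_meas' [measurable (raw)]:
  "f \<in> measurable M N \<Longrightarrow> h \<in> measurable M N \<Longrightarrow> (\<lambda>x. H (f x) (h x)) \<in> borel_measurable M"
  using measurable_compose[OF measurable_Pair H_meas] by simp

lemma G_meas [measurable]: "case_prod G \<in> borel_measurable (N \<Otimes>\<^sub>M N)"
  unfolding G_def by measurable

lemma G_meas' [measurable (raw)]:
  "f \<in> measurable M N \<Longrightarrow> h \<in> measurable M N \<Longrightarrow> (\<lambda>x. G (f x) (h x)) \<in> borel_measurable M"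
  using measurable_compose[OF measurable_Pair G_meas] by simp

lemma Htrunc_meas' [measurable (raw)]:
  assumes [measurable]: "f \<in> measurable M N" "h \<in> measurable M N"
  shows "(\<lambda>x. Htrunc K (f x) (h x)) \<in> borel_measurable M"
  unfolding Htrunc_def by measurable

lemma G_bounded: "\<bar>G x y\<bar> \<le> b\<^sup>2"
  unfolding G_def using H_bounded b_nonneg
  by (intro integral_bounded prob_space_axioms)
     (auto simp: abs_mult power2_eq_square intro!: mult_mono)

lemma G_degenerate: "x \<in> space N \<Longrightarrow> (\<integral>y. G x y \<partial>N) = 0"
proof -
  assume x: "x \<in> space N"
  have "(\<integral>y. G x y \<partial>N) = (\<integral>z. \<integral>y. H x z * H y z \<partial>N \<partial>N)"
    unfolding G_def
  proof (rule pairN.Fubini_integral)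
    show "integrable (N \<Otimes>\<^sub>M N) (\<lambda>(z, y). H x z * H y z)"
      using x H_bounded b_nonneg
      by (intro integrable_bounded[where c = "b * b"] pairN.prob_space_axioms)
         (auto simp: abs_mult intro!: mult_mono)
  qed
  also have "\<dots> = (\<integral>z. H x z * (\<integral>y. H z y \<partial>N) \<partial>N)"
    using H_sym by (simp add: H_sym)
  also have "\<dots> = (\<integral>z. 0 \<partial>N)"
    by (intro Bochner_Integration.integral_cong) (auto simp: H_degenerate)
  finally show ?thesis by simp
qed

lemma integral_P_Suc:
  fixes f :: "(nat \<Rightarrow> 'b) \<Rightarrow> 'd :: {banach, second_countable_topology}"
  assumes "f \<in> borel_measurable (P (Suc m))" "\<And>x. x \<in> space (P (Suc m)) \<Longrightarrow> norm (f x) \<le> c"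
  shows "(\<integral>x. f x \<partial>P (Suc m)) = (\<integral>x. \<integral>y. f (x(m := y)) \<partial>N \<partial>P m)"
proof -
  have "integrable (PiM (insert m {..<m}) (\<lambda>_. N)) f"
    using integrable_bounded[OF prob_space_P assms] by (simp add: lessThan_Suc)
  from prodN.product_integral_insert[OF _ _ this] show ?thesis by (simp add: lessThan_Suc)
qed

lemma moments_sum_P:
  fixes f :: "'b \<Rightarrow> real"
  assumes [measurable]: "f \<in> borel_measurable N" and bd: "\<And>x. \<bar>f x\<bar> \<le> c"
    and mean: "(\<integral>x. f x \<partial>N) = 0"
  shows "(\<integral>x. (\<Sum>j<m. f (x j))\<^sup>2 \<partial>P m) = real m * (\<integral>x. (f x)\<^sup>2 \<partial>N)"
    and "(\<integral>x. (\<Sum>j<m. f (x j)) ^ 4 \<partial>P m) =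
      real m * (\<integral>x. f x ^ 4 \<partial>N) + 3 * real m * (real m - 1) * (\<integral>x. (f x)\<^sup>2 \<partial>N)\<^sup>2"
proof -
  interpret P: prob_space "P m" by (rule prob_space_P)
  have comp: "(\<integral>x. h (x j) \<partial>P m) = (\<integral>x. h x \<partial>N)" if "j < m" "h \<in> borel_measurable N" for j and h :: "'b \<Rightarrow> real"
  proof -
    have "(\<integral>x. h x \<partial>distr (P m) N (\<lambda>x. x j)) = (\<integral>x. h (x j) \<partial>P m)"
      using that by (intro integral_distr) auto
    moreover have "distr (P m) N (\<lambda>x. x j) = N"
      using that prob_space_axioms by (intro distr_PiM_component) auto
    ultimately show ?thesis by simp
  qed
  have ind: "P.indep_vars (\<lambda>_. borel) (\<lambda>j x. f (x j)) {..<m}"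
  proof -
    have "P.indep_vars (\<lambda>_. N) (\<lambda>i x. x i) {..<m}"
      by (rule indep_vars_PiM_coordinates) (rule prob_space_axioms)
    then show ?thesis
      by (rule P.indep_vars_compose2[where Y = "\<lambda>_. f"]) auto
  qed
  have c: "0 \<le> c" using bd[of undefined] by linarith
  note * = P.moments_sum_indep[OF _ ind, where s = "\<integral>x. (f x)\<^sup>2 \<partial>N" and q = "\<integral>x. f x ^ 4 \<partial>N"]
  have int: "integrable (P m) (\<lambda>x. f (x j) ^ 4)" if "j < m" for j
  proof (rule integrable_bounded[where c = "c ^ 4", OF prob_space_P])
    show "norm (f (x j) ^ 4) \<le> c ^ 4" for x :: "nat \<Rightarrow> 'b"
      using power_mono[OF bd abs_ge_zero, of "x j" 4] by (simp add: power_abs)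
  qed (use that in auto)
  have comps: "(\<integral>x. f (x j) \<partial>P m) = 0" "(\<integral>x. (f (x j))\<^sup>2 \<partial>P m) = (\<integral>x. (f x)\<^sup>2 \<partial>N)"
    "(\<integral>x. f (x j) ^ 4 \<partial>P m) = (\<integral>x. f x ^ 4 \<partial>N)" if "j < m" for j
    using comp[OF that, of f] comp[OF that, of "\<lambda>x. (f x)\<^sup>2"] comp[OF that, of "\<lambda>x. f x ^ 4"] mean by auto
  show "(\<integral>x. (\<Sum>j<m. f (x j))\<^sup>2 \<partial>P m) = real m * (\<integral>x. (f x)\<^sup>2 \<partial>N)"
    using *(3) int comps by simp
  show "(\<integral>x. (\<Sum>j<m. f (x j)) ^ 4 \<partial>P m) =
      real m * (\<integral>x. f x ^ 4 \<partial>N) + 3 * real m * (real m - 1) * (\<integral>x. (f x)\<^sup>2 \<partial>N)\<^sup>2"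
    using *(4) int comps by simp
qed

lemma component_meas:
  assumes "X \<in> measurable Q (P m)" "j < m"
  shows "(\<lambda>q. X q j) \<in> measurable Q N"
  using measurable_compose[OF assms(1) measurable_component_singleton] assms(2) by simp

lemma incr_meas:
  assumes X: "X \<in> measurable Q (P m)" and Y: "Y \<in> measurable Q N" and "i \<le> m"
  shows "(\<lambda>q. incr c i (X q) (Y q)) \<in> borel_measurable Q"
  unfolding incr_def using \<open>i \<le> m\<close>
  by (intro borel_measurable_times borel_measurable_sum borel_measurable_const H_meas' Y component_meas[OF X]) auto

lemma U_meas:
  assumes X: "X \<in> measurable Q (P m)"
  shows "(\<lambda>q. U c m (X q)) \<in> borel_measurable Q"
  unfolding U_def
  by (intro borel_measurable_sum incr_meas[OF X] component_meas[OF X]) auto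

lemma U_Suc: "U c (Suc m) (x(m := y)) = U c m x + incr c m x y"
proof -
  have "incr c k (x(m := y)) z = incr c k x z" if "k \<le> m" for k z
    using that unfolding incr_def by (auto intro!: arg_cong[where f = "(*) c"] sum.cong)
  then show ?thesis unfolding U_def by (auto intro!: sum.cong)
qed

lemma incr_bounded: "\<bar>incr c i x y\<bar> \<le> \<bar>c\<bar> * (real i * b)"
  unfolding incr_def abs_mult
  by (intro mult_left_mono order.trans[OF sum_abs] order.trans[OF sum_bounded_above[where K = b]])
     (auto simp: H_bounded)

text \<open>Given the earlier points, degeneracy centres each summand, and multiplying out the
  square produces \<open>G\<close>. These are the conditional mean and the conditional variance of a
  martingale difference.\<close>

lemma integral_incr:
  assumes x: "x \<in> space (P m)"
  shows "(\<integral>y. incr c m x y \<partial>N) = 0"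
    and "(\<integral>y. (incr c m x y)\<^sup>2 \<partial>N) = c\<^sup>2 * (\<Sum>j<m. \<Sum>k<m. G (x j) (x k))"
proof -
  have xj [measurable]: "x j \<in> space N" if "j < m" for j
    using x that by (auto simp: space_PiM)
  have m: "(\<lambda>y. H (x j) y) \<in> borel_measurable N" if "j < m" for j
    using xj[OF that] by measurable
  have i1: "integrable N (\<lambda>y. H (x j) y)" if "j < m" for j
    using m[OF that] H_bounded by (intro integrable_bounded[where c = b] prob_space_axioms) auto
  have i2: "integrable N (\<lambda>y. H (x j) y * H (x k) y)" if "j < m" "k < m" for j k
    using m[OF that(1)] m[OF that(2)] H_bounded b_nonneg
    by (intro integrable_bounded[where c = "b * b"] prob_space_axioms) (auto simp: abs_mult intro!: mult_mono)
  show "(\<integral>y. incr c m x y \<partial>N) = 0"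
    unfolding incr_def using xj i1 H_degenerate by (simp add: Bochner_Integration.integral_sum)
  have "(\<integral>y. (incr c m x y)\<^sup>2 \<partial>N) = (\<integral>y. c\<^sup>2 * (\<Sum>j<m. \<Sum>k<m. H (x j) y * H (x k) y) \<partial>N)"
    unfolding incr_def power_mult_distrib by (simp add: power2_eq_square sum_product)
  also have "\<dots> = c\<^sup>2 * (\<Sum>j<m. \<Sum>k<m. G (x j) (x k))"
  proof -
    have "(\<integral>y. (\<Sum>j<m. \<Sum>k<m. H (x j) y * H (x k) y) \<partial>N) = (\<Sum>j<m. \<integral>y. (\<Sum>k<m. H (x j) y * H (x k) y) \<partial>N)"
      using i2 by (intro Bochner_Integration.integral_sum) auto
    also have "\<dots> = (\<Sum>j<m. \<Sum>k<m. G (x j) (x k))"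
      unfolding G_def using i2 by (intro sum.cong refl Bochner_Integration.integral_sum) auto
    finally show ?thesis by simp
  qed
  finally show "(\<integral>y. (incr c m x y)\<^sup>2 \<partial>N) = c\<^sup>2 * (\<Sum>j<m. \<Sum>k<m. G (x j) (x k))" .
qed

section \<open>Fluctuation of the conditional variances\<close>

definition R :: "nat \<Rightarrow> (nat \<Rightarrow> 'b) \<Rightarrow> real" where
  "R m x = (\<Sum>j<m. \<Sum>k<m. G (x j) (x k)) - real m * v"

lemma R_meas:
  assumes X: "X \<in> measurable Q (P m)"
  shows "(\<lambda>q. R m (X q)) \<in> borel_measurable Q"
  unfolding R_def
  by (intro borel_measurable_diff borel_measurable_sum borel_measurable_const G_meas' component_meas[OF X]) auto

lemma G_sym: "G x y = G y x"
  unfolding G_def by (simp add: mult.commute)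

lemma v_bounded: "\<bar>v\<bar> \<le> b\<^sup>2"
  unfolding v_def using G_bounded by (intro integral_bounded prob_space_axioms) auto

lemma v_nonneg: "0 \<le> v"
  unfolding v_def G_def by (intro integral_nonneg_AE AE_I2) auto

lemma R_bounded: "\<bar>R m x\<bar> \<le> real m * (real m * b\<^sup>2) + real m * b\<^sup>2"
proof -
  have "\<bar>\<Sum>j<m. \<Sum>k<m. G (x j) (x k)\<bar> \<le> (\<Sum>j<m. \<Sum>k<m. b\<^sup>2)"
    by (intro order.trans[OF sum_abs] sum_mono order.trans[OF sum_abs]) (simp add: G_bounded)
  moreover have "\<bar>real m * v\<bar> \<le> real m * b\<^sup>2"
    using v_bounded by (simp add: abs_mult mult_left_mono)
  ultimately show ?thesis unfolding R_def by simp
qed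

lemma R_Suc: "R (Suc m) (x(m := y)) = R m x + (2 * (\<Sum>j<m. G (x j) y) + (G y y - v))"
proof -
  have "(\<Sum>j<m. \<Sum>k<m. G ((x(m := y)) j) ((x(m := y)) k)) = (\<Sum>j<m. \<Sum>k<m. G (x j) (x k))"
    by (intro sum.cong) auto
  moreover have "(\<Sum>j<m. G ((x(m := y)) j) y) = (\<Sum>j<m. G (x j) y)" by (intro sum.cong) auto
  moreover have "(\<Sum>j<m. G y ((x(m := y)) j)) = (\<Sum>j<m. G (x j) y)" by (intro sum.cong) (auto simp: G_sym)
  ultimately show ?thesis unfolding R_def by (simp add: sum.distrib algebra_simps)
qed

lemma Fubini_P:
  fixes f :: "(nat \<Rightarrow> 'b) \<Rightarrow> 'b \<Rightarrow> real"
  assumes "case_prod f \<in> borel_measurable (P m \<Otimes>\<^sub>M N)" "\<And>x y. \<bar>f x y\<bar> \<le> c"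
  shows "(\<integral>x. \<integral>y. f x y \<partial>N \<partial>P m) = (\<integral>y. \<integral>x. f x y \<partial>P m \<partial>N)"
proof -
  interpret P: prob_space "P m" by (rule prob_space_P)
  interpret PN: pair_prob_space "P m" N by unfold_locales
  show ?thesis
    by (rule PN.Fubini_integral[symmetric])
       (use assms in \<open>auto intro!: integrable_bounded[where c = c] PN.prob_space_axioms simp: split_beta\<close>)
qed

text \<open>Up to the factor \<open>c\<^sup>2\<close>, \<open>R m\<close> is the conditional
  variance of an increment minus its mean; off-diagonal terms average out because \<open>G\<close>
  is degenerate as well. It is itself a martingale in \<open>m\<close>: its increment
  \<open>L\<close> is centred given the past, so second moments add, and at most
  \<open>8 * m * g + 2 * w\<close> is added per step.\<close>

lemma R_second_moment: "(\<integral>x. (R m x)\<^sup>2 \<partial>P m) \<le> 2 * real m * w + 4 * (real m)\<^sup>2 * g"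
proof (induction m)
  case 0
  then show ?case by (simp add: R_def)
next
  case (Suc m)
  interpret P: prob_space "P m" by (rule prob_space_P)
  define L where "L x y = 2 * (\<Sum>j<m. G (x j) y) + (G y y - v)" for x y
  define c where "c = 2 * (real m * b\<^sup>2) + 2 * b\<^sup>2"
  have L_bd: "\<bar>L x y\<bar> \<le> c" for x y
  proof -
    have "\<bar>\<Sum>j<m. G (x j) y\<bar> \<le> real m * b\<^sup>2"
      using sum_bounded_above[of "{..<m}" "\<lambda>j. \<bar>G (x j) y\<bar>" "b\<^sup>2"]
      by (intro order.trans[OF sum_abs]) (auto simp: G_bounded)
    then show ?thesis using G_bounded[of y y] v_bounded unfolding L_def c_def by linarith
  qed
  have c0: "0 \<le> c" using L_bd[of undefined undefined] by linarith
  define d where "d = real m * (real m * b\<^sup>2) + real m * b\<^sup>2"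
  have R_bd: "\<bar>R m x\<bar> \<le> d" for x unfolding d_def by (rule R_bounded)
  have d0: "0 \<le> d" using R_bd[of undefined] by linarith
  have sq_bd: "\<bar>r\<^sup>2\<bar> \<le> e\<^sup>2" if "\<bar>r\<bar> \<le> e" for r e :: real
    using power_mono[OF that abs_ge_zero, of 2] by simp
  have SG_meas: "(\<lambda>q. \<Sum>j<m. G (X q j) (Y q)) \<in> borel_measurable Q"
    if "X \<in> measurable Q (P m)" "Y \<in> measurable Q N" for X Y and Q :: "'z measure"
    using that by (intro borel_measurable_sum G_meas' component_meas[OF that(1)]) auto
  have L_meas: "(\<lambda>q. L (X q) (Y q)) \<in> borel_measurable Q"
    if "X \<in> measurable Q (P m)" "Y \<in> measurable Q N" for X Y and Q :: "'z measure"
    unfolding L_def using SG_meas[OF that] that(2) by measurable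
  have "(\<integral>x. (R (Suc m) x)\<^sup>2 \<partial>P (Suc m)) = (\<integral>x. \<integral>y. (R (Suc m) (x(m := y)))\<^sup>2 \<partial>N \<partial>P m)"
    using sq_bd[OF R_bounded[of "Suc m"]] R_meas[of "\<lambda>x. x"] by (intro integral_P_Suc) auto
  also have "\<dots> = (\<integral>x. (R m x)\<^sup>2 + (\<integral>y. (L x y)\<^sup>2 \<partial>N) \<partial>P m)"
  proof (intro Bochner_Integration.integral_cong refl)
    fix x assume x: "x \<in> space (P m)"
    then have xj: "x j \<in> space N" if "j < m" for j using that by (auto simp: space_PiM)
    have Lm [measurable]: "(\<lambda>y. L x y) \<in> borel_measurable N"
      using x by (intro L_meas) auto
    have i1: "integrable N (L x)" "integrable N (\<lambda>y. (L x y)\<^sup>2)"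
      using L_bd sq_bd[OF L_bd] by (auto intro!: integrable_bounded prob_space_axioms)
    have iG: "integrable N (\<lambda>y. G (x j) y)" if "j < m" for j
      using xj[OF that] G_bounded by (intro integrable_bounded prob_space_axioms) auto
    have iGG: "integrable N (\<lambda>y. G y y)"
      using G_bounded by (intro integrable_bounded prob_space_axioms) auto
    have "(\<integral>y. (\<Sum>j<m. G (x j) y) \<partial>N) = (\<Sum>j<m. \<integral>y. G (x j) y \<partial>N)"
      using iG by (intro Bochner_Integration.integral_sum) auto
    also have "\<dots> = 0" using xj G_degenerate by simp
    finally have "(\<integral>y. (\<Sum>j<m. G (x j) y) \<partial>N) = 0" .
    moreover have "(\<integral>y. L x y \<partial>N) = 2 * (\<integral>y. (\<Sum>j<m. G (x j) y) \<partial>N) + ((\<integral>y. G y y \<partial>N) - v)"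
    proof -
      have "integrable N (\<lambda>y. \<Sum>j<m. G (x j) y)" using iG by (intro Bochner_Integration.integrable_sum) auto
      then show ?thesis unfolding L_def using iGG
        by (simp add: prob_space del: Bochner_Integration.integral_sum)
    qed
    ultimately have "(\<integral>y. L x y \<partial>N) = 0" by (simp add: v_def)
    moreover have "(\<integral>y. (R (Suc m) (x(m := y)))\<^sup>2 \<partial>N)
        = (\<integral>y. (R m x)\<^sup>2 + 2 * R m x * L x y + (L x y)\<^sup>2 \<partial>N)"
      unfolding R_Suc L_def[symmetric] by (simp add: power2_sum algebra_simps)
    ultimately show "(\<integral>y. (R (Suc m) (x(m := y)))\<^sup>2 \<partial>N) = (R m x)\<^sup>2 + (\<integral>y. (L x y)\<^sup>2 \<partial>N)"
      using i1 by (simp add: prob_space)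
  qed
  also have "\<dots> = (\<integral>x. (R m x)\<^sup>2 \<partial>P m) + (\<integral>x. \<integral>y. (L x y)\<^sup>2 \<partial>N \<partial>P m)"
  proof (intro Bochner_Integration.integral_add)
    show "integrable (P m) (\<lambda>x. (R m x)\<^sup>2)"
      using sq_bd[OF R_bd] R_meas[of "\<lambda>x. x"] by (intro integrable_bounded prob_space_P) auto
    have [measurable]: "(\<lambda>q. L (fst q) (snd q)) \<in> borel_measurable (P m \<Otimes>\<^sub>M N)"
      by (intro L_meas) auto
    show "integrable (P m) (\<lambda>x. \<integral>y. (L x y)\<^sup>2 \<partial>N)"
      by (rule integrable_bounded[OF prob_space_P _ integral_square_bounded[OF prob_space_axioms L_bd]])
         measurable
  qed
  \<comment> \<open>With the new point \<open>y\<close> fixed first, the sum over the past consists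
    of independent centred terms and its second moment is additive.\<close>
  also have "(\<integral>x. \<integral>y. (L x y)\<^sup>2 \<partial>N \<partial>P m) = (\<integral>y. \<integral>x. (L x y)\<^sup>2 \<partial>P m \<partial>N)"
    using sq_bd[OF L_bd] L_meas[of fst _ snd] by (intro Fubini_P) (auto simp: split_beta)
  also have "\<dots> \<le> (\<integral>y. 8 * (real m * (\<integral>z. (G z y)\<^sup>2 \<partial>N)) + 2 * (G y y - v)\<^sup>2 \<partial>N)"
  proof (rule integral_mono)
    have [measurable]: "(\<lambda>q. L (snd q) (fst q)) \<in> borel_measurable (N \<Otimes>\<^sub>M P m)"
      by (intro L_meas) auto
    show "integrable N (\<lambda>y. \<integral>x. (L x y)\<^sup>2 \<partial>P m)"
      by (rule integrable_bounded[OF prob_space_axioms _ integral_square_bounded[OF prob_space_P L_bd]])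
         measurable
    have "integrable N (\<lambda>y. \<integral>z. (G z y)\<^sup>2 \<partial>N)"
      by (rule integrable_bounded[OF prob_space_axioms _ integral_square_bounded[OF prob_space_axioms G_bounded]])
         measurable
    moreover have "integrable N (\<lambda>y. (G y y - v)\<^sup>2)"
    proof (intro integrable_bounded[where c = "(2 * b\<^sup>2)\<^sup>2"] prob_space_axioms)
      show "norm ((G y y - v)\<^sup>2) \<le> (2 * b\<^sup>2)\<^sup>2" for y
        unfolding real_norm_def by (rule sq_bd) (use G_bounded[of y y] v_bounded in linarith)
    qed auto
    ultimately show "integrable N (\<lambda>y. 8 * (real m * (\<integral>z. (G z y)\<^sup>2 \<partial>N)) + 2 * (G y y - v)\<^sup>2)"
      by simp
    fix y assume y: "y \<in> space N"
    have [measurable]: "(\<lambda>x. \<Sum>j<m. G (x j) y) \<in> borel_measurable (P m)"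
      using y by (intro SG_meas) auto
    have SG_bd: "\<bar>\<Sum>j<m. G (x j) y\<bar> \<le> real m * b\<^sup>2" for x
      using sum_bounded_above[of "{..<m}" "\<lambda>j. \<bar>G (x j) y\<bar>" "b\<^sup>2"]
      by (intro order.trans[OF sum_abs]) (auto simp: G_bounded)
    have iS: "integrable (P m) (\<lambda>x. (\<Sum>j<m. G (x j) y)\<^sup>2)"
      using sq_bd[OF SG_bd] by (intro integrable_bounded prob_space_P) auto
    have "(\<integral>x. (L x y)\<^sup>2 \<partial>P m) \<le> (\<integral>x. 8 * (\<Sum>j<m. G (x j) y)\<^sup>2 + 2 * (G y y - v)\<^sup>2 \<partial>P m)"
    proof (rule integral_mono)
      show "integrable (P m) (\<lambda>x. (L x y)\<^sup>2)"
        using sq_bd[OF L_bd] L_meas[of "\<lambda>x. x" _ "\<lambda>_. y"] y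
        by (intro integrable_bounded prob_space_P) auto
      show "integrable (P m) (\<lambda>x. 8 * (\<Sum>j<m. G (x j) y)\<^sup>2 + 2 * (G y y - v)\<^sup>2)"
        using iS by simp
      show "(L x y)\<^sup>2 \<le> 8 * (\<Sum>j<m. G (x j) y)\<^sup>2 + 2 * (G y y - v)\<^sup>2" for x
        using square_sum_le[of "2 * (\<Sum>j<m. G (x j) y)" "G y y - v"] unfolding L_def
        by (simp add: power_mult_distrib)
    qed
    also have "\<dots> = 8 * (\<integral>x. (\<Sum>j<m. G (x j) y)\<^sup>2 \<partial>P m) + 2 * (G y y - v)\<^sup>2"
      using iS by (simp add: P.prob_space)
    also have "(\<integral>x. (\<Sum>j<m. G (x j) y)\<^sup>2 \<partial>P m) = real m * (\<integral>z. (G z y)\<^sup>2 \<partial>N)"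
      using y G_degenerate[OF y] G_bounded by (intro moments_sum_P) (auto simp: G_sym)
    finally show "(\<integral>x. (L x y)\<^sup>2 \<partial>P m) \<le> 8 * (real m * (\<integral>z. (G z y)\<^sup>2 \<partial>N)) + 2 * (G y y - v)\<^sup>2" .
  qed
  also have "\<dots> = 8 * real m * g + 2 * w"
  proof -
    have "integrable N (\<lambda>y. \<integral>z. (G z y)\<^sup>2 \<partial>N)"
      by (rule integrable_bounded[OF prob_space_axioms _ integral_square_bounded[OF prob_space_axioms G_bounded]])
         measurable
    moreover have "integrable N (\<lambda>y. (G y y - v)\<^sup>2)"
    proof (intro integrable_bounded[where c = "(2 * b\<^sup>2)\<^sup>2"] prob_space_axioms)
      show "norm ((G y y - v)\<^sup>2) \<le> (2 * b\<^sup>2)\<^sup>2" for y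
        unfolding real_norm_def by (rule sq_bd) (use G_bounded[of y y] v_bounded in linarith)
    qed auto
    moreover have "(\<integral>y. \<integral>z. (G z y)\<^sup>2 \<partial>N \<partial>N) = g" unfolding g_def by (simp add: G_sym)
    ultimately show ?thesis by (simp add: w_def)
  qed
  finally have "(\<integral>x. (R (Suc m) x)\<^sup>2 \<partial>P (Suc m)) \<le> (\<integral>x. (R m x)\<^sup>2 \<partial>P m) + (8 * real m * g + 2 * w)"
    by simp
  moreover have "0 \<le> g" unfolding g_def by (intro integral_nonneg_AE AE_I2) auto
  ultimately show ?case using Suc.IH by (simp add: power2_eq_square algebra_simps)
qed

text \<open>
  Truncating \<open>H\<close> destroys its centring, so both parts are recentred in the variable that is summed over.
\<close>

lemma tail_bound_pointwise:
  fixes K :: real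
  assumes y: "y \<in> space N"
  defines "H' \<equiv> \<lambda>x. Htrunc K x y - (\<integral>z. Htrunc K z y \<partial>N)"
    and "H'' \<equiv> \<lambda>x. H x y - Htrunc K x y + (\<integral>z. Htrunc K z y \<partial>N)"
  assumes K: "0 \<le> K"
  shows "H' \<in> borel_measurable N" "H'' \<in> borel_measurable N"
    and "\<And>x. \<bar>H' x\<bar> \<le> 2 * K" "\<And>x. \<bar>H'' x\<bar> \<le> b + 2 * K"
    and "(\<integral>x. H' x \<partial>N) = 0" "(\<integral>x. H'' x \<partial>N) = 0"
    and "(\<integral>x. (H' x)\<^sup>2 \<partial>N) \<le> K\<^sup>2" "(\<integral>x. (H' x) ^ 4 \<partial>N) \<le> 16 * K ^ 4"
    and "(\<integral>x. (H'' x)\<^sup>2 \<partial>N) \<le> (\<integral>x. (H x y - Htrunc K x y)\<^sup>2 \<partial>N)"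
proof -
  have T_bd: "\<bar>Htrunc K x z\<bar> \<le> K" for x z unfolding Htrunc_def using K by auto
  have D_bd: "\<bar>H x z - Htrunc K x z\<bar> \<le> b" for x z
    unfolding Htrunc_def using H_bounded[of x z] b_nonneg by auto
  define \<mu> where "\<mu> = (\<integral>z. Htrunc K z y \<partial>N)"
  have mu_bd: "\<bar>\<mu>\<bar> \<le> K" unfolding \<mu>_def using T_bd K by (intro integral_bounded prob_space_axioms)
  have meas [measurable]: "(\<lambda>x. Htrunc K x y) \<in> borel_measurable N" "(\<lambda>x. H x y) \<in> borel_measurable N"
    using y by measurable
  have iT: "integrable N (\<lambda>x. Htrunc K x y)" using T_bd by (intro integrable_bounded prob_space_axioms) auto
  have iH: "integrable N (\<lambda>x. H x y)" using H_bounded by (intro integrable_bounded prob_space_axioms) auto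
  have sq_bd: "\<bar>r\<^sup>2\<bar> \<le> e\<^sup>2" if "\<bar>r\<bar> \<le> e" for r e :: real
    using power_mono[OF that abs_ge_zero, of 2] by simp
  have iT2: "integrable N (\<lambda>x. (Htrunc K x y)\<^sup>2)"
    using sq_bd[OF T_bd] by (intro integrable_bounded prob_space_axioms) auto
  have iD2: "integrable N (\<lambda>x. (H x y - Htrunc K x y)\<^sup>2)"
    using sq_bd[OF D_bd] by (intro integrable_bounded prob_space_axioms) auto
  have H0: "(\<integral>x. H x y \<partial>N) = 0" using H_degenerate[OF y] by (simp add: H_sym)
  show m1: "H' \<in> borel_measurable N" "H'' \<in> borel_measurable N"
    unfolding H'_def H''_def by measurable
  show b1: "\<bar>H' x\<bar> \<le> 2 * K" for x
    using T_bd[of x y] mu_bd unfolding H'_def \<mu>_def[symmetric] by linarith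
  show b2: "\<bar>H'' x\<bar> \<le> b + 2 * K" for x
    using D_bd[of x y] mu_bd K unfolding H''_def \<mu>_def[symmetric] by linarith
  show "(\<integral>x. H' x \<partial>N) = 0" "(\<integral>x. H'' x \<partial>N) = 0"
    unfolding H'_def H''_def using iT iH H0 by (auto simp: prob_space)
  have "(\<integral>x. (H' x)\<^sup>2 \<partial>N) = (\<integral>x. (Htrunc K x y)\<^sup>2 - 2 * \<mu> * Htrunc K x y + \<mu>\<^sup>2 \<partial>N)"
    unfolding H'_def \<mu>_def[symmetric] by (simp add: power2_diff algebra_simps)
  also have "\<dots> = (\<integral>x. (Htrunc K x y)\<^sup>2 \<partial>N) - \<mu>\<^sup>2"
    using iT iT2 by (simp add: prob_space \<mu>_def[symmetric] power2_eq_square)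
  also have "\<dots> \<le> (\<integral>x. (Htrunc K x y)\<^sup>2 \<partial>N)" by simp
  also have "\<dots> \<le> (\<integral>x. K\<^sup>2 \<partial>N)"
    using iT2 sq_bd[OF T_bd] by (intro integral_mono) auto
  finally show "(\<integral>x. (H' x)\<^sup>2 \<partial>N) \<le> K\<^sup>2" by (simp add: prob_space)
  have q: "\<bar>H' x ^ 4\<bar> \<le> (2 * K) ^ 4" for x
    using power_mono[OF b1 abs_ge_zero, of x 4] by (simp add: power_abs)
  have "(\<integral>x. H' x ^ 4 \<partial>N) \<le> (\<integral>x. (2 * K) ^ 4 \<partial>N)"
    using q m1(1) by (intro integral_mono integrable_bounded[OF prob_space_axioms]) (auto intro: abs_le_D1)
  then show "(\<integral>x. H' x ^ 4 \<partial>N) \<le> 16 * K ^ 4" by (simp add: prob_space power_mult_distrib)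
  have mD: "(\<integral>x. H x y - Htrunc K x y \<partial>N) = - \<mu>" using iT iH H0 by (simp add: \<mu>_def)
  have "(\<integral>x. (H'' x)\<^sup>2 \<partial>N) = (\<integral>x. (H x y - Htrunc K x y)\<^sup>2 + 2 * \<mu> * (H x y - Htrunc K x y) + \<mu>\<^sup>2 \<partial>N)"
    unfolding H''_def \<mu>_def[symmetric] by (simp add: power2_eq_square algebra_simps)
  also have "\<dots> = (\<integral>x. (H x y - Htrunc K x y)\<^sup>2 \<partial>N) + 2 * \<mu> * (\<integral>x. H x y - Htrunc K x y \<partial>N) + \<mu>\<^sup>2"
    using iT iH iD2 by (simp add: prob_space)
  also have "\<dots> \<le> (\<integral>x. (H x y - Htrunc K x y)\<^sup>2 \<partial>N)"
    unfolding mD by (simp add: power2_eq_square)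
  finally show "(\<integral>x. (H'' x)\<^sup>2 \<partial>N) \<le> (\<integral>x. (H x y - Htrunc K x y)\<^sup>2 \<partial>N)" .
qed

text \<open>For fixed \<open>y\<close> the truncated and the remaining part of the increment are
  sums of independent centred terms. The cube of the first is interpolated between its second and
  fourth moment, which \<open>K\<close> bounds; the square of the second costs
  \<open>tail K\<close>. After \<open>n\<close> steps this leaves a multiple of
  \<open>(K\<^sup>2 + K ^ 4) / sqrt n\<close> and one of \<open>tail K\<close>, to be made small by
  sending first \<open>n\<close> and then \<open>K\<close> to infinity.\<close>

lemma Lindeberg_bound:
  assumes n: "0 < n" "m \<le> n" and K: "0 \<le> K"
  shows "(\<integral>x. \<integral>y. min ((t * incr (1 / real n) m x y)\<^sup>2) (\<bar>t * incr (1 / real n) m x y\<bar> ^ 3) \<partial>N \<partial>P m)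
    \<le> 80 * \<bar>t\<bar> ^ 3 * (K\<^sup>2 + K ^ 4) / (real n * sqrt (real n)) + 4 * t\<^sup>2 * tail K / real n"
proof -
  interpret P: prob_space "P m" by (rule prob_space_P)
  define c where "c = 1 / real n"
  have c0: "0 < c" using n by (simp add: c_def)
  \<comment> \<open>This weight balances the two moments: \<open>l * c^2 * n\<close> and
    \<open>c^4 / l * n^2\<close> are both of order \<open>n^(-3/2)\<close>.\<close>
  define l where "l = 1 / sqrt (real n)"
  have l0: "0 < l" using n by (simp add: l_def)
  define F where "F x y = min ((t * incr c m x y)\<^sup>2) (\<bar>t * incr c m x y\<bar> ^ 3)" for x y
  define \<tau> where "\<tau> y = (\<integral>x. (H x y - Htrunc K x y)\<^sup>2 \<partial>N)" for y
  define C where "C = 80 * \<bar>t\<bar> ^ 3 * (K\<^sup>2 + K ^ 4) / (real n * sqrt (real n))"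
  define e where "e = \<bar>t\<bar> * (\<bar>c\<bar> * (real m * b))"
  have ti_bd: "\<bar>t * incr c m x y\<bar> \<le> e" for x y
    unfolding e_def abs_mult[of t] by (intro mult_left_mono incr_bounded) auto
  have F_bd: "\<bar>F x y\<bar> \<le> e\<^sup>2" for x y
  proof -
    have "(t * incr c m x y)\<^sup>2 \<le> e\<^sup>2" using power_mono[OF ti_bd abs_ge_zero, of x y 2] by simp
    moreover have "0 \<le> F x y" unfolding F_def by auto
    ultimately show ?thesis unfolding F_def by auto
  qed
  have F_meas: "(\<lambda>q. F (X q) (Y q)) \<in> borel_measurable Q"
    if "X \<in> measurable Q (P m)" "Y \<in> measurable Q N" for X Y and Q :: "'z measure"
    unfolding F_def using incr_meas[OF that order_refl, of c] by measurable
  have D_bd: "\<bar>H x z - Htrunc K x z\<bar> \<le> b" for x z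
    unfolding Htrunc_def using H_bounded[of x z] b_nonneg by auto
  have D2_bd: "\<bar>(H x z - Htrunc K x z)\<^sup>2\<bar> \<le> b\<^sup>2" for x z
    using power_mono[OF D_bd abs_ge_zero, of x z 2] by simp
  have main: "(\<integral>x. F x y \<partial>P m) \<le> C + 4 * t\<^sup>2 / real n * \<tau> y" if y: "y \<in> space N" for y
  proof -
    define H' where "H' x = Htrunc K x y - (\<integral>z. Htrunc K z y \<partial>N)" for x
    define H'' where "H'' x = H x y - Htrunc K x y + (\<integral>z. Htrunc K z y \<partial>N)" for x
    note tb = tail_bound_pointwise[OF y K, folded H'_def H''_def]
    define A where "A x = (\<Sum>j<m. H' (x j))" for x :: "nat \<Rightarrow> 'b"
    define B where "B x = (\<Sum>j<m. H'' (x j))" for x :: "nat \<Rightarrow> 'b"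
    have A_meas [measurable]: "A \<in> borel_measurable (P m)" and B_meas [measurable]: "B \<in> borel_measurable (P m)"
      unfolding A_def B_def using tb(1,2) by (auto intro!: borel_measurable_sum)
    have A_bd: "\<bar>A x\<bar> \<le> real m * (2 * K)" for x
      unfolding A_def using sum_bounded_above[of "{..<m}" "\<lambda>j. \<bar>H' (x j)\<bar>" "2 * K"]
      by (intro order.trans[OF sum_abs]) (auto simp: tb(3))
    have B_bd: "\<bar>B x\<bar> \<le> real m * (b + 2 * K)" for x
      unfolding B_def using sum_bounded_above[of "{..<m}" "\<lambda>j. \<bar>H'' (x j)\<bar>" "b + 2 * K"]
      by (intro order.trans[OF sum_abs]) (auto simp: tb(4))
    have iA2: "integrable (P m) (\<lambda>x. (A x)\<^sup>2)" and iA4: "integrable (P m) (\<lambda>x. A x ^ 4)"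
      using power_mono[OF A_bd abs_ge_zero, of _ 2] power_mono[OF A_bd abs_ge_zero, of _ 4]
      by (auto intro!: integrable_bounded prob_space_P simp: power_abs)
    have iB2: "integrable (P m) (\<lambda>x. (B x)\<^sup>2)"
      using power_mono[OF B_bd abs_ge_zero, of _ 2] by (auto intro!: integrable_bounded prob_space_P)
    have A2: "(\<integral>x. (A x)\<^sup>2 \<partial>P m) \<le> real n * K\<^sup>2"
    proof -
      have "(\<integral>x. (A x)\<^sup>2 \<partial>P m) = real m * (\<integral>x. (H' x)\<^sup>2 \<partial>N)"
        unfolding A_def by (rule moments_sum_P[OF tb(1,3,5)])
      also have "\<dots> \<le> real n * K\<^sup>2" using n tb(7) by (intro mult_mono) auto
      finally show ?thesis .
    qed
    \<comment> \<open>The crude bound \<open>m \<le> n^2\<close> lets the 16 from single terms join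
      the 3 from pairs, which gives 19.\<close>
    have A4: "(\<integral>x. A x ^ 4 \<partial>P m) \<le> 19 * (real n)\<^sup>2 * K ^ 4"
    proof -
      have "(\<integral>x. A x ^ 4 \<partial>P m) = real m * (\<integral>x. H' x ^ 4 \<partial>N) + 3 * real m * (real m - 1) * (\<integral>x. (H' x)\<^sup>2 \<partial>N)\<^sup>2"
        unfolding A_def by (rule moments_sum_P[OF tb(1,3,5)])
      also have "\<dots> \<le> (real n)\<^sup>2 * (16 * K ^ 4) + 3 * (real n * real n) * (K\<^sup>2)\<^sup>2"
      proof (intro add_mono)
        have "real m \<le> real n * real n" using n mult_mono[of 1 "real n" "real m" "real n"] by auto
        then show "real m * (\<integral>x. H' x ^ 4 \<partial>N) \<le> (real n)\<^sup>2 * (16 * K ^ 4)"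
          using tb(8) by (intro mult_mono) (auto simp: power2_eq_square)
        have "(\<integral>x. (H' x)\<^sup>2 \<partial>N)\<^sup>2 \<le> (K\<^sup>2)\<^sup>2" using tb(7) by (intro power_mono) auto
        moreover have "3 * real m * (real m - 1) \<le> 3 * (real n * real n)"
          using n mult_mono[of "real m" "real n" "real m - 1" "real n"] by (cases "m = 0") (simp_all add: mult.assoc)
        ultimately show "3 * real m * (real m - 1) * (\<integral>x. (H' x)\<^sup>2 \<partial>N)\<^sup>2 \<le> 3 * (real n * real n) * (K\<^sup>2)\<^sup>2"
          by - (rule mult_mono, auto)
      qed
      finally show ?thesis by (simp add: power2_eq_square power4_eq_xxxx mult_ac)
    qed
    have B2: "(\<integral>x. (B x)\<^sup>2 \<partial>P m) \<le> real n * \<tau> y"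
    proof -
      have "(\<integral>x. (B x)\<^sup>2 \<partial>P m) = real m * (\<integral>x. (H'' x)\<^sup>2 \<partial>N)"
        unfolding B_def by (rule moments_sum_P[OF tb(2,4,6)])
      also have "\<dots> \<le> real n * \<tau> y" using n tb(9) unfolding \<tau>_def by (intro mult_mono) auto
      finally show ?thesis .
    qed
    have F_le: "F x y \<le> 4 * \<bar>t\<bar> ^ 3 * (l * c\<^sup>2 * (A x)\<^sup>2 + c ^ 4 / l * A x ^ 4) + 4 * t\<^sup>2 * c\<^sup>2 * (B x)\<^sup>2" for x
    proof -
      have AB: "incr c m x y = c * A x + c * B x"
      proof -
        have "(\<Sum>j<m. H (x j) y) = (\<Sum>j<m. H' (x j) + H'' (x j))" by (simp add: H'_def H''_def)
        then show ?thesis unfolding incr_def A_def B_def sum.distrib by (simp add: distrib_left)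
      qed
      have "F x y \<le> 8 * \<bar>t * (c * A x)\<bar> ^ 3 + 4 * (t * (c * B x))\<^sup>2"
        unfolding F_def AB distrib_left by (rule min_square_cube_add)
      also have "\<bar>t * (c * A x)\<bar> ^ 3 = \<bar>t\<bar> ^ 3 * \<bar>c * A x\<bar> ^ 3"
        by (simp add: abs_mult power_mult_distrib)
      also have "8 * (\<bar>t\<bar> ^ 3 * \<bar>c * A x\<bar> ^ 3) \<le> 8 * (\<bar>t\<bar> ^ 3 * ((l * (c * A x)\<^sup>2 + (c * A x) ^ 4 / l) / 2))"
        using abs_cube_le[OF l0, of "c * A x"] by (intro mult_left_mono) auto
      also have "\<dots> = 4 * \<bar>t\<bar> ^ 3 * (l * (c * A x)\<^sup>2 + (c * A x) ^ 4 / l)" by simp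
      finally show ?thesis by (simp add: power_mult_distrib mult.assoc)
    qed
    have "(\<integral>x. F x y \<partial>P m) \<le>
      (\<integral>x. 4 * \<bar>t\<bar> ^ 3 * (l * c\<^sup>2 * (A x)\<^sup>2 + c ^ 4 / l * A x ^ 4) + 4 * t\<^sup>2 * c\<^sup>2 * (B x)\<^sup>2 \<partial>P m)"
    proof (rule integral_mono)
      show "integrable (P m) (\<lambda>x. F x y)"
        using F_bd F_meas[of "\<lambda>x. x" "P m" "\<lambda>_. y"] y by (intro integrable_bounded prob_space_P) auto
    qed (use iA2 iA4 iB2 F_le in auto)
    also have "\<dots> = 4 * \<bar>t\<bar> ^ 3 * (l * c\<^sup>2 * (\<integral>x. (A x)\<^sup>2 \<partial>P m) + c ^ 4 / l * (\<integral>x. A x ^ 4 \<partial>P m))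
        + 4 * t\<^sup>2 * c\<^sup>2 * (\<integral>x. (B x)\<^sup>2 \<partial>P m)"
      using iA2 iA4 iB2 by simp
    also have "\<dots> \<le> 4 * \<bar>t\<bar> ^ 3 * (l * c\<^sup>2 * (real n * K\<^sup>2) + c ^ 4 / l * (19 * (real n)\<^sup>2 * K ^ 4))
        + 4 * t\<^sup>2 * c\<^sup>2 * (real n * \<tau> y)"
      using A2 A4 B2 l0 c0 by (intro add_mono mult_left_mono) auto
    also have "l * c\<^sup>2 * (real n * K\<^sup>2) = K\<^sup>2 / (real n * sqrt (real n))"
      using n by (simp add: l_def c_def power2_eq_square)
    also have "c ^ 4 / l * (19 * (real n)\<^sup>2 * K ^ 4) = 19 * K ^ 4 / (real n * sqrt (real n))"
    proof -
      define r where "r = sqrt (real n)"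
      have r: "0 < r" "real n = r * r" using n by (auto simp: r_def)
      show ?thesis unfolding c_def l_def r_def[symmetric] unfolding r(2)
        using r(1) by (simp add: power2_eq_square power4_eq_xxxx)
    qed
    also have "4 * t\<^sup>2 * c\<^sup>2 * (real n * \<tau> y) = 4 * t\<^sup>2 / real n * \<tau> y"
      using n by (simp add: c_def power2_eq_square)
    also have "4 * \<bar>t\<bar> ^ 3 * (K\<^sup>2 / (real n * sqrt (real n)) + 19 * K ^ 4 / (real n * sqrt (real n))) \<le> C"
    proof -
      have "4 * \<bar>t\<bar> ^ 3 * (K\<^sup>2 + 19 * K ^ 4) \<le> 4 * \<bar>t\<bar> ^ 3 * (20 * (K\<^sup>2 + K ^ 4))"
        by (intro mult_left_mono) auto
      also have "\<dots> = 80 * \<bar>t\<bar> ^ 3 * (K\<^sup>2 + K ^ 4)" by simp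
      finally have "4 * \<bar>t\<bar> ^ 3 * (K\<^sup>2 + 19 * K ^ 4) / (real n * sqrt (real n)) \<le> C"
        unfolding C_def by (rule divide_right_mono) auto
      then show ?thesis by (simp only: add_divide_distrib[symmetric] times_divide_eq_right)
    qed
    finally show ?thesis by simp
  qed
  have \<tau>_int: "integrable N \<tau>"
    unfolding \<tau>_def
    by (rule integrable_bounded[OF prob_space_axioms _ integral_square_bounded[OF prob_space_axioms D_bd]])
       measurable
  have [measurable]: "(\<lambda>q. F (snd q) (fst q)) \<in> borel_measurable (N \<Otimes>\<^sub>M P m)"
    by (intro F_meas) auto
  have "(\<integral>x. \<integral>y. F x y \<partial>N \<partial>P m) = (\<integral>y. \<integral>x. F x y \<partial>P m \<partial>N)"
    using F_bd F_meas[of fst "P m \<Otimes>\<^sub>M N" snd] by (intro Fubini_P) (auto simp: split_beta)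
  also have "\<dots> \<le> (\<integral>y. C + 4 * t\<^sup>2 / real n * \<tau> y \<partial>N)"
  proof (rule integral_mono)
    have "norm (\<integral>x. F x y \<partial>P m) \<le> e\<^sup>2" for y
      unfolding real_norm_def using F_bd by (intro integral_bounded prob_space_P) auto
    then show "integrable N (\<lambda>y. \<integral>x. F x y \<partial>P m)"
      by (intro integrable_bounded[OF prob_space_axioms]) measurable
  qed (use \<tau>_int main in auto)
  also have "\<dots> = C + 4 * t\<^sup>2 / real n * (\<integral>y. \<tau> y \<partial>N)"
    using \<tau>_int by (simp add: prob_space)
  also have "(\<integral>y. \<tau> y \<partial>N) = tail K"
  proof -
    have "(\<lambda>x. (H x y - Htrunc K x y)\<^sup>2) = (\<lambda>x. (H y x - Htrunc K y x)\<^sup>2)" for y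
      unfolding Htrunc_def by (rule ext) (simp only: H_sym[of _ y])
    then show ?thesis unfolding \<tau>_def tail_def by simp
  qed
  finally show ?thesis unfolding F_def c_def C_def by simp
qed

text \<open>Three replacements are paid for: the exponential by its quadratic Taylor polynomial,
  whose mean is known exactly; the conditional variance by its mean, at the price of
  \<open>R\<close>; and \<open>1 - u\<close> by \<open>exp (- u)\<close>.\<close>

lemma char_increment:
  assumes x: "x \<in> space (P m)"
  shows "cmod ((CLINT y|N. iexp (t * incr c m x y)) - complex_of_real (exp (- (t\<^sup>2 * (c\<^sup>2 * (real m * v)) / 2))))
    \<le> t\<^sup>2 / 2 * c\<^sup>2 * \<bar>R m x\<bar>
      + (\<integral>y. min ((t * incr c m x y)\<^sup>2) (\<bar>t * incr c m x y\<bar> ^ 3) \<partial>N)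
      + t ^ 4 * (c\<^sup>2 * (real m * v))\<^sup>2 / 8"
proof -
  define d where "d y = t * incr c m x y" for y
  define e where "e = \<bar>t\<bar> * (\<bar>c\<bar> * (real m * b))"
  have d_bd: "\<bar>d y\<bar> \<le> e" for y
    unfolding d_def e_def abs_mult[of t] by (intro mult_left_mono incr_bounded) auto
  have d2_bd: "\<bar>(d y)\<^sup>2\<bar> \<le> e\<^sup>2" for y
    using power_mono[OF d_bd abs_ge_zero, of y 2] by simp
  have [measurable]: "d \<in> borel_measurable N"
    unfolding d_def using x incr_meas[of "\<lambda>_. x" N m "\<lambda>y. y" m c] by measurable
  have i1: "integrable N d" and i2: "integrable N (\<lambda>y. (d y)\<^sup>2)"
    using d_bd d2_bd by (auto intro!: integrable_bounded prob_space_axioms)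
  define \<tau> where "\<tau> = c\<^sup>2 * (real m * v)"
  define \<sigma> where "\<sigma> = c\<^sup>2 * (\<Sum>j<m. \<Sum>k<m. G (x j) (x k))"
  have "(\<integral>y. d y \<partial>N) = 0" unfolding d_def using integral_incr(1)[OF x] by simp
  moreover have "(\<integral>y. (d y)\<^sup>2 \<partial>N) = t\<^sup>2 * \<sigma>"
    unfolding d_def power_mult_distrib \<sigma>_def using integral_incr(2)[OF x] by simp
  ultimately have quad: "(CLINT y|N. 1 + \<i> * d y - (d y)\<^sup>2 / 2) = complex_of_real (1 - t\<^sup>2 * \<sigma> / 2)"
  proof -
    have "(CLINT y|N. 1 + \<i> * d y - (d y)\<^sup>2 / 2) = (CLINT y|N. 1 + \<i> * d y) - (CLINT y|N. complex_of_real ((d y)\<^sup>2 / 2))"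
      using i1 integrable_of_real[OF i2, where 'a = complex]
      by (subst Bochner_Integration.integral_diff[symmetric]) auto
    also have "(CLINT y|N. 1 + \<i> * d y) = 1 + \<i> * complex_of_real (\<integral>y. d y \<partial>N)"
      using i1 by (subst Bochner_Integration.integral_add) (auto simp: prob_space)
    also have "(CLINT y|N. complex_of_real ((d y)\<^sup>2 / 2)) = complex_of_real ((\<integral>y. (d y)\<^sup>2 \<partial>N) / 2)"
      by (subst integral_complex_of_real) simp
    finally show ?thesis using \<open>(\<integral>y. d y \<partial>N) = 0\<close> \<open>(\<integral>y. (d y)\<^sup>2 \<partial>N) = t\<^sup>2 * \<sigma>\<close> by simp
  qed
  have iq: "integrable N (\<lambda>y. 1 + \<i> * complex_of_real (d y) - complex_of_real ((d y)\<^sup>2) / 2)"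
    using i1 i2 by (auto intro!: integrable_of_real simp del: of_real_power)
  have ie: "integrable N (\<lambda>y. iexp (d y))"
    by (intro integrable_bounded[where c = 1] prob_space_axioms) auto
  have "cmod ((CLINT y|N. iexp (d y)) - complex_of_real (1 - t\<^sup>2 * \<sigma> / 2))
      = cmod (CLINT y|N. iexp (d y) - (1 + \<i> * d y - (d y)\<^sup>2 / 2))"
    unfolding quad[symmetric] using ie iq by (subst Bochner_Integration.integral_diff) auto
  also have "\<dots> \<le> (\<integral>y. cmod (iexp (d y) - (1 + \<i> * d y - (d y)\<^sup>2 / 2)) \<partial>N)"
    by (rule integral_norm_bound)
  also have "\<dots> \<le> (\<integral>y. min ((d y)\<^sup>2) (\<bar>d y\<bar> ^ 3) \<partial>N)"
  proof (rule integral_mono)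
    show "integrable N (\<lambda>y. cmod (iexp (d y) - (1 + \<i> * d y - (d y)\<^sup>2 / 2)))"
      using ie iq by (auto intro!: integrable_norm)
    have "norm (min ((d y)\<^sup>2) (\<bar>d y\<bar> ^ 3)) \<le> e\<^sup>2" for y
      using d2_bd[of y] by (auto simp: min_def abs_if split: if_splits)
    then show "integrable N (\<lambda>y. min ((d y)\<^sup>2) (\<bar>d y\<bar> ^ 3))"
      by (intro integrable_bounded[OF prob_space_axioms]) measurable
  qed (rule cmod_iexp_quadratic)
  finally have 1: "cmod ((CLINT y|N. iexp (d y)) - complex_of_real (1 - t\<^sup>2 * \<sigma> / 2))
      \<le> (\<integral>y. min ((d y)\<^sup>2) (\<bar>d y\<bar> ^ 3) \<partial>N)" .
  have "\<sigma> - \<tau> = c\<^sup>2 * R m x" unfolding \<sigma>_def \<tau>_def R_def by (simp add: algebra_simps)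
  then have "(1 - t\<^sup>2 * \<sigma> / 2) - (1 - t\<^sup>2 * \<tau> / 2) = - (t\<^sup>2 / 2 * c\<^sup>2 * R m x)"
    by (simp add: algebra_simps flip: right_diff_distrib)
  then have f1: "\<bar>(1 - t\<^sup>2 * \<sigma> / 2) - (1 - t\<^sup>2 * \<tau> / 2)\<bar> = t\<^sup>2 / 2 * c\<^sup>2 * \<bar>R m x\<bar>"
    by (simp add: abs_mult)
  have f2: "\<bar>exp (- (t\<^sup>2 * \<tau> / 2)) - (1 - t\<^sup>2 * \<tau> / 2)\<bar> \<le> (t\<^sup>2 * \<tau> / 2)\<^sup>2 / 2"
    using v_nonneg by (intro exp_minus_quadratic) (auto simp: \<tau>_def)
  then have "\<bar>(1 - t\<^sup>2 * \<sigma> / 2) - exp (- (t\<^sup>2 * \<tau> / 2))\<bar> \<le> t\<^sup>2 / 2 * c\<^sup>2 * \<bar>R m x\<bar> + t ^ 4 * \<tau>\<^sup>2 / 8"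
  proof -
    have "(t\<^sup>2 * \<tau> / 2)\<^sup>2 / 2 = t ^ 4 * \<tau>\<^sup>2 / 8" by (simp add: power_mult_distrib power_divide)
    then show ?thesis using f1 f2 by linarith
  qed
  then have 2: "cmod (complex_of_real (1 - t\<^sup>2 * \<sigma> / 2) - complex_of_real (exp (- (t\<^sup>2 * \<tau> / 2))))
      \<le> t\<^sup>2 / 2 * c\<^sup>2 * \<bar>R m x\<bar> + t ^ 4 * \<tau>\<^sup>2 / 8"
    by (simp only: of_real_diff[symmetric] norm_of_real)
  show ?thesis
    using norm_triangle_ineq[of "(CLINT y|N. iexp (d y)) - complex_of_real (1 - t\<^sup>2 * \<sigma> / 2)"
        "complex_of_real (1 - t\<^sup>2 * \<sigma> / 2) - complex_of_real (exp (- (t\<^sup>2 * \<tau> / 2)))"] 1 2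
    unfolding d_def \<tau>_def by simp
qed

text \<open>The Gaussian factor is deterministic, so it can be taken out of the expectation over the
  past, and \<open>iexp (t * U)\<close> has modulus 1 and disappears from the error. The bound is
  uniform in \<open>m\<close> and carries a factor \<open>1 / real n\<close>, as \<open>n\<close>
  such errors will be added.\<close>

lemma char_step:
  fixes t K :: real
  assumes n: "0 < n" "m < n" and K: "0 \<le> K"
  defines "\<phi> \<equiv> \<lambda>m. (CLINT x|P m. iexp (t * U (1 / real n) m x))"
  shows "cmod (\<phi> (Suc m) - complex_of_real (exp (- (t\<^sup>2 * (real m * v / (real n)\<^sup>2) / 2))) * \<phi> m)
    \<le> (t\<^sup>2 / 2 * sqrt (2 * w / real n + 4 * g) + 80 * \<bar>t\<bar> ^ 3 * (K\<^sup>2 + K ^ 4) / sqrt (real n)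
       + 4 * t\<^sup>2 * tail K + t ^ 4 * v\<^sup>2 / (8 * real n)) / real n"
proof -
  interpret P: prob_space "P m" by (rule prob_space_P)
  define c where "c = 1 / real n"
  define E where "E = exp (- (t\<^sup>2 * (c\<^sup>2 * (real m * v)) / 2))"
  define \<psi> where "\<psi> x = (CLINT y|N. iexp (t * incr c m x y))" for x
  define J where "J x = (\<integral>y. min ((t * incr c m x y)\<^sup>2) (\<bar>t * incr c m x y\<bar> ^ 3) \<partial>N)" for x
  have Um [measurable]: "U c m \<in> borel_measurable (P m)" using U_meas[of "\<lambda>x. x" "P m" m c] by simp
  have Im [measurable]: "(\<lambda>q. incr c m (fst q) (snd q)) \<in> borel_measurable (P m \<Otimes>\<^sub>M N)"
    by (intro incr_meas[of _ _ m]) auto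
  have \<psi>m [measurable]: "\<psi> \<in> borel_measurable (P m)"
    unfolding \<psi>_def by measurable
  have Rm [measurable]: "R m \<in> borel_measurable (P m)" using R_meas[of "\<lambda>x. x" "P m" m] by simp
  have \<psi>_bd: "cmod (\<psi> x) \<le> 1" for x
  proof (cases "integrable N (\<lambda>y. iexp (t * incr c m x y))")
    case True
    have "cmod (\<psi> x) \<le> (\<integral>y. cmod (iexp (t * incr c m x y)) \<partial>N)"
      unfolding \<psi>_def by (rule integral_norm_bound)
    then show ?thesis by (simp add: prob_space)
  next
    case False
    then show ?thesis by (simp add: \<psi>_def not_integrable_integral_eq)
  qed
  have "\<phi> (Suc m) = (CLINT x|P m. CLINT y|N. iexp (t * U c (Suc m) (x(m := y))))"
    unfolding \<phi>_def c_def[symmetric] using U_meas[of "\<lambda>x. x" "P (Suc m)" "Suc m" c]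
    by (intro integral_P_Suc[where c = 1]) auto
  also have "\<dots> = (CLINT x|P m. iexp (t * U c m x) * \<psi> x)"
    unfolding \<psi>_def U_Suc by (simp add: distrib_left exp_add)
  finally have "\<phi> (Suc m) - complex_of_real E * \<phi> m = (CLINT x|P m. iexp (t * U c m x) * \<psi> x - E * iexp (t * U c m x))"
    unfolding \<phi>_def c_def[symmetric] using \<psi>_bd
    by (subst Bochner_Integration.integral_diff)
       (auto intro!: integrable_bounded[where c = 1] prob_space_P integrable_mult_right simp: norm_mult)
  also have "\<dots> = (CLINT x|P m. iexp (t * U c m x) * (\<psi> x - E))"
    by (simp add: algebra_simps)
  also have "cmod \<dots> \<le> (\<integral>x. cmod (iexp (t * U c m x) * (\<psi> x - E)) \<partial>P m)"
    by (rule integral_norm_bound)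
  also have "\<dots> = (\<integral>x. cmod (\<psi> x - E) \<partial>P m)" by (simp add: norm_mult)
  also have "\<dots> \<le> t\<^sup>2 / 2 * c\<^sup>2 * (\<integral>x. \<bar>R m x\<bar> \<partial>P m) + (\<integral>x. J x \<partial>P m) + t ^ 4 * (c\<^sup>2 * (real m * v))\<^sup>2 / 8"
  proof -
    have iR: "integrable (P m) (\<lambda>x. \<bar>R m x\<bar>)"
      using R_bounded by (intro integrable_bounded prob_space_P) auto
    define e where "e = \<bar>t\<bar> * (\<bar>c\<bar> * (real m * b))"
    have "\<bar>min ((t * incr c m x y)\<^sup>2) (\<bar>t * incr c m x y\<bar> ^ 3)\<bar> \<le> e\<^sup>2" for x y
    proof -
      have "\<bar>t * incr c m x y\<bar> \<le> e"
        unfolding e_def abs_mult[of t] by (intro mult_left_mono incr_bounded) auto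
      from power_mono[OF this abs_ge_zero, of 2] show ?thesis
        by (auto simp: min_def split: if_splits)
    qed
    then have "norm (J x) \<le> e\<^sup>2" for x
      unfolding J_def real_norm_def by (intro integral_bounded prob_space_axioms) auto
    then have iJ: "integrable (P m) J"
      unfolding J_def by (intro integrable_bounded[OF prob_space_P]) measurable
    have i\<psi>: "integrable (P m) (\<lambda>x. cmod (\<psi> x - E))"
      using \<psi>_bd by (intro integrable_norm Bochner_Integration.integrable_diff integrable_bounded[where c = 1 and f = \<psi>] prob_space_P) auto
    have "(\<integral>x. cmod (\<psi> x - E) \<partial>P m) \<le> (\<integral>x. t\<^sup>2 / 2 * c\<^sup>2 * \<bar>R m x\<bar> + J x + t ^ 4 * (c\<^sup>2 * (real m * v))\<^sup>2 / 8 \<partial>P m)"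
      using i\<psi> iR iJ char_increment[of _ m t c] unfolding \<psi>_def E_def J_def
      by (intro integral_mono) auto
    also have "\<dots> = t\<^sup>2 / 2 * c\<^sup>2 * (\<integral>x. \<bar>R m x\<bar> \<partial>P m) + (\<integral>x. J x \<partial>P m) + t ^ 4 * (c\<^sup>2 * (real m * v))\<^sup>2 / 8"
      using iR iJ by (simp add: P.prob_space)
    finally show ?thesis .
  qed
  finally have main: "cmod (\<phi> (Suc m) - complex_of_real E * \<phi> m) \<le>
    t\<^sup>2 / 2 * c\<^sup>2 * (\<integral>x. \<bar>R m x\<bar> \<partial>P m) + (\<integral>x. J x \<partial>P m) + t ^ 4 * (c\<^sup>2 * (real m * v))\<^sup>2 / 8" .
  have g0: "0 \<le> g" and w0: "0 \<le> w" unfolding g_def w_def by (intro integral_nonneg_AE AE_I2; simp)+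
  \<comment> \<open>Only the first moment of \<open>R\<close> enters, bounded by the root of the
    second one; replacing \<open>m\<close> by \<open>n\<close> makes the bound the same for all
    steps.\<close>
  have "(\<integral>x. \<bar>R m x\<bar> \<partial>P m) \<le> real n * sqrt (2 * w / real n + 4 * g)"
  proof -
    have "integrable (P m) (\<lambda>x. (R m x)\<^sup>2)"
      using power_mono[OF R_bounded abs_ge_zero, of m _ 2] by (intro integrable_bounded prob_space_P) auto
    then have "(\<integral>x. \<bar>R m x\<bar> \<partial>P m) \<le> sqrt (\<integral>x. (R m x)\<^sup>2 \<partial>P m)"
      by (intro P.expectation_abs_le_sqrt) auto
    also have "\<dots> \<le> sqrt ((real n)\<^sup>2 * (2 * w / real n + 4 * g))"
    proof (intro real_sqrt_le_mono order.trans[OF R_second_moment])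
      have "2 * real m * w \<le> 2 * real n * w" using n w0 by (intro mult_right_mono) auto
      moreover have "4 * (real m)\<^sup>2 * g \<le> 4 * (real n)\<^sup>2 * g" using n g0 by (intro mult_right_mono) auto
      ultimately show "2 * real m * w + 4 * (real m)\<^sup>2 * g \<le> (real n)\<^sup>2 * (2 * w / real n + 4 * g)"
        using n by (simp add: power2_eq_square distrib_left)
    qed
    also have "\<dots> = real n * sqrt (2 * w / real n + 4 * g)"
      by (simp add: real_sqrt_mult)
    finally show ?thesis .
  qed
  then have "t\<^sup>2 / 2 * c\<^sup>2 * (\<integral>x. \<bar>R m x\<bar> \<partial>P m) \<le> t\<^sup>2 / 2 * c\<^sup>2 * (real n * sqrt (2 * w / real n + 4 * g))"
    by (intro mult_left_mono) auto
  also have "\<dots> = (t\<^sup>2 / 2 * sqrt (2 * w / real n + 4 * g)) / real n"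
    using n by (simp add: c_def power2_eq_square)
  finally have 1: "t\<^sup>2 / 2 * c\<^sup>2 * (\<integral>x. \<bar>R m x\<bar> \<partial>P m) \<le> \<dots>" .
  have 2: "(\<integral>x. J x \<partial>P m) \<le> 80 * \<bar>t\<bar> ^ 3 * (K\<^sup>2 + K ^ 4) / sqrt (real n) / real n + 4 * t\<^sup>2 * tail K / real n"
    using Lindeberg_bound[of n m K t] n K unfolding J_def c_def by (simp add: mult.commute)
  have "real m * v \<le> real n * v" using n v_nonneg by (intro mult_right_mono) auto
  then have "(c\<^sup>2 * (real m * v))\<^sup>2 \<le> (c\<^sup>2 * (real n * v))\<^sup>2"
    using v_nonneg by (intro power_mono mult_left_mono) auto
  then have "t ^ 4 * (c\<^sup>2 * (real m * v))\<^sup>2 / 8 \<le> t ^ 4 * (c\<^sup>2 * (real n * v))\<^sup>2 / 8"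
    by (intro divide_right_mono mult_left_mono) auto
  also have "\<dots> = t ^ 4 * v\<^sup>2 / (8 * real n) / real n"
    using n by (simp add: c_def power2_eq_square)
  finally have 3: "t ^ 4 * (c\<^sup>2 * (real m * v))\<^sup>2 / 8 \<le> \<dots>" .
  have "E = exp (- (t\<^sup>2 * (real m * v / (real n)\<^sup>2) / 2))"
    unfolding E_def c_def by (simp add: power_divide)
  then show ?thesis using main 1 2 3 by (simp add: add_divide_distrib)
qed

text \<open>
  Hall's conditions are visible on the right-hand side: \<open>w = o(n)\<close>, \<open>g = o(1)\<close>, and a Lindeberg
  condition in place of his fourth moment of \<open>H\<close>.
\<close>

lemma char_bound:
  assumes n: "0 < n" and K: "0 \<le> K"
  shows "cmod ((CLINT x|P n. iexp (t * U (1 / real n) n x)) - complex_of_real (exp (- (t\<^sup>2 * (v * (real n - 1) / (2 * real n)) / 2))))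
    \<le> t\<^sup>2 / 2 * sqrt (2 * w / real n + 4 * g) + 80 * \<bar>t\<bar> ^ 3 * (K\<^sup>2 + K ^ 4) / sqrt (real n)
       + 4 * t\<^sup>2 * tail K + t ^ 4 * v\<^sup>2 / (8 * real n)" (is "_ \<le> ?B")
proof -
  define \<phi> where "\<phi> m = (CLINT x|P m. iexp (t * U (1 / real n) m x))" for m
  define e where "e m = exp (- (t\<^sup>2 * (real m * v / (real n)\<^sup>2) / 2))" for m
  have "cmod (\<phi> n - (\<Prod>m<n. complex_of_real (e m)) * \<phi> 0) \<le> real n * (?B / real n)"
    using char_step[OF n _ K, of _ t] v_nonneg unfolding \<phi>_def e_def
    by (intro prod_telescope_bound) auto
  moreover have "\<phi> 0 = 1"
  proof -
    interpret P: prob_space "PiM {} (\<lambda>_::nat. N)" using prob_space_P[of 0] by simp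
    show ?thesis unfolding \<phi>_def U_def by (simp add: P.prob_space)
  qed
  \<comment> \<open>The step variances \<open>m * v / n^2\<close> add up to
    \<open>v * (n - 1) / (2 * n)\<close>.\<close>
  moreover have "(\<Prod>m<n. complex_of_real (e m)) = complex_of_real (exp (- (t\<^sup>2 * (v * (real n - 1) / (2 * real n)) / 2)))"
  proof -
    have s: "(\<Sum>m<n. real m) = real n * (real n - 1) / 2" by (induction n) (auto simp: field_simps)
    have "(\<Prod>m<n. e m) = exp (\<Sum>m<n. - (t\<^sup>2 * (real m * v / (real n)\<^sup>2) / 2))"
      unfolding e_def by (simp add: exp_sum)
    also have "(\<Sum>m<n. - (t\<^sup>2 * (real m * v / (real n)\<^sup>2) / 2)) = - (t\<^sup>2 * v / (2 * (real n)\<^sup>2)) * (\<Sum>m<n. real m)"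
      unfolding sum_distrib_left by (intro sum.cong) (auto simp: field_simps)
    also have "\<dots> = - (t\<^sup>2 * (v * (real n - 1) / (2 * real n)) / 2)"
      using n unfolding s by (simp add: power2_eq_square)
    finally show ?thesis by (simp only: of_real_prod[symmetric])
  qed
  ultimately show ?thesis using n unfolding \<phi>_def by simp
qed

end

subsection \<open>Kernels given by finitely many features\<close>

text \<open>A kernel \<open>s * <A x, A y>\<close> has finite rank: its integral operator shares the
  nonzero spectrum with \<open>s\<close> times the second moment matrix of the features, whose norm
  \<open>op_bound\<close> limits to \<open>c\<close>. This norm and the unit bound
  \<open>A_norm\<close> yield the conditions on the iterated kernel.\<close>

locale feature_kernel = prob_space N for N :: "'b measure" +
  fixes I :: "'i set" and A :: "'i \<Rightarrow> 'b \<Rightarrow> real" and s c :: real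
  assumes finite_I: "finite I"
    and A_meas: "\<And>a. a \<in> I \<Longrightarrow> A a \<in> borel_measurable N"
    and A_norm: "\<And>x. (\<Sum>a\<in>I. (A a x)\<^sup>2) \<le> 1"
    and s_nonneg: "0 \<le> s" and c_pos: "0 < c"
    and op_bound: "\<And>M. (\<integral>x. (\<Sum>a\<in>I. A a x * M a)\<^sup>2 \<partial>N) \<le> c * (\<Sum>a\<in>I. (M a)\<^sup>2)"
begin

text \<open>
  \<open>F\<close> is the kernel of the uncentred features, \<open>H\<close> that of the centred ones, and \<open>\<epsilon>\<close> bounds the second
  moment of their difference.
\<close>

definition \<mu> :: "'i \<Rightarrow> real" where "\<mu> a = (\<integral>x. A a x \<partial>N)"
definition B :: "'i \<Rightarrow> 'b \<Rightarrow> real" where "B a x = A a x - \<mu> a"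
definition F :: "'b \<Rightarrow> 'b \<Rightarrow> real" where "F x y = s * (\<Sum>a\<in>I. A a x * A a y)"
definition H :: "'b \<Rightarrow> 'b \<Rightarrow> real" where "H x y = s * (\<Sum>a\<in>I. B a x * B a y)"
definition msq :: real where "msq = (\<Sum>a\<in>I. (\<mu> a)\<^sup>2)"
definition \<epsilon> :: real where "\<epsilon> = 3 * s\<^sup>2 * (2 * c * msq + msq\<^sup>2)"

section \<open>Centred features and their operator norm\<close>

lemma A_bounded: "a \<in> I \<Longrightarrow> \<bar>A a x\<bar> \<le> 1"
proof -
  assume "a \<in> I"
  then have "(A a x)\<^sup>2 \<le> (\<Sum>a\<in>I. (A a x)\<^sup>2)" using finite_I by (intro member_le_sum) auto
  also have "\<dots> \<le> 1" by (rule A_norm)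
  finally show ?thesis by (simp add: abs_square_le_1)
qed

lemma A_int: "a \<in> I \<Longrightarrow> integrable N (A a)"
  using A_bounded A_meas by (intro integrable_const_bound[where B = 1]) auto

lemma \<mu>_bounded: "a \<in> I \<Longrightarrow> \<bar>\<mu> a\<bar> \<le> 1"
proof -
  assume a: "a \<in> I"
  have "\<bar>\<mu> a\<bar> \<le> (\<integral>x. \<bar>A a x\<bar> \<partial>N)" unfolding \<mu>_def by (rule integral_abs_bound)
  also have "\<dots> \<le> (\<integral>x. 1 \<partial>N)" using A_int[OF a] A_bounded[OF a] by (intro integral_mono) auto
  finally show ?thesis by (simp add: prob_space)
qed

lemma msq_nonneg: "0 \<le> msq" unfolding msq_def by (intro sum_nonneg) auto

lemma msq_le_1: "msq \<le> 1"
proof -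
  have iA2: "integrable N (\<lambda>x. (A a x)\<^sup>2)" if "a \<in> I" for a
    using A_bounded[OF that] A_meas[OF that]
    by (intro integrable_const_bound[where B = 1]) (auto simp: abs_square_le_1)
  have "msq \<le> (\<Sum>a\<in>I. \<integral>x. (A a x)\<^sup>2 \<partial>N)"
    unfolding msq_def \<mu>_def using iA2 A_int by (intro sum_mono square_expectation_le) auto
  also have "\<dots> = (\<integral>x. (\<Sum>a\<in>I. (A a x)\<^sup>2) \<partial>N)"
    using iA2 by (intro Bochner_Integration.integral_sum[symmetric]) auto
  also have "\<dots> \<le> (\<integral>x. 1 \<partial>N)" using iA2 A_norm by (intro integral_mono Bochner_Integration.integrable_sum) auto
  finally show ?thesis by (simp add: prob_space)
qed

lemma B_bounded: "a \<in> I \<Longrightarrow> \<bar>B a x\<bar> \<le> 2"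
  using A_bounded[of a x] \<mu>_bounded[of a] unfolding B_def by linarith

lemma B_meas: "a \<in> I \<Longrightarrow> B a \<in> borel_measurable N"
  unfolding B_def using A_meas by measurable

lemma B_int: "a \<in> I \<Longrightarrow> integrable N (B a)"
  unfolding B_def using A_int by auto

lemma B_mean: "a \<in> I \<Longrightarrow> (\<integral>x. B a x \<partial>N) = 0"
  unfolding B_def using A_int by (simp add: prob_space \<mu>_def)

lemma B_norm: "(\<Sum>a\<in>I. (B a x)\<^sup>2) \<le> 4"
proof -
  have "(\<Sum>a\<in>I. (B a x)\<^sup>2) \<le> (\<Sum>a\<in>I. 2 * (A a x)\<^sup>2 + 2 * (\<mu> a)\<^sup>2)"
    unfolding B_def by (intro sum_mono square_diff_le)
  also have "\<dots> = 2 * (\<Sum>a\<in>I. (A a x)\<^sup>2) + 2 * msq"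
    unfolding msq_def by (simp add: sum.distrib sum_distrib_left)
  finally show ?thesis using A_norm[of x] msq_le_1 by linarith
qed

lemma lin_A_meas: "(\<lambda>x. \<Sum>a\<in>I. A a x * M a) \<in> borel_measurable N"
  using A_meas by (intro borel_measurable_sum borel_measurable_times) auto
lemma lin_B_meas: "(\<lambda>x. \<Sum>a\<in>I. B a x * M a) \<in> borel_measurable N"
  using B_meas by (intro borel_measurable_sum borel_measurable_times) auto

lemma lin_A_bounded: "(\<Sum>a\<in>I. A a x * M a)\<^sup>2 \<le> (\<Sum>a\<in>I. (M a)\<^sup>2)"
  using order.trans[OF Cauchy_Schwarz_ineq_sum mult_right_mono[OF A_norm]]
  by (fastforce intro: sum_nonneg)

lemma lin_B_bounded: "(\<Sum>a\<in>I. B a x * M a)\<^sup>2 \<le> 4 * (\<Sum>a\<in>I. (M a)\<^sup>2)"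
  using order.trans[OF Cauchy_Schwarz_ineq_sum mult_right_mono[OF B_norm]]
  by (fastforce intro: sum_nonneg)

lemma lin_A_int: "integrable N (\<lambda>x. \<Sum>a\<in>I. A a x * M a)" "integrable N (\<lambda>x. (\<Sum>a\<in>I. A a x * M a)\<^sup>2)"
proof -
  show "integrable N (\<lambda>x. (\<Sum>a\<in>I. A a x * M a)\<^sup>2)"
    using lin_A_bounded[of _ M] lin_A_meas[of M] by (intro integrable_const_bound) auto
  then show "integrable N (\<lambda>x. \<Sum>a\<in>I. A a x * M a)"
    by (rule square_integrable_imp_integrable[OF lin_A_meas])
qed

lemma lin_B_int: "integrable N (\<lambda>x. \<Sum>a\<in>I. B a x * M a)" "integrable N (\<lambda>x. (\<Sum>a\<in>I. B a x * M a)\<^sup>2)"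
proof -
  show "integrable N (\<lambda>x. (\<Sum>a\<in>I. B a x * M a)\<^sup>2)"
    using lin_B_bounded[of _ M] lin_B_meas[of M] by (intro integrable_const_bound) auto
  then show "integrable N (\<lambda>x. \<Sum>a\<in>I. B a x * M a)"
    by (rule square_integrable_imp_integrable[OF lin_B_meas])
qed

lemma lin_B_mean: "(\<integral>x. (\<Sum>a\<in>I. B a x * M a) \<partial>N) = 0"
proof -
  have "(\<integral>x. (\<Sum>a\<in>I. B a x * M a) \<partial>N) = (\<Sum>a\<in>I. \<integral>x. B a x * M a \<partial>N)"
    using B_int by (intro Bochner_Integration.integral_sum) auto
  then show ?thesis using B_int B_mean by simp
qed

text \<open>A variance is at most the second moment, so centring preserves the constant.\<close>

lemma op_bound_B: "(\<integral>x. (\<Sum>a\<in>I. B a x * M a)\<^sup>2 \<partial>N) \<le> c * (\<Sum>a\<in>I. (M a)\<^sup>2)"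
proof -
  define f where "f x = (\<Sum>a\<in>I. A a x * M a)" for x
  define k where "k = (\<Sum>a\<in>I. \<mu> a * M a)"
  have f: "integrable N f" "integrable N (\<lambda>x. (f x)\<^sup>2)" unfolding f_def by (rule lin_A_int)+
  have B: "(\<Sum>a\<in>I. B a x * M a) = f x - k" for x
    unfolding f_def k_def B_def by (simp add: sum_subtractf algebra_simps)
  have "(\<integral>x. f x \<partial>N) = (\<Sum>a\<in>I. \<integral>x. A a x * M a \<partial>N)"
    unfolding f_def using A_int by (intro Bochner_Integration.integral_sum) auto
  also have "\<dots> = k" unfolding k_def \<mu>_def using A_int by simp
  finally have "(\<integral>x. (\<Sum>a\<in>I. B a x * M a)\<^sup>2 \<partial>N) = variance f" by (simp add: B)
  also have "\<dots> \<le> (\<integral>x. (f x)\<^sup>2 \<partial>N)" using variance_eq[OF f] by simp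
  also have "\<dots> \<le> c * (\<Sum>a\<in>I. (M a)\<^sup>2)" unfolding f_def by (rule op_bound)
  finally show ?thesis .
qed

lemma lin_pair_meas:
  assumes "\<And>a. a \<in> I \<Longrightarrow> X a \<in> borel_measurable N" "\<And>a. a \<in> I \<Longrightarrow> Y a \<in> borel_measurable N"
  shows "(\<lambda>(x, y). s * (\<Sum>a\<in>I. X a x * Y a y)) \<in> borel_measurable (N \<Otimes>\<^sub>M N)"
  unfolding split_beta using assms
  by (intro borel_measurable_times borel_measurable_sum borel_measurable_const
      measurable_compose[OF measurable_fst] measurable_compose[OF measurable_snd]) auto

lemma H_lin: "H x y = s * (\<Sum>a\<in>I. B a y * B a x)"
  unfolding H_def by (simp add: mult.commute)

sublocale deg: degenerate_kernel N H "4 * s"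
proof
  show "case_prod H \<in> borel_measurable (N \<Otimes>\<^sub>M N)"
    unfolding H_def using lin_pair_meas[OF B_meas B_meas] by simp
  show "\<bar>H x y\<bar> \<le> 4 * s" for x y
  proof -
    have "(\<Sum>a\<in>I. B a x * B a y)\<^sup>2 \<le> 4 * 4"
      using lin_B_bounded[of x "\<lambda>a. B a y"] B_norm[of y] by linarith
    then have "\<bar>\<Sum>a\<in>I. B a x * B a y\<bar> \<le> 4" using real_le_rsqrt abs_le_square_iff[of _ 4] by fastforce
    then show ?thesis using s_nonneg unfolding H_def abs_mult by (auto simp: mult.commute intro: mult_left_mono)
  qed
  show "H x y = H y x" for x y unfolding H_def by (simp add: mult.commute)
  show "(\<integral>y. H x y \<partial>N) = 0" for x unfolding H_lin using lin_B_mean by simp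
qed

lemma G_diag_bound: "deg.G x x \<le> 4 * s\<^sup>2 * c"
proof -
  have "deg.G x x = s\<^sup>2 * (\<integral>z. (\<Sum>a\<in>I. B a z * B a x)\<^sup>2 \<partial>N)"
    unfolding deg.G_def H_lin by (simp add: power2_eq_square mult_ac flip: integral_mult_right_zero)
  also have "\<dots> \<le> s\<^sup>2 * (c * (\<Sum>a\<in>I. (B a x)\<^sup>2))" by (intro mult_left_mono op_bound_B) auto
  also have "\<dots> \<le> s\<^sup>2 * (c * 4)" using B_norm c_pos by (intro mult_left_mono) auto
  finally show ?thesis by simp
qed

lemma G_diag_nonneg: "0 \<le> deg.G x x"
  unfolding deg.G_def by (intro integral_nonneg_AE AE_I2) auto

lemma G_diag_int: "integrable N (\<lambda>x. deg.G x x)" "integrable N (\<lambda>x. (deg.G x x)\<^sup>2)"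
proof -
  have "(deg.G x x)\<^sup>2 \<le> (4 * s\<^sup>2 * c)\<^sup>2" for x
    using G_diag_bound G_diag_nonneg by (intro power_mono) auto
  then show i2: "integrable N (\<lambda>x. (deg.G x x)\<^sup>2)" by (intro integrable_const_bound) auto
  then show "integrable N (\<lambda>x. deg.G x x)" by (intro square_integrable_imp_integrable[OF _ i2]) measurable
qed

text \<open>The variance of the diagonal of \<open>G\<close> is bounded by the square of its
  supremum. This is enough because only \<open>w / n\<close> enters and \<open>s^2 * c\<close> stays
  bounded in the application.\<close>

lemma w_bound: "deg.w \<le> (4 * s\<^sup>2 * c)\<^sup>2"
proof -
  have "deg.w \<le> (\<integral>x. (deg.G x x)\<^sup>2 \<partial>N)"
    using variance_eq[OF G_diag_int] unfolding deg.w_def deg.v_def by simp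
  also have "\<dots> \<le> (\<integral>x. (4 * s\<^sup>2 * c)\<^sup>2 \<partial>N)"
    using G_diag_int(2) G_diag_bound G_diag_nonneg by (intro integral_mono power_mono) auto
  finally show ?thesis by (simp add: prob_space)
qed

text \<open>For the operator T with kernel \<open>H\<close> this is tr T^4 \<le> ||T||^2 tr T^2 with
  ||T|| at most \<open>s * c\<close>, proved for each \<open>x\<close> separately.\<close>

lemma g_bound: "deg.g \<le> s\<^sup>2 * c\<^sup>2 * deg.v"
proof -
  have inner: "(\<integral>y. (deg.G x y)\<^sup>2 \<partial>N) \<le> s\<^sup>2 * c\<^sup>2 * deg.G x x" if x: "x \<in> space N" for x
  proof -
    \<comment> \<open>The coefficients of \<open>G x\<close> in the features: \<open>G x y\<close>
      is \<open>s\<close> times the inner product of \<open>B y\<close> with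
      \<open>k\<close>.\<close>
    define k where "k a = (\<integral>z. B a z * H x z \<partial>N)" for a
    define nk where "nk = (\<Sum>a\<in>I. (k a)\<^sup>2)"
    have Hm [measurable]: "H x \<in> borel_measurable N" using x by measurable
    have iH2: "integrable N (\<lambda>z. (H x z)\<^sup>2)"
      unfolding H_lin power_mult_distrib using lin_B_int(2) by auto
    have iBH: "integrable N (\<lambda>z. B a z * H x z)" if "a \<in> I" for a
    proof (intro integrable_const_bound[where B = "2 * (4 * s)"] AE_I2)
      show "norm (B a z * H x z) \<le> 2 * (4 * s)" for z
        unfolding real_norm_def abs_mult using B_bounded[OF that] deg.H_bounded by (intro mult_mono) auto
    qed (use B_meas[OF that] in measurable)
    have lin: "(\<Sum>a\<in>I. (\<integral>z. B a z * H x z \<partial>N) * M a) = (\<integral>z. H x z * (\<Sum>a\<in>I. B a z * M a) \<partial>N)" for M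
    proof -
      have "(\<integral>z. H x z * (\<Sum>a\<in>I. B a z * M a) \<partial>N) = (\<integral>z. (\<Sum>a\<in>I. B a z * H x z * M a) \<partial>N)"
        by (simp add: sum_distrib_left mult_ac)
      also have "\<dots> = (\<Sum>a\<in>I. \<integral>z. B a z * H x z * M a \<partial>N)"
        using iBH by (intro Bochner_Integration.integral_sum) auto
      finally show ?thesis using iBH by simp
    qed
    have "deg.G x y = s * (\<Sum>a\<in>I. B a y * k a)" for y
    proof -
      have "deg.G x y = (\<integral>z. s * (H x z * (\<Sum>a\<in>I. B a z * B a y)) \<partial>N)"
        unfolding deg.G_def H_lin[of y] by (simp add: mult_ac)
      also have "\<dots> = s * (\<Sum>a\<in>I. k a * B a y)"
        unfolding k_def lin by simp
      finally show ?thesis by (simp add: mult.commute)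
    qed
    then have "(\<integral>y. (deg.G x y)\<^sup>2 \<partial>N) = s\<^sup>2 * (\<integral>y. (\<Sum>a\<in>I. B a y * k a)\<^sup>2 \<partial>N)"
      by (simp add: power_mult_distrib)
    also have "\<dots> \<le> s\<^sup>2 * (c * nk)"
      unfolding nk_def by (intro mult_left_mono op_bound_B) auto
    finally have 1: "(\<integral>y. (deg.G x y)\<^sup>2 \<partial>N) \<le> s\<^sup>2 * (c * nk)" .
    have "nk = (\<integral>z. H x z * (\<Sum>a\<in>I. B a z * k a) \<partial>N)"
      unfolding nk_def using lin[of k] by (simp add: k_def[symmetric] power2_eq_square)
    \<comment> \<open>With weight \<open>c\<close> the last term is at most \<open>nk / 2\<close>,
      which is absorbed on the left.\<close>
    also have "\<dots> \<le> (\<integral>z. (c * (H x z)\<^sup>2 + (\<Sum>a\<in>I. B a z * k a)\<^sup>2 / c) / 2 \<partial>N)"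
    proof (rule integral_mono)
      show "integrable N (\<lambda>z. (c * (H x z)\<^sup>2 + (\<Sum>a\<in>I. B a z * k a)\<^sup>2 / c) / 2)"
        using iH2 lin_B_int(2) by auto
      have am: "\<bar>u * q\<bar> \<le> (c * u\<^sup>2 + q\<^sup>2 / c) / 2" for u q :: real
        using two_abs_mult_le[OF c_pos, of u q] by simp
      show "H x z * (\<Sum>a\<in>I. B a z * k a) \<le> (c * (H x z)\<^sup>2 + (\<Sum>a\<in>I. B a z * k a)\<^sup>2 / c) / 2" for z
        using am[of "H x z" "\<Sum>a\<in>I. B a z * k a"] by linarith
      show "integrable N (\<lambda>z. H x z * (\<Sum>a\<in>I. B a z * k a))"
        by (rule Bochner_Integration.integrable_bound[where f = "\<lambda>z. (c * (H x z)\<^sup>2 + (\<Sum>a\<in>I. B a z * k a)\<^sup>2 / c) / 2"])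
           (use iH2 lin_B_int(2) am lin_B_meas in \<open>auto intro!: AE_I2 order.trans[OF am abs_ge_self] simp del: abs_divide\<close>)
    qed
    also have "\<dots> = (c * deg.G x x + (\<integral>z. (\<Sum>a\<in>I. B a z * k a)\<^sup>2 \<partial>N) / c) / 2"
      using iH2 lin_B_int(2) by (simp add: deg.G_def power2_eq_square)
    also have "\<dots> \<le> (c * deg.G x x + nk) / 2"
    proof -
      have "(\<integral>z. (\<Sum>a\<in>I. B a z * k a)\<^sup>2 \<partial>N) / c \<le> c * nk / c"
        unfolding nk_def using c_pos by (intro divide_right_mono op_bound_B) auto
      then have "(\<integral>z. (\<Sum>a\<in>I. B a z * k a)\<^sup>2 \<partial>N) / c \<le> nk" using c_pos by simp
      then show ?thesis by (intro divide_right_mono add_left_mono) auto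
    qed
    finally have "nk \<le> c * deg.G x x" by simp
    then have "s\<^sup>2 * (c * nk) \<le> s\<^sup>2 * (c * (c * deg.G x x))"
      using c_pos by (intro mult_left_mono) auto
    with 1 show ?thesis by (simp add: power2_eq_square mult_ac)
  qed
  have "deg.g \<le> (\<integral>x. s\<^sup>2 * c\<^sup>2 * deg.G x x \<partial>N)"
    unfolding deg.g_def
  proof (rule integral_mono)
    show "integrable N (\<lambda>x. \<integral>y. (deg.G x y)\<^sup>2 \<partial>N)"
      by (rule integrable_bounded[OF prob_space_axioms _ integral_square_bounded[OF prob_space_axioms deg.G_bounded]])
         measurable
  qed (use G_diag_int inner in auto)
  then show ?thesis by (simp add: deg.v_def)
qed

section \<open>Comparison of the centred with the uncentred kernel\<close>

abbreviation Q :: "('b \<times> 'b) measure" where "Q \<equiv> N \<Otimes>\<^sub>M N"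

lemma F_meas [measurable]: "(\<lambda>z. F (fst z) (snd z)) \<in> borel_measurable Q"
  unfolding F_def using lin_pair_meas[OF A_meas A_meas] by (simp add: split_beta)

lemma F_bounded: "\<bar>F x y\<bar> \<le> s"
proof -
  have "(\<Sum>a\<in>I. A a x * A a y)\<^sup>2 \<le> 1"
    using lin_A_bounded[of x "\<lambda>a. A a y"] A_norm[of y] by linarith
  then have "\<bar>\<Sum>a\<in>I. A a x * A a y\<bar> \<le> 1" by (simp add: abs_square_le_1)
  then show ?thesis using s_nonneg unfolding F_def abs_mult by (auto intro: mult_left_le)
qed

lemma integrable_Q:
  fixes f :: "'b \<times> 'b \<Rightarrow> real"
  assumes "f \<in> borel_measurable Q" "\<And>z. \<bar>f z\<bar> \<le> b"
  shows "integrable Q f"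
  using assms by (intro integrable_bounded[OF deg.pairN.prob_space_axioms]) auto

lemma integral_Q:
  fixes f :: "'b \<Rightarrow> 'b \<Rightarrow> real"
  assumes "(\<lambda>z. f (fst z) (snd z)) \<in> borel_measurable Q" "\<And>x y. \<bar>f x y\<bar> \<le> b"
  shows "(\<integral>x. \<integral>y. f x y \<partial>N \<partial>N) = (\<integral>z. f (fst z) (snd z) \<partial>Q)"
  using deg.pairN.integral_fst'[OF integrable_Q[OF assms(1), of b]] assms(2) by simp

definition mean_part :: "'b \<Rightarrow> real" where "mean_part x = (\<Sum>a\<in>I. A a x * \<mu> a)"

lemma H_eq_F: "H x y = F x y - s * (mean_part x + mean_part y - msq)"
  unfolding H_def F_def B_def mean_part_def msq_def
  by (simp add: sum_subtractf sum.distrib algebra_simps power2_eq_square)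

lemma mean_part_meas [measurable]: "mean_part \<in> borel_measurable N"
  unfolding mean_part_def by (rule lin_A_meas)

lemma H_meas_Q [measurable]: "(\<lambda>z. H (fst z) (snd z)) \<in> borel_measurable Q"
  by measurable

text \<open>Up to sign the kernels differ by \<open>s * (mean_part x + mean_part y - msq)\<close>.
  Applying \<open>op_bound\<close> to the mean itself bounds the second moment of
  \<open>mean_part\<close> by \<open>c * msq\<close>; the 3 in \<open>\<epsilon>\<close> comes from
  squaring three summands.\<close>

lemma error_second_moment: "(\<integral>z. (H (fst z) (snd z) - F (fst z) (snd z))\<^sup>2 \<partial>Q) \<le> \<epsilon>"
proof -
  have eq: "H x y - F x y = - (s * (mean_part x + mean_part y - msq))" for x y
    unfolding H_eq_F by simp
  have bd: "\<bar>H x y - F x y\<bar> \<le> 5 * s" for x y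
    using deg.H_bounded[of x y] F_bounded[of x y] by linarith
  have im: "integrable N (\<lambda>x. (mean_part x)\<^sup>2)" unfolding mean_part_def by (rule lin_A_int)
  have em: "(\<integral>x. (mean_part x)\<^sup>2 \<partial>N) \<le> c * msq" unfolding mean_part_def msq_def by (rule op_bound)
  have pt: "(H x y - F x y)\<^sup>2 \<le> 3 * s\<^sup>2 * ((mean_part x)\<^sup>2 + (mean_part y)\<^sup>2 + msq\<^sup>2)" for x y
  proof -
    have "(u + v - k)\<^sup>2 \<le> 3 * (u\<^sup>2 + v\<^sup>2 + k\<^sup>2)" for u v k :: real
      using zero_le_power2[of "u - v"] zero_le_power2[of "u + k"] zero_le_power2[of "v + k"]
      by (simp add: power2_eq_square algebra_simps)
    from mult_left_mono[OF this[of "mean_part x" "mean_part y" msq], of "s\<^sup>2"]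
    have "s\<^sup>2 * (mean_part x + mean_part y - msq)\<^sup>2 \<le> s\<^sup>2 * (3 * ((mean_part x)\<^sup>2 + (mean_part y)\<^sup>2 + msq\<^sup>2))" by simp
    also have "\<dots> = 3 * s\<^sup>2 * ((mean_part x)\<^sup>2 + (mean_part y)\<^sup>2 + msq\<^sup>2)" by simp
    finally show ?thesis unfolding eq by (simp only: power2_minus power_mult_distrib)
  qed
  have "(\<integral>z. (H (fst z) (snd z) - F (fst z) (snd z))\<^sup>2 \<partial>Q) = (\<integral>x. \<integral>y. (H x y - F x y)\<^sup>2 \<partial>N \<partial>N)"
    using bounded_square[OF bd] by (intro integral_Q[symmetric, where b = "(5 * s)\<^sup>2"]) auto
  also have "\<dots> \<le> (\<integral>x. 3 * s\<^sup>2 * ((mean_part x)\<^sup>2 + c * msq + msq\<^sup>2) \<partial>N)"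
  proof (rule integral_mono)
    show "integrable N (\<lambda>x. \<integral>y. (H x y - F x y)\<^sup>2 \<partial>N)"
      by (rule integrable_bounded[OF prob_space_axioms _ integral_square_bounded[OF prob_space_axioms bd]])
         (unfold eq, measurable)
    show "integrable N (\<lambda>x. 3 * s\<^sup>2 * ((mean_part x)\<^sup>2 + c * msq + msq\<^sup>2))" using im by auto
    fix x
    have "(\<integral>y. (H x y - F x y)\<^sup>2 \<partial>N) \<le> (\<integral>y. 3 * s\<^sup>2 * ((mean_part x)\<^sup>2 + (mean_part y)\<^sup>2 + msq\<^sup>2) \<partial>N)"
    proof (rule integral_mono)
      show "integrable N (\<lambda>y. (H x y - F x y)\<^sup>2)"
        by (rule integrable_bounded[OF prob_space_axioms _ bounded_square[OF bd]]) (unfold eq, measurable)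
    qed (use im pt in auto)
    also have "\<dots> = 3 * s\<^sup>2 * ((mean_part x)\<^sup>2 + (\<integral>y. (mean_part y)\<^sup>2 \<partial>N) + msq\<^sup>2)"
      using im by (simp add: prob_space)
    also have "\<dots> \<le> 3 * s\<^sup>2 * ((mean_part x)\<^sup>2 + c * msq + msq\<^sup>2)"
      using em by (intro mult_left_mono) auto
    finally show "(\<integral>y. (H x y - F x y)\<^sup>2 \<partial>N) \<le> \<dots>" .
  qed
  also have "\<dots> = 3 * s\<^sup>2 * ((\<integral>x. (mean_part x)\<^sup>2 \<partial>N) + c * msq + msq\<^sup>2)"
    using im by (simp add: prob_space)
  also have "\<dots> \<le> \<epsilon>" unfolding \<epsilon>_def using em by (intro mult_left_mono) auto
  finally show ?thesis .
qed

lemma v_eq: "deg.v = (\<integral>z. (H (fst z) (snd z))\<^sup>2 \<partial>Q)"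
proof -
  have "deg.v = (\<integral>x. \<integral>y. (H x y)\<^sup>2 \<partial>N \<partial>N)" unfolding deg.v_def deg.G_def by (simp add: power2_eq_square)
  also have "\<dots> = (\<integral>z. (H (fst z) (snd z))\<^sup>2 \<partial>Q)"
    using bounded_square[OF deg.H_bounded] by (intro integral_Q[where b = "(4 * s)\<^sup>2"]) auto
  finally show ?thesis .
qed

lemma F_sq_int: "integrable Q (\<lambda>z. (F (fst z) (snd z))\<^sup>2)"
  using bounded_square[OF F_bounded] by (intro integrable_Q[where b = "s\<^sup>2"]) auto
lemma H_sq_int: "integrable Q (\<lambda>z. (H (fst z) (snd z))\<^sup>2)"
  using bounded_square[OF deg.H_bounded] by (intro integrable_Q[where b = "(4 * s)\<^sup>2"]) auto
lemma HF_sq_int: "integrable Q (\<lambda>z. (H (fst z) (snd z) - F (fst z) (snd z))\<^sup>2)"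
proof -
  have bd: "\<bar>H x y - F x y\<bar> \<le> 5 * s" for x y
    using deg.H_bounded[of x y] F_bounded[of x y] by linarith
  show ?thesis using bounded_square[OF bd] by (intro integrable_Q[where b = "(5 * s)\<^sup>2"]) auto
qed

text \<open>Expanding the difference of squares leaves a mixed term, which is split with weight
  \<open>sqrt e\<close>. The weight must be positive, whence a bound \<open>e\<close> in place of
  \<open>\<epsilon>\<close>, which is 0 when \<open>msq\<close> is.\<close>

lemma v_approx:
  assumes e: "0 < e" "\<epsilon> \<le> e"
  defines "V \<equiv> (\<integral>z. (F (fst z) (snd z))\<^sup>2 \<partial>Q)"
  shows "\<bar>deg.v - V\<bar> \<le> sqrt e * V + e + sqrt e"
proof -
  define \<eta> where "\<eta> = sqrt e"
  have \<eta>: "0 < \<eta>" "\<eta> * \<eta> = e" using e by (auto simp: \<eta>_def)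
  have pt: "\<bar>h\<^sup>2 - f\<^sup>2\<bar> \<le> \<eta> * f\<^sup>2 + (1 + 1 / \<eta>) * (h - f)\<^sup>2" for h f :: real
  proof -
    have 1: "2 * \<bar>f * (h - f)\<bar> \<le> \<eta> * f\<^sup>2 + (h - f)\<^sup>2 / \<eta>" using \<eta>(1) by (rule two_abs_mult_le)
    have "h\<^sup>2 - f\<^sup>2 = 2 * (f * (h - f)) + (h - f)\<^sup>2" by (simp add: power2_eq_square algebra_simps)
    then have "\<bar>h\<^sup>2 - f\<^sup>2\<bar> \<le> 2 * \<bar>f * (h - f)\<bar> + (h - f)\<^sup>2"
      using abs_triangle_ineq[of "2 * (f * (h - f))" "(h - f)\<^sup>2"] by (simp add: abs_mult)
    with 1 show ?thesis by (simp add: algebra_simps)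
  qed
  have "\<bar>deg.v - V\<bar> = \<bar>\<integral>z. (H (fst z) (snd z))\<^sup>2 - (F (fst z) (snd z))\<^sup>2 \<partial>Q\<bar>"
    unfolding v_eq V_def using F_sq_int H_sq_int by simp
  also have "\<dots> \<le> (\<integral>z. \<bar>(H (fst z) (snd z))\<^sup>2 - (F (fst z) (snd z))\<^sup>2\<bar> \<partial>Q)" by (rule integral_abs_bound)
  also have "\<dots> \<le> (\<integral>z. \<eta> * (F (fst z) (snd z))\<^sup>2 + (1 + 1 / \<eta>) * (H (fst z) (snd z) - F (fst z) (snd z))\<^sup>2 \<partial>Q)"
    using F_sq_int H_sq_int HF_sq_int pt by (intro integral_mono) auto
  also have "\<dots> = \<eta> * V + (1 + 1 / \<eta>) * (\<integral>z. (H (fst z) (snd z) - F (fst z) (snd z))\<^sup>2 \<partial>Q)"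
    unfolding V_def using F_sq_int HF_sq_int by simp
  also have "\<dots> \<le> \<eta> * V + (1 + 1 / \<eta>) * e"
    using error_second_moment e \<eta> by (intro add_left_mono mult_left_mono) auto
  also have "(1 + 1 / \<eta>) * e = e + \<eta>" using \<eta>(1) unfolding \<eta>(2)[symmetric] by (simp add: field_simps)
  finally show ?thesis by (simp add: \<eta>_def)
qed

text \<open>If \<open>|H| > 2 * K\<close>, then at least half of \<open>|H|\<close> is carried by
  \<open>F\<close>, so that \<open>|F| > K\<close>, or by the difference \<open>H - F\<close>. This
  is why the truncation level doubles.\<close>

lemma tail_bound:
  shows "deg.tail (2 * K) \<le> 4 * (\<integral>z. (if \<bar>F (fst z) (snd z)\<bar> > K then (F (fst z) (snd z))\<^sup>2 else 0) \<partial>Q) + 4 * \<epsilon>"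
proof -
  have iF: "integrable Q (\<lambda>z. (if \<bar>F (fst z) (snd z)\<bar> > K then (F (fst z) (snd z))\<^sup>2 else 0))"
    using bounded_square[OF F_bounded] by (intro integrable_Q[where b = "s\<^sup>2"]) auto
  have T_bd: "\<bar>H x y - deg.Htrunc K' x y\<bar> \<le> 4 * s" for x y K'
    unfolding deg.Htrunc_def using deg.H_bounded[of x y] s_nonneg by auto
  have "deg.tail (2 * K) = (\<integral>z. (H (fst z) (snd z) - deg.Htrunc (2 * K) (fst z) (snd z))\<^sup>2 \<partial>Q)"
    unfolding deg.tail_def using bounded_square[OF T_bd]
    by (intro integral_Q[where b = "(4 * s)\<^sup>2"]) auto
  also have "\<dots> \<le> (\<integral>z. 4 * (if \<bar>F (fst z) (snd z)\<bar> > K then (F (fst z) (snd z))\<^sup>2 else 0)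
      + 4 * (H (fst z) (snd z) - F (fst z) (snd z))\<^sup>2 \<partial>Q)"
  proof (rule integral_mono)
    show "integrable Q (\<lambda>z. (H (fst z) (snd z) - deg.Htrunc (2 * K) (fst z) (snd z))\<^sup>2)"
      using bounded_square[OF T_bd] by (intro integrable_Q[where b = "(4 * s)\<^sup>2"]) auto
    show "integrable Q (\<lambda>z. 4 * (if \<bar>F (fst z) (snd z)\<bar> > K then (F (fst z) (snd z))\<^sup>2 else 0)
      + 4 * (H (fst z) (snd z) - F (fst z) (snd z))\<^sup>2)"
      using HF_sq_int iF by (intro Bochner_Integration.integrable_add integrable_mult_right) auto
    have pt: "(h - (if \<bar>h\<bar> \<le> 2 * K then h else 0))\<^sup>2 \<le> 4 * (if \<bar>f\<bar> > K then f\<^sup>2 else 0) + 4 * (h - f)\<^sup>2" for h f :: real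
    proof (cases "\<bar>h\<bar> \<le> 2 * K")
      case False
      show ?thesis
      proof (cases "\<bar>h - f\<bar> \<le> \<bar>f\<bar>")
        case True
        then have "\<bar>h\<bar> \<le> 2 * \<bar>f\<bar>" by linarith
        then have "h\<^sup>2 \<le> 4 * f\<^sup>2" using power_mono[of "\<bar>h\<bar>" "2 * \<bar>f\<bar>" 2] by (simp add: power_mult_distrib)
        moreover have "\<bar>f\<bar> > K" using False \<open>\<bar>h\<bar> \<le> 2 * \<bar>f\<bar>\<close> by linarith
        ultimately show ?thesis using False by (simp add: add_increasing2)
      next
        case f: False
        then have "\<bar>h\<bar> \<le> 2 * \<bar>h - f\<bar>" using abs_triangle_ineq[of "h - f" f] by simp
        then have "h\<^sup>2 \<le> 4 * (h - f)\<^sup>2" using power_mono[of "\<bar>h\<bar>" "2 * \<bar>h - f\<bar>" 2] by (simp add: power_mult_distrib)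
        then show ?thesis using False by (simp add: add_increasing)
      qed
    qed auto
    show "(H (fst z) (snd z) - deg.Htrunc (2 * K) (fst z) (snd z))\<^sup>2
      \<le> 4 * (if \<bar>F (fst z) (snd z)\<bar> > K then (F (fst z) (snd z))\<^sup>2 else 0) + 4 * (H (fst z) (snd z) - F (fst z) (snd z))\<^sup>2" for z
      unfolding deg.Htrunc_def by (rule pt)
  qed
  also have "\<dots> = 4 * (\<integral>z. (if \<bar>F (fst z) (snd z)\<bar> > K then (F (fst z) (snd z))\<^sup>2 else 0) \<partial>Q)
      + 4 * (\<integral>z. (H (fst z) (snd z) - F (fst z) (snd z))\<^sup>2 \<partial>Q)"
    using HF_sq_int iF by simp
  finally show ?thesis using error_second_moment by linarith
qed

section \<open>The U-statistic of the uncentred kernel\<close>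

definition W :: "nat \<Rightarrow> (nat \<Rightarrow> 'b) \<Rightarrow> real" where
  "W n x = (\<Sum>k<n. \<Sum>j<k. F (x j) (x k)) / real n"

lemma sum_pairs: "(\<Sum>k<n. \<Sum>j<k. f j + f k) = (real n - 1) * (\<Sum>k<n. f k)" for f :: "nat \<Rightarrow> real"
  by (induction n) (auto simp: sum.distrib algebra_simps)

lemma W_meas: "W n \<in> borel_measurable (deg.P n)"
  unfolding W_def F_def using A_meas
  by (intro borel_measurable_divide borel_measurable_sum borel_measurable_times borel_measurable_const
      measurable_compose[OF measurable_component_singleton]) auto

text \<open>The difference consists of the constant and the linear part of the Hoeffding
  decomposition; the factor \<open>real n - 1\<close> counts the pairs that contain a given
  point.\<close>

lemma W_minus_U:
  assumes n: "0 < n"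
  shows "W n x - deg.U (1 / real n) n x = s / real n * ((real n - 1) * (\<Sum>k<n. \<Sum>a\<in>I. B a (x k) * \<mu> a) + real n * (real n - 1) / 2 * msq)"
proof -
  have mp: "mean_part z = (\<Sum>a\<in>I. B a z * \<mu> a) + msq" for z
    unfolding mean_part_def msq_def B_def by (simp add: left_diff_distrib sum_subtractf power2_eq_square)
  define \<alpha> where "\<alpha> z = (\<Sum>a\<in>I. B a z * \<mu> a)" for z
  have s1: "(\<Sum>k<n. real k) = real n * (real n - 1) / 2" by (induction n) (auto simp: field_simps)
  have FH: "F u z - H u z = s * (\<alpha> u + \<alpha> z + msq)" for u z
    unfolding H_eq_F mp \<alpha>_def by simp
  have "W n x - deg.U (1 / real n) n x = (\<Sum>k<n. \<Sum>j<k. F (x j) (x k) - H (x j) (x k)) / real n"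
    unfolding W_def deg.U_def deg.incr_def by (simp add: sum_subtractf sum_divide_distrib diff_divide_distrib)
  also have "(\<Sum>k<n. \<Sum>j<k. F (x j) (x k) - H (x j) (x k)) = s * (\<Sum>k<n. (\<Sum>j<k. \<alpha> (x j) + \<alpha> (x k)) + real k * msq)"
    unfolding FH by (simp add: sum_distrib_left sum.distrib algebra_simps)
  also have "(\<Sum>k<n. (\<Sum>j<k. \<alpha> (x j) + \<alpha> (x k)) + real k * msq) = (real n - 1) * (\<Sum>k<n. \<alpha> (x k)) + real n * (real n - 1) / 2 * msq"
    unfolding sum.distrib[of _ "\<lambda>k. real k * msq"] sum_pairs by (simp add: sum_distrib_right[symmetric] s1)
  finally show ?thesis unfolding \<alpha>_def by simp
qed

text \<open>By independence and \<open>op_bound_B\<close> the sum of the linear terms has variance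
  at most \<open>n * c * msq\<close>. The constant part is the stricter one: with \<open>s\<close>
  and \<open>n\<close> of order \<open>p\<close> it vanishes only if \<open>msq\<close> is
  \<open>o(p^-2)\<close>.\<close>

lemma W_minus_U_L1:
  assumes n: "0 < n"
  shows "(\<integral>x. \<bar>W n x - deg.U (1 / real n) n x\<bar> \<partial>deg.P n) \<le> s * sqrt (real n * c * msq) + s * real n * msq / 2"
    and "integrable (deg.P n) (\<lambda>x. \<bar>W n x - deg.U (1 / real n) n x\<bar>)"
proof -
  interpret P: prob_space "deg.P n" by (rule deg.prob_space_P)
  define \<alpha> where "\<alpha> z = (\<Sum>a\<in>I. B a z * \<mu> a)" for z
  define S where "S x = (\<Sum>k<n. \<alpha> (x k))" for x :: "nat \<Rightarrow> 'b"
  have [measurable]: "\<alpha> \<in> borel_measurable N" unfolding \<alpha>_def by (rule lin_B_meas)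
  have \<alpha>_bd: "\<bar>\<alpha> z\<bar> \<le> 2" for z
  proof -
    have "(\<alpha> z)\<^sup>2 \<le> 2\<^sup>2" using lin_B_bounded[of z \<mu>] msq_le_1 unfolding \<alpha>_def msq_def by simp
    then show ?thesis using abs_le_square_iff[of "\<alpha> z" 2] by auto
  qed
  have Sm [measurable]: "S \<in> borel_measurable (deg.P n)"
    unfolding S_def by (intro borel_measurable_sum measurable_compose[OF measurable_component_singleton]) auto
  have S_bd: "\<bar>S x\<bar> \<le> real n * 2" for x
    unfolding S_def using sum_bounded_above[of "{..<n}" "\<lambda>k. \<bar>\<alpha> (x k)\<bar>" 2]
    by (intro order.trans[OF sum_abs]) (auto simp: \<alpha>_bd)
  have iS: "integrable (deg.P n) S" "integrable (deg.P n) (\<lambda>x. (S x)\<^sup>2)"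
    using S_bd bounded_square[OF S_bd] by (auto intro!: integrable_bounded[OF deg.prob_space_P])
  have "(\<integral>x. (S x)\<^sup>2 \<partial>deg.P n) = real n * (\<integral>z. (\<alpha> z)\<^sup>2 \<partial>N)"
    unfolding S_def using \<alpha>_bd lin_B_mean unfolding \<alpha>_def
    by (intro deg.moments_sum_P lin_B_meas) auto
  also have "\<dots> \<le> real n * (c * msq)"
    unfolding \<alpha>_def msq_def by (intro mult_left_mono op_bound_B) auto
  finally have "sqrt (\<integral>x. (S x)\<^sup>2 \<partial>deg.P n) \<le> sqrt (real n * c * msq)"
    by (simp add: mult.assoc)
  with P.expectation_abs_le_sqrt[OF Sm iS(2)] have ES: "(\<integral>x. \<bar>S x\<bar> \<partial>deg.P n) \<le> sqrt (real n * c * msq)" by linarith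
  have eq: "W n x - deg.U (1 / real n) n x = s / real n * ((real n - 1) * S x + real n * (real n - 1) / 2 * msq)" for x
    unfolding W_minus_U[OF n] S_def \<alpha>_def ..
  show "integrable (deg.P n) (\<lambda>x. \<bar>W n x - deg.U (1 / real n) n x\<bar>)" unfolding eq using iS by auto
  have "\<bar>W n x - deg.U (1 / real n) n x\<bar> \<le> s * \<bar>S x\<bar> + s * real n * msq / 2" for x
  proof -
    have "\<bar>(real n - 1) * S x + real n * (real n - 1) / 2 * msq\<bar> \<le> real n * \<bar>S x\<bar> + real n * real n / 2 * msq"
    proof (rule order.trans[OF abs_triangle_ineq], rule add_mono)
      show "\<bar>(real n - 1) * S x\<bar> \<le> real n * \<bar>S x\<bar>" using n by (auto simp: abs_mult intro!: mult_right_mono)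
      show "\<bar>real n * (real n - 1) / 2 * msq\<bar> \<le> real n * real n / 2 * msq"
        using n msq_nonneg by (auto simp: abs_mult intro!: mult_right_mono mult_left_mono divide_right_mono)
    qed
    from mult_left_mono[OF this, of "s / real n"] show ?thesis
      unfolding eq abs_mult using n s_nonneg by (simp add: distrib_left)
  qed
  then have "(\<integral>x. \<bar>W n x - deg.U (1 / real n) n x\<bar> \<partial>deg.P n) \<le> (\<integral>x. s * \<bar>S x\<bar> + s * real n * msq / 2 \<partial>deg.P n)"
    using iS \<open>integrable (deg.P n) (\<lambda>x. \<bar>W n x - deg.U (1 / real n) n x\<bar>)\<close> by (intro integral_mono) auto
  also have "\<dots> = s * (\<integral>x. \<bar>S x\<bar> \<partial>deg.P n) + s * real n * msq / 2"
    using iS by (simp add: P.prob_space)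
  also have "\<dots> \<le> s * sqrt (real n * c * msq) + s * real n * msq / 2"
    using ES s_nonneg by (intro add_right_mono mult_left_mono) auto
  finally show "(\<integral>x. \<bar>W n x - deg.U (1 / real n) n x\<bar> \<partial>deg.P n) \<le> \<dots>" .
qed

lemma char_W_bound:
  assumes n: "0 < n" and K: "0 \<le> K"
  shows "cmod ((CLINT x|deg.P n. iexp (t * W n x)) - complex_of_real (exp (- (t\<^sup>2 * (deg.v * (real n - 1) / (2 * real n)) / 2))))
    \<le> \<bar>t\<bar> * (s * sqrt (real n * c * msq) + s * real n * msq / 2)
       + (t\<^sup>2 / 2 * sqrt (2 * deg.w / real n + 4 * deg.g) + 80 * \<bar>t\<bar> ^ 3 * (K\<^sup>2 + K ^ 4) / sqrt (real n)
       + 4 * t\<^sup>2 * deg.tail K + t ^ 4 * deg.v\<^sup>2 / (8 * real n))" (is "cmod (?w - ?e) \<le> ?b1 + ?b2")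
proof -
  let ?U = "deg.U (1 / real n) n"
  have [measurable]: "W n \<in> borel_measurable (deg.P n)" "?U \<in> borel_measurable (deg.P n)"
    using W_meas deg.U_meas[of "\<lambda>x. x" "deg.P n" n] by auto
  have i: "integrable (deg.P n) (\<lambda>x. iexp (t * W n x))" "integrable (deg.P n) (\<lambda>x. iexp (t * ?U x))"
    by (intro integrable_bounded[where c = 1] deg.prob_space_P; simp)+
  have lip: "cmod (iexp x - iexp y) \<le> \<bar>x - y\<bar>" for x y :: real
  proof -
    have "iexp x - iexp y = iexp y * (iexp (x - y) - 1)" by (simp add: algebra_simps flip: exp_add)
    then have "cmod (iexp x - iexp y) = cmod (iexp (x - y) - 1)" by (simp add: norm_mult)
    then show ?thesis using iexp_approx1[of "x - y" 0] by simp
  qed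
  have "cmod (?w - (CLINT x|deg.P n. iexp (t * ?U x))) = cmod (CLINT x|deg.P n. iexp (t * W n x) - iexp (t * ?U x))"
    using i by simp
  also have "\<dots> \<le> (\<integral>x. cmod (iexp (t * W n x) - iexp (t * ?U x)) \<partial>deg.P n)" by (rule integral_norm_bound)
  also have "\<dots> \<le> (\<integral>x. \<bar>t\<bar> * \<bar>W n x - ?U x\<bar> \<partial>deg.P n)"
  proof (rule integral_mono)
    show "cmod (iexp (t * W n x) - iexp (t * ?U x)) \<le> \<bar>t\<bar> * \<bar>W n x - ?U x\<bar>" for x
      using lip[of "t * W n x" "t * ?U x"] by (simp add: abs_mult flip: right_diff_distrib)
  qed (use i W_minus_U_L1(2)[OF n] in auto)
  also have "\<dots> \<le> ?b1" using W_minus_U_L1[OF n] by (simp add: mult_left_mono)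
  finally have 1: "cmod (?w - (CLINT x|deg.P n. iexp (t * ?U x))) \<le> ?b1" .
  have "cmod (?w - ?e) \<le> cmod (?w - (CLINT x|deg.P n. iexp (t * ?U x))) + cmod ((CLINT x|deg.P n. iexp (t * ?U x)) - ?e)"
    using norm_triangle_ineq[of "?w - (CLINT x|deg.P n. iexp (t * ?U x))" "(CLINT x|deg.P n. iexp (t * ?U x)) - ?e"] by simp
  then show ?thesis using 1 deg.char_bound[OF n K, of t] by linarith
qed

end

subsection \<open>Normalized columns\<close>

locale standardized_entry = real_distribution D for D :: "real measure" +
  assumes mean: "integrable D (\<lambda>x. x)" "(\<integral>x. x \<partial>D) = 0"
    and second_moment: "integrable D (\<lambda>x. x\<^sup>2)" "(\<integral>x. x\<^sup>2 \<partial>D) = 1"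
    and fourth_moment: "integrable D (\<lambda>x. x ^ 4)"
begin

definition \<kappa> :: real where "\<kappa> = (\<integral>x. x ^ 4 \<partial>D)"

abbreviation Col :: "nat \<Rightarrow> (nat \<Rightarrow> real) measure" where "Col p \<equiv> PiM {..<p} (\<lambda>_. D)"

sublocale prodD: product_prob_space "\<lambda>_::nat. D" UNIV by unfold_locales

lemma prob_space_Col: "prob_space (Col p)"
  by (rule prob_space_PiM) unfold_locales

lemma prob_UNIV: "measure D UNIV = 1" using prob_space by simp

lemma \<kappa>_ge_1: "1 \<le> \<kappa>"
proof -
  have "(\<integral>x. x\<^sup>2 \<partial>D)\<^sup>2 \<le> (\<integral>x. (x\<^sup>2)\<^sup>2 \<partial>D)"
    using second_moment fourth_moment by (intro square_expectation_le) auto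
  then show ?thesis using second_moment by (simp add: \<kappa>_def)
qed

lemma power_int: "k \<le> 4 \<Longrightarrow> integrable D (\<lambda>x. x ^ k)"
  using integrable_power_le4[of "\<lambda>x. x" k] fourth_moment by simp

lemma coord_meas [measurable]: "k < p \<Longrightarrow> (\<lambda>z. z k) \<in> borel_measurable (Col p)"
  using measurable_component_singleton[of k "{..<p}" "\<lambda>_. D"] by simp

lemma coord_int:
  fixes f :: "real \<Rightarrow> real"
  assumes "k < p" "integrable D f"
  shows "integrable (Col p) (\<lambda>z. f (z k))"
proof -
  have "distr (Col p) D (\<lambda>z. z k) = D"
    using assms by (intro distr_PiM_component) (auto intro: prob_space_axioms)
  then show ?thesis using assms by (intro integrable_distr[of "\<lambda>z. z k" "Col p" D f]) auto
qed

lemma monomial_sq_int: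
  assumes "k < p" "l < p"
  shows "integrable (Col p) (\<lambda>z. (z k * z l)\<^sup>2)" "integrable (Col p) (\<lambda>z. (z k)\<^sup>2)"
proof -
  show "integrable (Col p) (\<lambda>z. (z k)\<^sup>2)" using coord_int[OF assms(1) second_moment(1)] .
  show "integrable (Col p) (\<lambda>z. (z k * z l)\<^sup>2)"
  proof (rule Bochner_Integration.integrable_bound)
    show "integrable (Col p) (\<lambda>z. z k ^ 4 + z l ^ 4)"
      using coord_int[OF assms(1) fourth_moment] coord_int[OF assms(2) fourth_moment] by auto
    have "(a * b)\<^sup>2 \<le> a ^ 4 + b ^ 4" for a b :: real
    proof -
      have "0 \<le> (a\<^sup>2 - b\<^sup>2)\<^sup>2" "0 \<le> a ^ 4" "0 \<le> b ^ 4" by auto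
      then show ?thesis by (simp add: power2_eq_square power4_eq_xxxx algebra_simps)
    qed
    then show "AE z in Col p. norm ((z k * z l)\<^sup>2) \<le> norm (z k ^ 4 + z l ^ 4)"
      by (auto intro!: AE_I2)
    show "(\<lambda>z. (z k * z l)\<^sup>2) \<in> borel_measurable (Col p)" using assms by measurable
  qed
qed

lemma integral_Col_Suc:
  fixes f :: "(nat \<Rightarrow> real) \<Rightarrow> real"
  assumes "integrable (Col (Suc p)) f"
  shows "(\<integral>z. f z \<partial>Col (Suc p)) = (\<integral>z. \<integral>y. f (z(p := y)) \<partial>D \<partial>Col p)"
  using prodD.product_integral_insert[of "{..<p}" p f] assms by (simp add: lessThan_Suc)

section \<open>Linear and quadratic forms in a column\<close>

definition lin :: "(nat \<Rightarrow> real) \<Rightarrow> nat \<Rightarrow> (nat \<Rightarrow> real) \<Rightarrow> real" where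
  "lin c p z = (\<Sum>k<p. c k * z k)"

text \<open>Centring entry by entry gives a recursion in \<open>p\<close> in which each new
  coordinate adds a conditionally centred increment.\<close>

definition quad :: "(nat \<Rightarrow> nat \<Rightarrow> real) \<Rightarrow> nat \<Rightarrow> (nat \<Rightarrow> real) \<Rightarrow> real" where
  "quad M p z = (\<Sum>k<p. \<Sum>l<p. M k l * (z k * z l - (if k = l then 1 else 0)))"

lemma lin_meas [measurable]: "lin c p \<in> borel_measurable (Col p)"
  unfolding lin_def by (intro borel_measurable_sum borel_measurable_times borel_measurable_const coord_meas) auto

lemma quad_meas [measurable]: "quad M p \<in> borel_measurable (Col p)"
  unfolding quad_def
  by (intro borel_measurable_sum borel_measurable_times borel_measurable_diff borel_measurable_const coord_meas) auto

lemma lin_sq_int: "integrable (Col p) (\<lambda>z. (lin c p z)\<^sup>2)"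
  unfolding lin_def using monomial_sq_int(2)
  by (intro integrable_square_sum borel_measurable_times borel_measurable_const coord_meas)
     (auto simp: power_mult_distrib)

lemma quad_sq_int: "integrable (Col p) (\<lambda>z. (quad M p z)\<^sup>2)"
proof -
  interpret C: prob_space "Col p" by (rule prob_space_Col)
  have "integrable (Col p) (\<lambda>z. (M k l * (z k * z l - (if k = l then 1 else 0)))\<^sup>2)" if "k < p" "l < p" for k l
  proof (rule Bochner_Integration.integrable_bound)
    show "integrable (Col p) (\<lambda>z. (M k l)\<^sup>2 * (2 * (z k * z l)\<^sup>2 + 2))" using monomial_sq_int[OF that] by auto
    show "(\<lambda>z. (M k l * (z k * z l - (if k = l then 1 else 0)))\<^sup>2) \<in> borel_measurable (Col p)"
      using that by measurable
    have "(M k l * (u - (if k = l then 1 else 0)))\<^sup>2 \<le> (M k l)\<^sup>2 * (2 * u\<^sup>2 + 2)" for u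
      using square_diff_le[of u "if k = l then 1 else 0"] unfolding power_mult_distrib
      by (intro mult_left_mono) (auto split: if_splits)
    then show "AE z in Col p. norm ((M k l * (z k * z l - (if k = l then 1 else 0)))\<^sup>2)
        \<le> norm ((M k l)\<^sup>2 * (2 * (z k * z l)\<^sup>2 + 2))"
      by (auto intro!: AE_I2)
  qed
  then show ?thesis
    unfolding quad_def
    by (intro integrable_square_sum borel_measurable_sum borel_measurable_times borel_measurable_diff
        borel_measurable_const coord_meas) auto
qed

lemma lin_int: "integrable (Col p) (lin c p)"
  and quad_int: "integrable (Col p) (quad M p)"
proof -
  interpret C: prob_space "Col p" by (rule prob_space_Col)
  show "integrable (Col p) (lin c p)" by (rule C.square_integrable_imp_integrable[OF lin_meas lin_sq_int])
  show "integrable (Col p) (quad M p)" by (rule C.square_integrable_imp_integrable[OF quad_meas quad_sq_int])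
qed

lemma lin_Suc: "lin c (Suc p) (z(p := y)) = lin c p z + c p * y"
  unfolding lin_def by simp

lemma quad_Suc:
  "quad M (Suc p) (z(p := y)) = quad M p z + y * lin (\<lambda>k. M k p + M p k) p z + M p p * (y\<^sup>2 - 1)"
proof -
  have 1: "(\<Sum>k<p. \<Sum>l<p. M k l * ((z(p := y)) k * (z(p := y)) l - (if k = l then 1 else 0))) = quad M p z"
    unfolding quad_def by (intro sum.cong) auto
  have 2: "(\<Sum>k<p. M k p * ((z(p := y)) k * y - (if k = p then 1 else 0))) = y * (\<Sum>k<p. M k p * z k)"
    unfolding sum_distrib_left by (intro sum.cong) auto
  have 3: "(\<Sum>l<p. M p l * (y * (z(p := y)) l - (if p = l then 1 else 0))) = y * (\<Sum>k<p. M p k * z k)"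
    unfolding sum_distrib_left by (intro sum.cong) auto
  have "quad M (Suc p) (z(p := y)) = quad M p z + y * (\<Sum>k<p. M k p * z k) + (y * (\<Sum>k<p. M p k * z k) + M p p * (y * y - 1))"
    unfolding quad_def[of M "Suc p"] sum.lessThan_Suc sum.distrib using 1 2 3 by simp
  also have "\<dots> = quad M p z + y * lin (\<lambda>k. M k p + M p k) p z + M p p * (y\<^sup>2 - 1)"
    unfolding lin_def by (simp add: sum.distrib algebra_simps power2_eq_square)
  finally show ?thesis .
qed

lemma lin_moments: "(\<integral>z. lin c p z \<partial>Col p) = 0" "(\<integral>z. (lin c p z)\<^sup>2 \<partial>Col p) = (\<Sum>k<p. (c k)\<^sup>2)"
proof -
  have "(\<integral>z. lin c p z \<partial>Col p) = 0 \<and> (\<integral>z. (lin c p z)\<^sup>2 \<partial>Col p) = (\<Sum>k<p. (c k)\<^sup>2)"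
  proof (induction p)
    case 0
    show ?case by (simp add: lin_def)
  next
    case (Suc p)
    interpret C: prob_space "Col p" by (rule prob_space_Col)
    have "(\<integral>z. lin c (Suc p) z \<partial>Col (Suc p)) = (\<integral>z. lin c p z \<partial>Col p)"
      unfolding integral_Col_Suc[OF lin_int] lin_Suc using mean by (simp add: prob_UNIV)
    moreover have "(\<integral>z. (lin c (Suc p) z)\<^sup>2 \<partial>Col (Suc p)) = (\<integral>z. (lin c p z)\<^sup>2 + (c p)\<^sup>2 \<partial>Col p)"
      unfolding integral_Col_Suc[OF lin_sq_int] lin_Suc
    proof (intro Bochner_Integration.integral_cong refl)
      fix z
      have "(\<integral>y. (lin c p z + c p * y)\<^sup>2 \<partial>D) = (\<integral>y. (lin c p z)\<^sup>2 + (2 * lin c p z * c p) * y + (c p)\<^sup>2 * y\<^sup>2 \<partial>D)"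
        by (simp add: power2_eq_square algebra_simps)
      also have "\<dots> = (lin c p z)\<^sup>2 + (c p)\<^sup>2"
        using mean second_moment by (simp add: prob_UNIV)
      finally show "(\<integral>y. (lin c p z + c p * y)\<^sup>2 \<partial>D) = (lin c p z)\<^sup>2 + (c p)\<^sup>2" .
    qed
    moreover have "\<dots> = (\<integral>z. (lin c p z)\<^sup>2 \<partial>Col p) + (c p)\<^sup>2"
      using lin_sq_int by (simp add: C.prob_space)
    ultimately show ?case using Suc by simp
  qed
  then show "(\<integral>z. lin c p z \<partial>Col p) = 0" "(\<integral>z. (lin c p z)\<^sup>2 \<partial>Col p) = (\<Sum>k<p. (c k)\<^sup>2)" by auto
qed

text \<open>A new coordinate \<open>y\<close> adds \<open>y * L + m * (y\<^sup>2 - 1)\<close>, which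
  is centred given the earlier ones, so second moments add; the cross term with the third moment is
  linear in \<open>L\<close> and averages to zero. The required factor is 2 off the diagonal and
  \<open>\<kappa> - 1\<close> on it; \<open>\<kappa> + 1\<close> covers both because
  \<open>\<kappa> \<ge> 1\<close>.\<close>

lemma quad_moments:
  "(\<integral>z. quad M p z \<partial>Col p) = 0"
  "(\<integral>z. (quad M p z)\<^sup>2 \<partial>Col p) \<le> (\<kappa> + 1) * (\<Sum>k<p. \<Sum>l<p. (M k l)\<^sup>2)"
proof -
  have "(\<integral>z. quad M p z \<partial>Col p) = 0 \<and> (\<integral>z. (quad M p z)\<^sup>2 \<partial>Col p) \<le> (\<kappa> + 1) * (\<Sum>k<p. \<Sum>l<p. (M k l)\<^sup>2)"
  proof (induction p)
    case 0
    show ?case by (simp add: quad_def)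
  next
    case (Suc p)
    interpret C: prob_space "Col p" by (rule prob_space_Col)
    define L where "L = lin (\<lambda>k. M k p + M p k) p"
    define m where "m = M p p"
    define m3 where "m3 = (\<integral>y. y ^ 3 \<partial>D)"
    have i3: "integrable D (\<lambda>y. y ^ 3)" by (rule power_int) simp
    have iL: "integrable (Col p) L" "integrable (Col p) (\<lambda>z. (L z)\<^sup>2)"
      unfolding L_def by (rule lin_int lin_sq_int)+
    have "(\<integral>z. quad M (Suc p) z \<partial>Col (Suc p)) = (\<integral>z. quad M p z \<partial>Col p)"
      unfolding integral_Col_Suc[OF quad_int] quad_Suc L_def[symmetric] m_def[symmetric]
      using mean second_moment by (simp add: prob_UNIV)
    moreover have "(\<integral>z. (quad M (Suc p) z)\<^sup>2 \<partial>Col (Suc p)) \<le> (\<kappa> + 1) * (\<Sum>k<Suc p. \<Sum>l<Suc p. (M k l)\<^sup>2)"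
    proof -
      have "(\<integral>z. (quad M (Suc p) z)\<^sup>2 \<partial>Col (Suc p))
          = (\<integral>z. (quad M p z)\<^sup>2 + (L z)\<^sup>2 + 2 * m * m3 * L z + m\<^sup>2 * (\<kappa> - 1) \<partial>Col p)"
        unfolding integral_Col_Suc[OF quad_sq_int] quad_Suc L_def[symmetric] m_def[symmetric]
      proof (intro Bochner_Integration.integral_cong refl)
        fix z
        let ?R = "quad M p z"
        have "(\<integral>y. (?R + y * L z + m * (y\<^sup>2 - 1))\<^sup>2 \<partial>D)
          = (\<integral>y. (?R - m)\<^sup>2 + 2 * (?R - m) * L z * y + ((L z)\<^sup>2 + 2 * (?R - m) * m) * y\<^sup>2
              + 2 * L z * m * y ^ 3 + m\<^sup>2 * y ^ 4 \<partial>D)"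
          by (intro Bochner_Integration.integral_cong refl)
             (simp add: power2_eq_square power3_eq_cube power4_eq_xxxx algebra_simps)
        also have "\<dots> = (?R - m)\<^sup>2 + ((L z)\<^sup>2 + 2 * (?R - m) * m) + 2 * L z * m * m3 + m\<^sup>2 * \<kappa>"
          using mean second_moment fourth_moment i3 by (simp add: prob_UNIV m3_def \<kappa>_def)
        also have "\<dots> = ?R\<^sup>2 + (L z)\<^sup>2 + 2 * m * m3 * L z + m\<^sup>2 * (\<kappa> - 1)"
          by (simp add: power2_eq_square algebra_simps)
        finally show "(\<integral>y. (?R + y * L z + m * (y\<^sup>2 - 1))\<^sup>2 \<partial>D) = \<dots>" .
      qed
      also have "\<dots> = (\<integral>z. (quad M p z)\<^sup>2 \<partial>Col p) + (\<integral>z. (L z)\<^sup>2 \<partial>Col p) + m\<^sup>2 * (\<kappa> - 1)"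
        using iL quad_sq_int lin_moments(1)[where c = "\<lambda>k. M k p + M p k" and p = p]
        by (simp add: C.prob_space L_def)
      also have "(\<integral>z. (L z)\<^sup>2 \<partial>Col p) = (\<Sum>k<p. (M k p + M p k)\<^sup>2)"
        unfolding L_def by (rule lin_moments)
      also have "\<dots> \<le> (\<Sum>k<p. (\<kappa> + 1) * ((M k p)\<^sup>2 + (M p k)\<^sup>2))"
      proof (rule sum_mono)
        fix k
        have "(M k p + M p k)\<^sup>2 \<le> 2 * ((M k p)\<^sup>2 + (M p k)\<^sup>2)"
          using square_diff_le[of "M k p" "- M p k"] by simp
        also have "\<dots> \<le> (\<kappa> + 1) * ((M k p)\<^sup>2 + (M p k)\<^sup>2)" using \<kappa>_ge_1 by (intro mult_right_mono) auto
        finally show "(M k p + M p k)\<^sup>2 \<le> \<dots>" .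
      qed
      also have "m\<^sup>2 * (\<kappa> - 1) \<le> (\<kappa> + 1) * (M p p)\<^sup>2" unfolding m_def by (simp add: algebra_simps)
      also have "(\<integral>z. (quad M p z)\<^sup>2 \<partial>Col p) \<le> (\<kappa> + 1) * (\<Sum>k<p. \<Sum>l<p. (M k l)\<^sup>2)" using Suc by simp
      finally show ?thesis
        by (simp add: sum_distrib_left[symmetric] sum.distrib algebra_simps)
    qed
    ultimately show ?case using Suc by simp
  qed
  then show "(\<integral>z. quad M p z \<partial>Col p) = 0"
    "(\<integral>z. (quad M p z)\<^sup>2 \<partial>Col p) \<le> (\<kappa> + 1) * (\<Sum>k<p. \<Sum>l<p. (M k l)\<^sup>2)" by auto
qed

section \<open>Lower tail of the squared norm\<close>

definition sqn :: "nat \<Rightarrow> (nat \<Rightarrow> real) \<Rightarrow> real" where "sqn p z = (\<Sum>k<p. (z k)\<^sup>2)"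

definition tail_prob :: "nat \<Rightarrow> real" where "tail_prob p = exp (- real p / (8 * \<kappa>))"

lemma sqn_meas [measurable]: "sqn p \<in> borel_measurable (Col p)"
  unfolding sqn_def by (intro borel_measurable_sum borel_measurable_power coord_meas) auto

lemma sqn_nonneg: "0 \<le> sqn p z" unfolding sqn_def by (intro sum_nonneg) auto

text \<open>Chernoff's bound. As squares are nonnegative,
  \<open>exp (- u) \<le> 1 - u + u\<^sup>2 / 2\<close> can be integrated at
  \<open>u = s * x\<^sup>2\<close> with four moments only, and this gives exponential decay without
  exponential moments.\<close>

lemma prob_sqn_small: "measure (Col p) {z \<in> space (Col p). sqn p z < real p / 2} \<le> tail_prob p"
proof -
  interpret C: prob_space "Col p" by (rule prob_space_Col)
  \<comment> \<open>Minimizes the exponent \<open>p * (- s / 2 + s\<^sup>2 * \<kappa> / 2)\<close>;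
    its value is then \<open>- p / (8 * \<kappa>)\<close>.\<close>
  define s where "s = 1 / (2 * \<kappa>)"
  have s: "0 < s" using \<kappa>_ge_1 by (simp add: s_def)
  have exp_le: "exp (- u) \<le> 1 - u + u\<^sup>2 / 2" if "0 \<le> u" for u :: real
    using exp_minus_quadratic[OF that] by linarith
  have iexp: "integrable D (\<lambda>x. exp (- (s * x\<^sup>2)))"
    using s by (intro integrable_const_bound[where B = 1]) auto
  have "(\<integral>x. exp (- (s * x\<^sup>2)) \<partial>D) \<le> (\<integral>x. 1 - s * x\<^sup>2 + s\<^sup>2 / 2 * x ^ 4 \<partial>D)"
  proof (rule integral_mono[OF iexp])
    show "integrable D (\<lambda>x. 1 - s * x\<^sup>2 + s\<^sup>2 / 2 * x ^ 4)" using second_moment fourth_moment by auto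
    show "exp (- (s * x\<^sup>2)) \<le> 1 - s * x\<^sup>2 + s\<^sup>2 / 2 * x ^ 4" for x
      using exp_le[of "s * x\<^sup>2"] s by (simp add: power_mult_distrib)
  qed
  also have "\<dots> = 1 + (- s + s\<^sup>2 / 2 * \<kappa>)"
    using second_moment fourth_moment by (simp add: prob_UNIV \<kappa>_def)
  also have "\<dots> \<le> exp (- s + s\<^sup>2 / 2 * \<kappa>)" by (rule exp_ge_add_one_self)
  finally have one: "(\<integral>x. exp (- (s * x\<^sup>2)) \<partial>D) \<le> exp (- s + s\<^sup>2 / 2 * \<kappa>)" .
  have prod_eq: "exp (- (s * sqn p z)) = (\<Prod>k<p. exp (- (s * (z k)\<^sup>2)))" for z
    unfolding sqn_def by (simp add: exp_sum[symmetric] sum_negf sum_distrib_left)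
  have ie: "integrable (Col p) (\<lambda>z. exp (- (s * sqn p z)))"
    unfolding prod_eq using iexp by (intro prodD.product_integrable_prod) auto
  have "(\<integral>z. exp (- (s * sqn p z)) \<partial>Col p) = (\<integral>x. exp (- (s * x\<^sup>2)) \<partial>D) ^ p"
    unfolding prod_eq using iexp
    by (subst prodD.product_integral_prod) (auto simp: prod_constant)
  also have "\<dots> \<le> exp (- s + s\<^sup>2 / 2 * \<kappa>) ^ p"
    using one by (intro power_mono integral_nonneg_AE AE_I2) auto
  finally have two: "(\<integral>z. exp (- (s * sqn p z)) \<partial>Col p) \<le> exp (real p * (- s + s\<^sup>2 / 2 * \<kappa>))"
    by (simp add: exp_of_nat_mult)
  have "measure (Col p) {z \<in> space (Col p). sqn p z < real p / 2}
      = (\<integral>z. indicator {z \<in> space (Col p). sqn p z < real p / 2} z \<partial>Col p)"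
    by simp
  also have "\<dots> \<le> (\<integral>z. exp (s * (real p / 2)) * exp (- (s * sqn p z)) \<partial>Col p)"
  proof (rule integral_mono)
    show "indicator {z \<in> space (Col p). sqn p z < real p / 2} z \<le> exp (s * (real p / 2)) * exp (- (s * sqn p z))" for z
      using s by (auto simp: indicator_def exp_add[symmetric] simp flip: right_diff_distrib)
  qed (use ie in \<open>auto intro!: C.integrable_const_bound[where B = 1]\<close>)
  also have "\<dots> = exp (s * (real p / 2)) * (\<integral>z. exp (- (s * sqn p z)) \<partial>Col p)" by simp
  also have "\<dots> \<le> exp (s * (real p / 2)) * exp (real p * (- s + s\<^sup>2 / 2 * \<kappa>))"
    using two by (intro mult_left_mono) auto
  also have "\<dots> = tail_prob p"
    using \<kappa>_ge_1 unfolding tail_prob_def s_def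
    by (simp add: exp_add[symmetric] power2_eq_square field_simps)
  finally show ?thesis .
qed

section \<open>Features of a normalized column\<close>

definition idx :: "nat \<Rightarrow> (nat \<times> nat) set" where "idx p = {..<p} \<times> {..<p}"

text \<open>
  The matrix \<open>z z\<^sup>T / |z|\<^sup>2 - I / p\<close>, flattened. At \<open>sqn p z = 0\<close> the quotient is \<open>0\<close>, leaving \<open>- I / p\<close>.
\<close>

definition feat :: "nat \<Rightarrow> nat \<times> nat \<Rightarrow> (nat \<Rightarrow> real) \<Rightarrow> real" where
  "feat p a z = z (fst a) * z (snd a) / sqn p z - (if fst a = snd a then 1 / real p else 0)"

text \<open>In this constant and the next, the first summand comes from moments of quadratic forms
  and the second from the exceptional event of a short column. Their orders are \<open>p^-2\<close>
  and \<open>p^(-3/2)\<close>.\<close>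

definition op_const :: "nat \<Rightarrow> real" where "op_const p = 16 * (\<kappa> + 1) / (real p)\<^sup>2 + tail_prob p"
definition mean_const :: "nat \<Rightarrow> real" where
  "mean_const p = 9 * (\<kappa> + 1) * sqrt (real p) / (real p)\<^sup>2 + 2 * tail_prob p"

lemma finite_idx: "finite (idx p)" by (simp add: idx_def)

lemma sum_idx: "(\<Sum>a\<in>idx p. f a) = (\<Sum>k<p. \<Sum>l<p. f (k, l))"
  unfolding idx_def by (simp add: sum.cartesian_product)

lemma feat_lin:
  "(\<Sum>a\<in>idx p. feat p a z * M a) = (\<Sum>k<p. \<Sum>l<p. M (k, l) * (z k * z l)) / sqn p z - (\<Sum>k<p. M (k, k)) / real p"
proof -
  have "(\<Sum>a\<in>idx p. feat p a z * M a) = (\<Sum>k<p. \<Sum>l<p. M (k, l) * (z k * z l) / sqn p z - (if k = l then M (k, k) / real p else 0))"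
    unfolding sum_idx feat_def by (intro sum.cong refl) (simp add: algebra_simps)
  also have "\<dots> = (\<Sum>k<p. (\<Sum>l<p. M (k, l) * (z k * z l) / sqn p z) - M (k, k) / real p)"
    by (intro sum.cong refl) (simp add: sum_subtractf)
  finally show ?thesis by (simp add: sum_subtractf sum_divide_distrib)
qed

lemma feat_trace: "sqn p z \<noteq> 0 \<Longrightarrow> (\<Sum>k<p. feat p (k, k) z) = 0"
proof -
  assume q: "sqn p z \<noteq> 0"
  then have "p \<noteq> 0" by (auto simp: sqn_def intro: ccontr)
  have "(\<Sum>k<p. feat p (k, k) z) = sqn p z / sqn p z - 1"
    using \<open>p \<noteq> 0\<close> unfolding feat_def by (simp add: sum_subtractf sqn_def power2_eq_square sum_divide_distrib[symmetric])
  then show ?thesis using q by simp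
qed

text \<open>The features of \<open>y\<close> have trace zero, so the identity part in those of
  \<open>z\<close> drops out. Hence only \<open>y\<close> must be nonzero: at
  \<open>sqn p z = 0\<close> both sides are 0.\<close>

lemma feat_inner:
  assumes "sqn p y \<noteq> 0"
  shows "(\<Sum>a\<in>idx p. feat p a z * feat p a y) =
     ((\<Sum>k<p. z k * y k)\<^sup>2 / sqn p y - sqn p z / real p) / sqn p z"
proof -
  have "(\<Sum>k<p. \<Sum>l<p. feat p (k, l) y * (z k * z l)) = (\<Sum>a\<in>idx p. feat p a y * (z (fst a) * z (snd a)))"
    unfolding sum_idx by simp
  also have "\<dots> = (\<Sum>k<p. \<Sum>l<p. (z k * z l) * (y k * y l)) / sqn p y - (\<Sum>k<p. z k * z k) / real p"
    using feat_lin[of p y "\<lambda>a. z (fst a) * z (snd a)"] by simp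
  also have "(\<Sum>k<p. \<Sum>l<p. (z k * z l) * (y k * y l)) = (\<Sum>k<p. z k * y k)\<^sup>2"
    unfolding power2_eq_square sum_product by (intro sum.cong) auto
  also have "(\<Sum>k<p. z k * z k) = sqn p z" unfolding sqn_def by (simp add: power2_eq_square)
  finally show ?thesis unfolding feat_lin feat_trace[OF assms] by simp
qed

text \<open>The exact value is \<open>1 - 1 / p\<close>, or \<open>1 / p\<close> when the column
  vanishes.\<close>

lemma feat_norm:
  assumes p: "0 < p"
  shows "(\<Sum>a\<in>idx p. (feat p a z)\<^sup>2) \<le> 1"
proof (cases "sqn p z = 0")
  case False
  have "(\<Sum>k<p. z k * z k) = sqn p z" unfolding sqn_def by (simp add: power2_eq_square)
  then have "(\<Sum>a\<in>idx p. (feat p a z)\<^sup>2) = ((sqn p z)\<^sup>2 / sqn p z - sqn p z / real p) / sqn p z"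
    using feat_inner[OF False, of z] by (simp add: power2_eq_square)
  also have "\<dots> = 1 - 1 / real p" using False p by (simp add: field_simps power2_eq_square)
  finally show ?thesis by simp
next
  case True
  have "(\<Sum>a\<in>idx p. (feat p a z)\<^sup>2) = - (\<Sum>k<p. feat p (k, k) z) / real p"
    using feat_lin[of p z "\<lambda>a. feat p a z"] True by (simp add: power2_eq_square)
  also have "\<dots> = 1 / real p" using p True by (simp add: feat_def sum_negf)
  finally show ?thesis using p by simp
qed

lemma feat_meas: "a \<in> idx p \<Longrightarrow> feat p a \<in> borel_measurable (Col p)"
proof -
  assume "a \<in> idx p"
  then have a [measurable]: "(\<lambda>z. z (fst a)) \<in> borel_measurable (Col p)" "(\<lambda>z. z (snd a)) \<in> borel_measurable (Col p)"
    by (auto simp: idx_def)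
  show ?thesis unfolding feat_def by measurable
qed

text \<open>The quadratic form of the traceless part of \<open>M\<close>. As the features of a
  nonzero column are traceless, they see nothing else of \<open>M\<close>. This form has mean
  exactly zero, so for such columns the bias stems from the random denominator.\<close>

definition centred :: "(nat \<times> nat \<Rightarrow> real) \<Rightarrow> nat \<Rightarrow> (nat \<Rightarrow> real) \<Rightarrow> real" where
  "centred M p z = quad (\<lambda>k l. M (k, l)) p z
     - (\<Sum>k<p. M (k, k)) / real p * quad (\<lambda>k l. if k = l then 1 else 0) p z"

lemma quad_id: "quad (\<lambda>k l. if k = l then 1 else 0) p z = sqn p z - real p"
proof -
  have "quad (\<lambda>k l. if k = l then 1 else 0) p z = (\<Sum>k<p. \<Sum>l<p. if k = l then (z k)\<^sup>2 - 1 else 0)"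
    unfolding quad_def by (intro sum.cong refl) (simp add: power2_eq_square)
  then show ?thesis unfolding sqn_def by (simp add: sum_subtractf)
qed

lemma feat_lin_centred:
  assumes "sqn p z \<noteq> 0" "0 < p"
  shows "(\<Sum>a\<in>idx p. feat p a z * M a) = centred M p z / sqn p z"
proof -
  have "quad (\<lambda>k l. M (k, l)) p z = (\<Sum>k<p. \<Sum>l<p. M (k, l) * (z k * z l)) - (\<Sum>k<p. M (k, k))"
  proof -
    have "quad (\<lambda>k l. M (k, l)) p z = (\<Sum>k<p. \<Sum>l<p. M (k, l) * (z k * z l) - (if k = l then M (k, k) else 0))"
      unfolding quad_def by (intro sum.cong refl) (simp add: algebra_simps)
    then show ?thesis by (simp add: sum_subtractf)
  qed
  moreover have "S / q - T / r = ((S - T) - T / r * (q - r)) / q" if "q \<noteq> 0" "r \<noteq> 0" for S T q r :: real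
    using that by (simp add: field_simps)
  ultimately show ?thesis unfolding feat_lin centred_def quad_id using assms by simp
qed

lemma trace_sq_le: "(\<Sum>k<p. M (k, k))\<^sup>2 \<le> real p * (\<Sum>a\<in>idx p. (M a)\<^sup>2)"
proof -
  have "(\<Sum>k<p. M (k, k) * 1)\<^sup>2 \<le> (\<Sum>k<p. (M (k, k))\<^sup>2) * (\<Sum>k<p. 1\<^sup>2)"
    by (rule Cauchy_Schwarz_ineq_sum)
  moreover have "(\<Sum>k<p. (M (k, k))\<^sup>2) \<le> (\<Sum>a\<in>idx p. (M a)\<^sup>2)"
    unfolding sum_idx by (intro sum_mono member_le_sum) auto
  ultimately show ?thesis
    using mult_left_mono[of "\<Sum>k<p. (M (k, k))\<^sup>2" "\<Sum>a\<in>idx p. (M a)\<^sup>2" "real p"]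
    by (simp add: mult.commute)
qed

lemma sqn_deviation: "(\<integral>z. (sqn p z - real p)\<^sup>2 \<partial>Col p) \<le> (\<kappa> + 1) * real p"
  and sqn_deviation_int: "integrable (Col p) (\<lambda>z. (sqn p z - real p)\<^sup>2)"
proof -
  let ?I = "\<lambda>k l. if k = l then 1 else 0 :: real"
  have "(\<Sum>k<p. \<Sum>l<p. (?I k l)\<^sup>2) = (\<Sum>k<p. \<Sum>l<p. ?I k l)" by (intro sum.cong) auto
  also have "\<dots> = real p" by simp
  finally have s: "(\<Sum>k<p. \<Sum>l<p. (?I k l)\<^sup>2) = real p" .
  show "(\<integral>z. (sqn p z - real p)\<^sup>2 \<partial>Col p) \<le> (\<kappa> + 1) * real p"
    using quad_moments(2)[where M = ?I and p = p] unfolding quad_id s .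
  show "integrable (Col p) (\<lambda>z. (sqn p z - real p)\<^sup>2)"
    using quad_sq_int[where M = ?I and p = p] unfolding quad_id .
qed

lemma centred_meas [measurable]: "centred M p \<in> borel_measurable (Col p)"
  unfolding centred_def by measurable

text \<open>Removing the trace costs \<open>(tr M)^2 / p^2\<close> times the second moment of
  \<open>sqn p z - p\<close>. By \<open>(tr M)^2 \<le> p * |M|^2\<close> this is no larger than the
  bound for the full form, and squaring a difference doubles both.\<close>

lemma centred_sq_int: "integrable (Col p) (\<lambda>z. (centred M p z)\<^sup>2)"
  and centred_second_moment: "0 < p \<Longrightarrow> (\<integral>z. (centred M p z)\<^sup>2 \<partial>Col p) \<le> 4 * (\<kappa> + 1) * (\<Sum>a\<in>idx p. (M a)\<^sup>2)"
  and centred_mean: "(\<integral>z. centred M p z \<partial>Col p) = 0"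
proof -
  define f where "f = quad (\<lambda>k l. M (k, l)) p"
  define T where "T = (\<Sum>k<p. M (k, k))"
  define n where "n = (\<Sum>a\<in>idx p. (M a)\<^sup>2)"
  have c: "centred M p z = f z - T / real p * (sqn p z - real p)" for z
    unfolding centred_def f_def T_def quad_id ..
  have f [measurable]: "f \<in> borel_measurable (Col p)" "integrable (Col p) (\<lambda>z. (f z)\<^sup>2)"
    "(\<integral>z. (f z)\<^sup>2 \<partial>Col p) \<le> (\<kappa> + 1) * n"
    unfolding f_def n_def sum_idx by (auto intro: quad_sq_int quad_moments)
  have le: "(centred M p z)\<^sup>2 \<le> 2 * (f z)\<^sup>2 + 2 * (T\<^sup>2 / (real p)\<^sup>2) * (sqn p z - real p)\<^sup>2" for z
    using square_diff_le[of "f z" "T / real p * (sqn p z - real p)"] unfolding c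
    by (simp add: power_mult_distrib power_divide)
  have ir: "integrable (Col p) (\<lambda>z. 2 * (f z)\<^sup>2 + 2 * (T\<^sup>2 / (real p)\<^sup>2) * (sqn p z - real p)\<^sup>2)"
    using f(2) sqn_deviation_int by (intro Bochner_Integration.integrable_add integrable_mult_right) auto
  show ic: "integrable (Col p) (\<lambda>z. (centred M p z)\<^sup>2)"
    by (rule Bochner_Integration.integrable_bound[OF ir])
       (use le in \<open>auto intro!: AE_I2 order.trans[OF le abs_ge_self]\<close>)
  show "(\<integral>z. centred M p z \<partial>Col p) = 0"
    unfolding centred_def using quad_int quad_moments(1) by simp
  assume p: "0 < p"
  have "(\<integral>z. (centred M p z)\<^sup>2 \<partial>Col p) \<le> (\<integral>z. 2 * (f z)\<^sup>2 + 2 * (T\<^sup>2 / (real p)\<^sup>2) * (sqn p z - real p)\<^sup>2 \<partial>Col p)"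
    using ic ir le by (rule integral_mono)
  also have "\<dots> = 2 * (\<integral>z. (f z)\<^sup>2 \<partial>Col p) + 2 * (T\<^sup>2 / (real p)\<^sup>2) * (\<integral>z. (sqn p z - real p)\<^sup>2 \<partial>Col p)"
    using f(2) sqn_deviation_int by simp
  also have "\<dots> \<le> 2 * ((\<kappa> + 1) * n) + 2 * (real p * n / (real p)\<^sup>2) * ((\<kappa> + 1) * real p)"
  proof (intro add_mono mult_mono)
    show "T\<^sup>2 / (real p)\<^sup>2 \<le> real p * n / (real p)\<^sup>2"
      unfolding T_def n_def by (intro divide_right_mono trace_sq_le) auto
    show "0 \<le> 2 * (real p * n / (real p)\<^sup>2)" unfolding n_def by (auto intro!: sum_nonneg divide_nonneg_nonneg mult_nonneg_nonneg)
  qed (use f(3) sqn_deviation in \<open>auto intro!: integral_nonneg_AE AE_I2\<close>)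
  also have "\<dots> = 4 * (\<kappa> + 1) * n" using p by (simp add: power2_eq_square field_simps)
  finally show "(\<integral>z. (centred M p z)\<^sup>2 \<partial>Col p) \<le> 4 * (\<kappa> + 1) * (\<Sum>a\<in>idx p. (M a)\<^sup>2)" unfolding n_def .
qed

lemma feat_lin_bounded:
  assumes "0 < p"
  shows "(\<Sum>a\<in>idx p. feat p a z * M a)\<^sup>2 \<le> (\<Sum>a\<in>idx p. (M a)\<^sup>2)"
proof -
  have "(\<Sum>a\<in>idx p. feat p a z * M a)\<^sup>2 \<le> (\<Sum>a\<in>idx p. (feat p a z)\<^sup>2) * (\<Sum>a\<in>idx p. (M a)\<^sup>2)"
    by (rule Cauchy_Schwarz_ineq_sum)
  also have "\<dots> \<le> 1 * (\<Sum>a\<in>idx p. (M a)\<^sup>2)"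
    by (intro mult_right_mono feat_norm[OF assms] sum_nonneg) auto
  finally show ?thesis by simp
qed

definition small :: "nat \<Rightarrow> (nat \<Rightarrow> real) set" where "small p = {z \<in> space (Col p). sqn p z < real p / 2}"

lemma small_sets [measurable]: "small p \<in> sets (Col p)" unfolding small_def by measurable

lemma small_int: "integrable (Col p) (indicator (small p) :: _ \<Rightarrow> real)"
proof -
  interpret C: prob_space "Col p" by (rule prob_space_Col)
  show ?thesis by (intro C.integrable_const_bound[where B = 1]) auto
qed

lemma small_integral: "(\<integral>z. indicator (small p) z \<partial>Col p) \<le> tail_prob p"
  using prob_sqn_small[of p] unfolding small_def by simp

lemma feat_lin_meas: "(\<lambda>z. \<Sum>a\<in>idx p. feat p a z * M a) \<in> borel_measurable (Col p)"
  using feat_meas by (intro borel_measurable_sum borel_measurable_times) auto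

text \<open>When the squared norm is at least \<open>p / 2\<close>, dividing the centred form by it
  costs a factor \<open>4 / p^2\<close> after squaring. The remaining columns have probability at
  most \<open>tail_prob p\<close>, and there Cauchy-Schwarz suffices.\<close>

lemma feat_op_bound:
  assumes p: "0 < p"
  shows "(\<integral>z. (\<Sum>a\<in>idx p. feat p a z * M a)\<^sup>2 \<partial>Col p) \<le> op_const p * (\<Sum>a\<in>idx p. (M a)\<^sup>2)"
proof -
  interpret C: prob_space "Col p" by (rule prob_space_Col)
  define n where "n = (\<Sum>a\<in>idx p. (M a)\<^sup>2)"
  have n0: "0 \<le> n" unfolding n_def by (intro sum_nonneg) auto
  have "(\<integral>z. (\<Sum>a\<in>idx p. feat p a z * M a)\<^sup>2 \<partial>Col p)
      \<le> (\<integral>z. 4 / (real p)\<^sup>2 * (centred M p z)\<^sup>2 + n * indicator (small p) z \<partial>Col p)"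
  proof (rule integral_mono)
    show "integrable (Col p) (\<lambda>z. (\<Sum>a\<in>idx p. feat p a z * M a)\<^sup>2)"
      using feat_lin_bounded[OF p, of _ M] feat_lin_meas[of p M] by (intro C.integrable_const_bound) auto
    show "integrable (Col p) (\<lambda>z. 4 / (real p)\<^sup>2 * (centred M p z)\<^sup>2 + n * indicator (small p) z)"
      using centred_sq_int small_int by (intro Bochner_Integration.integrable_add integrable_mult_right) auto
    fix z assume z: "z \<in> space (Col p)"
    show "(\<Sum>a\<in>idx p. feat p a z * M a)\<^sup>2 \<le> 4 / (real p)\<^sup>2 * (centred M p z)\<^sup>2 + n * indicator (small p) z"
    proof (cases "z \<in> small p")
      case True
      then show ?thesis using feat_lin_bounded[OF p, of z M] by (simp add: n_def add_increasing)
    next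
      case False
      then have q: "real p / 2 \<le> sqn p z" using z by (auto simp: small_def)
      then have q0: "0 < sqn p z" using p by linarith
      have "(\<Sum>a\<in>idx p. feat p a z * M a)\<^sup>2 = (centred M p z)\<^sup>2 / (sqn p z)\<^sup>2"
        using feat_lin_centred[of p z M] q0 p by (simp add: power_divide)
      also have "\<dots> \<le> (centred M p z)\<^sup>2 / (real p / 2)\<^sup>2"
        using q q0 p by (intro divide_left_mono power_mono) auto
      finally show ?thesis using False by (simp add: power_divide mult.commute)
    qed
  qed
  also have "\<dots> = 4 / (real p)\<^sup>2 * (\<integral>z. (centred M p z)\<^sup>2 \<partial>Col p) + n * (\<integral>z. indicator (small p) z \<partial>Col p)"
    using centred_sq_int small_int by simp
  also have "\<dots> \<le> 4 / (real p)\<^sup>2 * (4 * (\<kappa> + 1) * n) + n * tail_prob p"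
    using centred_second_moment[OF p, of M] small_integral[of p] n0 unfolding n_def[symmetric]
    by (intro add_mono mult_left_mono) auto
  also have "\<dots> = op_const p * n"
  proof -
    have "4 / (real p)\<^sup>2 * (4 * (\<kappa> + 1) * n) = 16 * (\<kappa> + 1) / (real p)\<^sup>2 * n" by simp
    then show ?thesis unfolding op_const_def distrib_right[of _ _ n] by (simp only: mult.commute[of n])
  qed
  finally show ?thesis unfolding n_def .
qed

lemma feature_kernel_Col:
  assumes p: "0 < p"
  shows "feature_kernel (Col p) (idx p) (feat p) (real p) (op_const p)"
proof -
  interpret C: prob_space "Col p" by (rule prob_space_Col)
  show ?thesis
  proof
    show "0 < op_const p" unfolding op_const_def tail_prob_def using \<kappa>_ge_1 by (intro add_nonneg_pos) auto
  qed (use feat_meas feat_norm[OF p] feat_op_bound[OF p] finite_idx in auto)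
qed

text \<open>
  The quadratic form divided by \<open>p\<close> instead of by \<open>sqn p z\<close> has mean zero; only the difference contributes.
\<close>

lemma feat_lin_mean:
  assumes p: "0 < p"
  shows "\<bar>\<integral>z. (\<Sum>a\<in>idx p. feat p a z * M a) \<partial>Col p\<bar> \<le> mean_const p * sqrt (\<Sum>a\<in>idx p. (M a)\<^sup>2)"
proof -
  interpret C: prob_space "Col p" by (rule prob_space_Col)
  define n where "n = sqrt (\<Sum>a\<in>idx p. (M a)\<^sup>2)"
  have n2: "(\<Sum>a\<in>idx p. (M a)\<^sup>2) = n\<^sup>2" unfolding n_def by (simp add: sum_nonneg)
  define f where "f z = (\<Sum>a\<in>idx p. feat p a z * M a)" for z
  have f2: "(f z)\<^sup>2 \<le> n\<^sup>2" for z unfolding f_def n2[symmetric] by (rule feat_lin_bounded[OF p])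
  have n0: "0 \<le> n" unfolding n_def by (simp add: sum_nonneg)
  have f_bd: "\<bar>f z\<bar> \<le> n" for z using f2[of z] n0 by (simp add: abs_le_square_iff[symmetric])
  show ?thesis
  \<comment> \<open>Below, \<open>n\<close> serves as a weight in denominators.\<close>
  proof (cases "n = 0")
    case True
    then have "f z = 0" for z using f_bd[of z] by simp
    then show ?thesis using True unfolding f_def[symmetric] n_def[symmetric] by simp
  next
    case False
    then have np: "0 < n" using n0 by simp
    \<comment> \<open>The weight \<open>r / n\<close> balances the product \<open>V * Y\<close>: the
      means of \<open>V\<^sup>2\<close> and \<open>Y\<^sup>2\<close> are of orders at most
      \<open>n\<^sup>2\<close> and \<open>p = r\<^sup>2\<close>, so both halves become of order
      \<open>r * n\<close>.\<close>
    define r where "r = sqrt (real p)"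
    have r: "0 < r" "real p = r * r" using p by (auto simp: r_def)
    define C where "C = \<kappa> + 1"
    define V where "V = centred M p"
    define Y where "Y z = sqn p z - real p" for z
    have V: "integrable (Col p) (\<lambda>z. (V z)\<^sup>2)" "integrable (Col p) V" "(\<integral>z. V z \<partial>Col p) = 0"
      "(\<integral>z. (V z)\<^sup>2 \<partial>Col p) \<le> 4 * C * n\<^sup>2"
      unfolding V_def C_def n2[symmetric] using centred_sq_int centred_mean centred_second_moment[OF p]
        C.square_integrable_imp_integrable[OF centred_meas centred_sq_int] by auto
    have Y: "integrable (Col p) (\<lambda>z. (Y z)\<^sup>2)" "(\<integral>z. (Y z)\<^sup>2 \<partial>Col p) \<le> C * real p"
      unfolding Y_def C_def using sqn_deviation sqn_deviation_int by auto
    have fi: "integrable (Col p) f"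
      unfolding f_def using feat_lin_meas f_bd unfolding f_def by (intro C.integrable_const_bound[where B = n]) auto
    define bd where "bd z = 1 / (real p)\<^sup>2 * (r / n * (V z)\<^sup>2 + n / r * (Y z)\<^sup>2)
        + 1 / (n * (real p)\<^sup>2) * (V z)\<^sup>2 + 2 * n * indicator (small p) z" for z
    have bdi: "integrable (Col p) bd"
      unfolding bd_def using V(1) Y(1) small_int
      by (intro Bochner_Integration.integrable_add integrable_mult_right) auto
    have pt: "\<bar>f z - V z / real p\<bar> \<le> bd z" if z: "z \<in> space (Col p)" for z
    proof (cases "z \<in> small p")
      case True
      \<comment> \<open>On short columns \<open>f\<close> is bounded but \<open>V\<close> is not.
        Splitting \<open>|V| / p\<close> leaves a multiple of \<open>V\<^sup>2\<close>, which may be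
        integrated over the whole space, and a constant that the indicator pays for.\<close>
      have "\<bar>f z - V z / real p\<bar> \<le> n + \<bar>V z\<bar> / real p"
        using f_bd[of z] abs_triangle_ineq4[of "f z" "V z / real p"] by simp
      also have "\<bar>V z\<bar> / real p \<le> 1 / (n * (real p)\<^sup>2) * (V z)\<^sup>2 + n"
      proof -
        have "2 * \<bar>V z / real p * 1\<bar> \<le> 1 / n * (V z / real p)\<^sup>2 + 1\<^sup>2 / (1 / n)" by (rule two_abs_mult_le) (use np in simp)
        moreover have "\<bar>V z / real p * 1\<bar> = \<bar>V z\<bar> / real p" using p by simp
        moreover have "1 / n * (V z / real p)\<^sup>2 = 1 / (n * (real p)\<^sup>2) * (V z)\<^sup>2" by (simp add: power_divide)
        moreover have "1\<^sup>2 / (1 / n) = n" by simp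
        moreover have "0 \<le> \<bar>V z\<bar> / real p" by simp
        ultimately show ?thesis by linarith
      qed
      finally have "\<bar>f z - V z / real p\<bar> \<le> 2 * n + 1 / (n * (real p)\<^sup>2) * (V z)\<^sup>2" by simp
      moreover have "0 \<le> 1 / (real p)\<^sup>2 * (r / n * (V z)\<^sup>2 + n / r * (Y z)\<^sup>2)" using np r(1) by simp
      ultimately show ?thesis unfolding bd_def using True by simp
    next
      case False
      then have q: "real p / 2 \<le> sqn p z" using z by (auto simp: small_def)
      then have q0: "0 < sqn p z" using p by linarith
      have "f z - V z / real p = - (V z * Y z) / (sqn p z * real p)"
        unfolding f_def V_def Y_def feat_lin_centred[OF less_imp_neq[OF q0, symmetric] p]
        using q0 p by (simp add: field_simps)
      then have "\<bar>f z - V z / real p\<bar> = \<bar>V z * Y z\<bar> / (sqn p z * real p)"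
        using q0 p by (simp add: abs_mult)
      also have "\<dots> \<le> \<bar>V z * Y z\<bar> / (real p / 2 * real p)"
        using q q0 p by (intro divide_left_mono mult_right_mono) auto
      also have "\<dots> = 1 / (real p)\<^sup>2 * (2 * \<bar>V z * Y z\<bar>)" by (simp add: power2_eq_square)
      finally have "\<bar>f z - V z / real p\<bar> \<le> 1 / (real p)\<^sup>2 * (2 * \<bar>V z * Y z\<bar>)" .
      also have "\<dots> \<le> 1 / (real p)\<^sup>2 * (r / n * (V z)\<^sup>2 + n / r * (Y z)\<^sup>2)"
        using two_abs_mult_le[of "r / n" "V z" "Y z"] r np by (intro mult_left_mono) (auto simp: mult.commute)
      finally have "\<bar>f z - V z / real p\<bar> \<le> 1 / (real p)\<^sup>2 * (r / n * (V z)\<^sup>2 + n / r * (Y z)\<^sup>2)" .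
      moreover have "0 \<le> 1 / (n * (real p)\<^sup>2) * (V z)\<^sup>2" using np by simp
      ultimately show ?thesis unfolding bd_def using False by simp
    qed
    have "(\<integral>z. f z \<partial>Col p) = (\<integral>z. f z - V z / real p \<partial>Col p)"
      using fi V by simp
    also have "\<bar>\<dots>\<bar> \<le> (\<integral>z. \<bar>f z - V z / real p\<bar> \<partial>Col p)" by (rule integral_abs_bound)
    also have "\<dots> \<le> (\<integral>z. bd z \<partial>Col p)"
      using fi V bdi pt by (intro integral_mono) auto
    also have "\<dots> = 1 / (real p)\<^sup>2 * (r / n * (\<integral>z. (V z)\<^sup>2 \<partial>Col p) + n / r * (\<integral>z. (Y z)\<^sup>2 \<partial>Col p))
        + 1 / (n * (real p)\<^sup>2) * (\<integral>z. (V z)\<^sup>2 \<partial>Col p) + 2 * n * (\<integral>z. indicator (small p) z \<partial>Col p)"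
      unfolding bd_def using V Y small_int by simp
    also have "\<dots> \<le> 1 / (real p)\<^sup>2 * (r / n * (4 * C * n\<^sup>2) + n / r * (C * real p))
        + 1 / (n * (real p)\<^sup>2) * (4 * C * n\<^sup>2) + 2 * n * tail_prob p"
      using V(4) Y(2) small_integral[of p] np r(1) by (intro add_mono mult_left_mono) auto
    also have "\<dots> = (5 * C * r / (real p)\<^sup>2 + 4 * C / (real p)\<^sup>2 + 2 * tail_prob p) * n"
    proof -
      have "r / n * (4 * C * n\<^sup>2) = 4 * C * r * n" "n / r * (C * real p) = C * r * n"
        "1 / (n * (real p)\<^sup>2) * (4 * C * n\<^sup>2) = 4 * C / (real p)\<^sup>2 * n"
        using np r by (auto simp: power2_eq_square)
      then show ?thesis by (simp add: distrib_right add_divide_distrib)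
    qed
    \<comment> \<open>As \<open>1 \<le> r\<close>, the term of order \<open>p^-2\<close> is
      absorbed, which turns 5 into 9.\<close>
    also have "\<dots> \<le> (5 * C * r / (real p)\<^sup>2 + 4 * C * r / (real p)\<^sup>2 + 2 * tail_prob p) * n"
    proof -
      have "1 \<le> r" using p by (simp add: r_def)
      then have "4 * C * 1 \<le> 4 * C * r" using \<kappa>_ge_1 by (intro mult_left_mono) (auto simp: C_def)
      then have "4 * C / (real p)\<^sup>2 \<le> 4 * C * r / (real p)\<^sup>2" by (intro divide_right_mono) auto
      then show ?thesis using np by (intro mult_right_mono) auto
    qed
    also have "\<dots> = mean_const p * n"
    proof -
      have "5 * C * r / (real p)\<^sup>2 + 4 * C * r / (real p)\<^sup>2 = 9 * C * r / (real p)\<^sup>2"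
        by (simp flip: add_divide_distrib)
      then show ?thesis unfolding mean_const_def C_def r_def by simp
    qed
    finally show ?thesis unfolding f_def n_def .
  qed
qed

text \<open>Duality: testing \<open>feat_lin_mean\<close> with the mean itself gives
  \<open>msq \<le> mean_const p * sqrt msq\<close>.\<close>

lemma msq_bound:
  assumes p: "0 < p"
  shows "feature_kernel.msq (Col p) (idx p) (feat p) \<le> (mean_const p)\<^sup>2"
proof -
  interpret K: feature_kernel "Col p" "idx p" "feat p" "real p" "op_const p" by (rule feature_kernel_Col[OF p])
  have "(\<integral>z. (\<Sum>a\<in>idx p. feat p a z * K.\<mu> a) \<partial>Col p) = (\<Sum>a\<in>idx p. \<integral>z. feat p a z * K.\<mu> a \<partial>Col p)"
    using K.A_int by (intro Bochner_Integration.integral_sum) auto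
  also have "\<dots> = K.msq" unfolding K.msq_def K.\<mu>_def using K.A_int by (simp add: power2_eq_square)
  finally have "\<bar>K.msq\<bar> \<le> mean_const p * sqrt K.msq"
    using feat_lin_mean[OF p, of K.\<mu>] unfolding K.msq_def by simp
  then have "sqrt K.msq * sqrt K.msq \<le> mean_const p * sqrt K.msq" using K.msq_nonneg by simp
  then have "sqrt K.msq \<le> mean_const p \<or> K.msq = 0"
    using K.msq_nonneg mult_right_le_imp_le[of "sqrt K.msq" "sqrt K.msq" "mean_const p"] by fastforce
  then show ?thesis
  proof
    assume "sqrt K.msq \<le> mean_const p"
    then show ?thesis using power_mono[of "sqrt K.msq" "mean_const p" 2] K.msq_nonneg by simp
  qed simp
qed

subsection \<open>Inner products of two columns\<close>

abbreviation Col2 :: "nat \<Rightarrow> ((nat \<Rightarrow> real) \<times> (nat \<Rightarrow> real)) measure" where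
  "Col2 p \<equiv> Col p \<Otimes>\<^sub>M Col p"

text \<open>
  Two independent columns of infinite length, so that the inner products for all \<open>p\<close> are partial sums of
  one fixed sequence.
\<close>

definition \<Omega> :: "(bool \<times> nat \<Rightarrow> real) measure" where "\<Omega> = PiM UNIV (\<lambda>_. D)"

definition block :: "nat \<Rightarrow> bool \<Rightarrow> (bool \<times> nat \<Rightarrow> real) \<Rightarrow> nat \<Rightarrow> real" where
  "block p b \<omega> = (\<lambda>k\<in>{..<p}. \<omega> (b, k))"

definition \<xi> :: "nat \<Rightarrow> (bool \<times> nat \<Rightarrow> real) \<Rightarrow> real" where "\<xi> k \<omega> = \<omega> (True, k) * \<omega> (False, k)"

lemma prob_space_\<Omega>: "prob_space \<Omega>"
  unfolding \<Omega>_def by (rule prob_space_PiM) unfold_locales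

lemma coordinates_indep: "prob_space.indep_vars \<Omega> (\<lambda>_. D) (\<lambda>i \<omega>. \<omega> i) UNIV"
  unfolding \<Omega>_def by (rule indep_vars_PiM_coordinates) unfold_locales

lemma component_borel_measurable:
  assumes "i \<in> I" shows "(\<lambda>w. w i) \<in> borel_measurable (PiM I (\<lambda>_. D))"
proof -
  have "measurable (PiM I (\<lambda>_. D)) D = borel_measurable (PiM I (\<lambda>_. D))"
    by (rule measurable_cong_sets) auto
  then show ?thesis using measurable_component_singleton[OF assms, of "\<lambda>_. D"] by blast
qed

lemma coord_\<Omega>_meas [measurable]: "(\<lambda>\<omega>. \<omega> i) \<in> borel_measurable \<Omega>"
  unfolding \<Omega>_def by (rule component_borel_measurable) simp

lemma distr_coord: "distr \<Omega> D (\<lambda>\<omega>. \<omega> i) = D"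
  unfolding \<Omega>_def by (rule distr_PiM_component) (auto intro: prob_space_axioms)

lemma distr_block: "distr \<Omega> (Col p) (block p b) = Col p"
  unfolding \<Omega>_def block_def
  by (rule distr_PiM_reindex) (auto simp: inj_on_def intro: prob_space_axioms)

lemma distr_blocks: "distr \<Omega> (Col2 p) (\<lambda>\<omega>. (block p True \<omega>, block p False \<omega>)) = Col2 p"
  and blocks_meas: "(\<lambda>\<omega>. (block p True \<omega>, block p False \<omega>)) \<in> measurable \<Omega> (Col2 p)"
proof -
  interpret O: prob_space \<Omega> by (rule prob_space_\<Omega>)
  let ?I = "\<lambda>b::bool. {b} \<times> {..<p}"
  have ind: "O.indep_var (PiM (?I True) (\<lambda>_. D)) (\<lambda>\<omega>. restrict (\<lambda>i. \<omega> i) (?I True))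
      (PiM (?I False) (\<lambda>_. D)) (\<lambda>\<omega>. restrict (\<lambda>i. \<omega> i) (?I False))"
    by (rule O.indep_var_restrict[OF coordinates_indep]) auto
  have re: "(\<lambda>w. \<lambda>k\<in>{..<p}. w (b, k)) \<in> measurable (PiM (?I b) (\<lambda>_. D)) (Col p)" for b
    by (rule measurable_restrict) (auto intro!: measurable_component_singleton)
  have blk: "(\<lambda>w. \<lambda>k\<in>{..<p}. w (b, k)) \<circ> (\<lambda>\<omega>. restrict (\<lambda>i. \<omega> i) (?I b)) = block p b" for b
    unfolding block_def by (auto simp: fun_eq_iff restrict_def)
  have "O.indep_var (Col p) (block p True) (Col p) (block p False)"
    using O.indep_var_compose[OF ind re re] unfolding blk .
  then show "distr \<Omega> (Col2 p) (\<lambda>\<omega>. (block p True \<omega>, block p False \<omega>)) = Col2 p"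
    "(\<lambda>\<omega>. (block p True \<omega>, block p False \<omega>)) \<in> measurable \<Omega> (Col2 p)"
    unfolding O.indep_var_distribution_eq distr_block by auto
qed

lemma \<xi>_indep: "prob_space.indep_vars \<Omega> (\<lambda>_. borel) \<xi> UNIV"
proof -
  interpret O: prob_space \<Omega> by (rule prob_space_\<Omega>)
  let ?K = "\<lambda>k::nat. {(True, k), (False, k)}"
  have "O.indep_vars (\<lambda>k. PiM (?K k) (\<lambda>_. D)) (\<lambda>k \<omega>. restrict (\<lambda>i. \<omega> i) (?K k)) UNIV"
    by (rule O.indep_vars_restrict[OF coordinates_indep]) (auto simp: disjoint_family_on_def)
  then have "O.indep_vars (\<lambda>_. borel) (\<lambda>k \<omega>. (\<lambda>w. w (True, k) * w (False, k)) (restrict (\<lambda>i. \<omega> i) (?K k))) UNIV"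
  proof (rule O.indep_vars_compose2)
    fix k
    have "(\<lambda>w. w i) \<in> borel_measurable (PiM (?K k) (\<lambda>_. D))" if "i \<in> ?K k" for i
      using that by (rule component_borel_measurable)
    then show "(\<lambda>w. w (True, k) * w (False, k)) \<in> borel_measurable (PiM (?K k) (\<lambda>_. D))"
      by (intro borel_measurable_times) auto
  qed
  then show ?thesis unfolding \<xi>_def[abs_def] by simp
qed

lemma pair_indep: "prob_space.indep_var \<Omega> borel (\<lambda>\<omega>. \<omega> (True, k)) borel (\<lambda>\<omega>. \<omega> (False, k))"
proof -
  interpret O: prob_space \<Omega> by (rule prob_space_\<Omega>)
  have ind: "O.indep_var (PiM {(True, k)} (\<lambda>_. D)) (\<lambda>\<omega>. restrict (\<lambda>i. \<omega> i) {(True, k)})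
      (PiM {(False, k)} (\<lambda>_. D)) (\<lambda>\<omega>. restrict (\<lambda>i. \<omega> i) {(False, k)})"
    by (rule O.indep_var_restrict[OF coordinates_indep]) auto
  have m: "(\<lambda>w. w i) \<in> borel_measurable (PiM {i} (\<lambda>_. D))" for i :: "bool \<times> nat"
    by (rule component_borel_measurable) simp
  show ?thesis using O.indep_var_compose[OF ind m m] by (simp add: o_def)
qed

lemma coord_\<Omega>_power:
  assumes "m \<le> 4"
  shows "integrable \<Omega> (\<lambda>\<omega>. \<omega> i ^ m)" "(\<integral>\<omega>. \<omega> i ^ m \<partial>\<Omega>) = (\<integral>x. x ^ m \<partial>D)"
proof -
  have "(\<lambda>\<omega>. \<omega> i) \<in> measurable \<Omega> D" by simp
  then show "integrable \<Omega> (\<lambda>\<omega>. \<omega> i ^ m)" "(\<integral>\<omega>. \<omega> i ^ m \<partial>\<Omega>) = (\<integral>x. x ^ m \<partial>D)"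
    using power_int[OF assms] integrable_distr[of "\<lambda>\<omega>. \<omega> i" \<Omega> D "\<lambda>x. x ^ m"]
      integral_distr[of "\<lambda>\<omega>. \<omega> i" \<Omega> D "\<lambda>x. x ^ m"] by (simp_all add: distr_coord)
qed

lemma \<xi>_power:
  assumes "m \<le> 4"
  shows "integrable \<Omega> (\<lambda>\<omega>. \<xi> k \<omega> ^ m)" "(\<integral>\<omega>. \<xi> k \<omega> ^ m \<partial>\<Omega>) = (\<integral>x. x ^ m \<partial>D)\<^sup>2"
proof -
  interpret O: prob_space \<Omega> by (rule prob_space_\<Omega>)
  have ind: "O.indep_var borel ((\<lambda>x. x ^ m) \<circ> (\<lambda>\<omega>. \<omega> (True, k))) borel ((\<lambda>x. x ^ m) \<circ> (\<lambda>\<omega>. \<omega> (False, k)))"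
    by (rule O.indep_var_compose[OF pair_indep]) auto
  show "integrable \<Omega> (\<lambda>\<omega>. \<xi> k \<omega> ^ m)"
    using O.indep_var_integrable[OF ind] coord_\<Omega>_power[OF assms] by (simp add: \<xi>_def power_mult_distrib o_def)
  show "(\<integral>\<omega>. \<xi> k \<omega> ^ m \<partial>\<Omega>) = (\<integral>x. x ^ m \<partial>D)\<^sup>2"
    using O.indep_var_lebesgue_integral[OF ind] coord_\<Omega>_power[OF assms]
    by (simp add: \<xi>_def power_mult_distrib o_def power2_eq_square)
qed

lemma \<xi>_meas [measurable]: "\<xi> k \<in> borel_measurable \<Omega>" unfolding \<xi>_def by measurable

text \<open>The central limit theorem asks for a common law of the summands that does not mention
  \<open>k\<close>.\<close>

lemma \<xi>_distr: "distr \<Omega> borel (\<xi> k) = distr (D \<Otimes>\<^sub>M D) borel (\<lambda>(x, y). x * y)"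
proof -
  interpret O: prob_space \<Omega> by (rule prob_space_\<Omega>)
  have "distr \<Omega> borel (\<lambda>\<omega>. \<omega> i) = D" for i
    using distr_coord[of i] by (metis M_is_borel distr_cong sets_borel)
  then have pair: "distr \<Omega> (borel \<Otimes>\<^sub>M borel) (\<lambda>\<omega>. (\<omega> (True, k), \<omega> (False, k))) = D \<Otimes>\<^sub>M D"
    using pair_indep[of k] unfolding O.indep_var_distribution_eq by simp
  show ?thesis
    unfolding pair[symmetric] by (subst distr_distr) (auto simp: \<xi>_def[abs_def] o_def)
qed

section \<open>Gaussian limit of the inner products\<close>

definition S :: "nat \<Rightarrow> (bool \<times> nat \<Rightarrow> real) \<Rightarrow> real" where "S p \<omega> = (\<Sum>k<p. \<xi> k \<omega>)"

lemma S_meas [measurable]: "S p \<in> borel_measurable \<Omega>" unfolding S_def by measurable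

lemma S_moments: "integrable \<Omega> (\<lambda>\<omega>. S p \<omega> ^ 4)" "(\<integral>\<omega>. (S p \<omega>)\<^sup>2 \<partial>\<Omega>) = real p"
  "(\<integral>\<omega>. S p \<omega> ^ 4 \<partial>\<Omega>) = real p * \<kappa>\<^sup>2 + 3 * real p * (real p - 1)"
proof -
  interpret O: prob_space \<Omega> by (rule prob_space_\<Omega>)
  have ind: "O.indep_vars (\<lambda>_. borel) \<xi> {..<p}" by (rule O.indep_vars_subset[OF \<xi>_indep]) auto
  have "(\<integral>\<omega>. \<xi> k \<omega> \<partial>\<Omega>) = 0" "(\<integral>\<omega>. (\<xi> k \<omega>)\<^sup>2 \<partial>\<Omega>) = 1" "(\<integral>\<omega>. \<xi> k \<omega> ^ 4 \<partial>\<Omega>) = \<kappa>\<^sup>2"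
    "integrable \<Omega> (\<lambda>\<omega>. \<xi> k \<omega> ^ 4)" for k
    using \<xi>_power[of 1 k] \<xi>_power[of 2 k] \<xi>_power[of 4 k] mean second_moment by (auto simp: \<kappa>_def)
  from O.moments_sum_indep[OF _ ind this(4,1,2,3)]
  show "integrable \<Omega> (\<lambda>\<omega>. S p \<omega> ^ 4)" "(\<integral>\<omega>. (S p \<omega>)\<^sup>2 \<partial>\<Omega>) = real p"
    "(\<integral>\<omega>. S p \<omega> ^ 4 \<partial>\<Omega>) = real p * \<kappa>\<^sup>2 + 3 * real p * (real p - 1)"
    unfolding S_def by auto
qed

lemma S_clt: "weak_conv_m (\<lambda>p. distr \<Omega> borel (\<lambda>\<omega>. S p \<omega> / sqrt (real p))) std_normal_distribution"
proof -
  interpret O: prob_space \<Omega> by (rule prob_space_\<Omega>)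
  have m: "O.expectation (\<xi> k) = 0" "O.expectation (\<lambda>\<omega>. (\<xi> k \<omega>)\<^sup>2) = 1" "integrable \<Omega> (\<lambda>\<omega>. (\<xi> k \<omega>)\<^sup>2)" for k
    using \<xi>_power[of 1 k] \<xi>_power[of 2 k] mean second_moment by auto
  have "weak_conv_m (\<lambda>n. distr \<Omega> borel (\<lambda>x. (\<Sum>i<n. \<xi> i x) / sqrt (real n * 1\<^sup>2))) std_normal_distribution"
    by (rule O.central_limit_theorem_zero_mean[OF \<xi>_indep _ _ _ _ \<xi>_distr]) (use m in auto)
  then show ?thesis unfolding S_def by simp
qed

definition scaled_inner :: "nat \<Rightarrow> (nat \<Rightarrow> real) \<times> (nat \<Rightarrow> real) \<Rightarrow> real" where
  "scaled_inner p z = (\<Sum>k<p. fst z k * snd z k) / sqrt (real p)"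

lemma scaled_inner_meas [measurable]: "scaled_inner p \<in> borel_measurable (Col2 p)"
  unfolding scaled_inner_def
  by (intro borel_measurable_divide borel_measurable_sum borel_measurable_times borel_measurable_const
      measurable_compose[OF measurable_fst coord_meas] measurable_compose[OF measurable_snd coord_meas]) auto

lemma scaled_inner_transfer:
  fixes f :: "real \<Rightarrow> real"
  assumes "f \<in> borel_measurable borel"
  shows "(\<integral>z. f (scaled_inner p z) \<partial>Col2 p) = (\<integral>\<omega>. f (S p \<omega> / sqrt (real p)) \<partial>\<Omega>)"
    and "integrable (Col2 p) (\<lambda>z. f (scaled_inner p z)) \<longleftrightarrow> integrable \<Omega> (\<lambda>\<omega>. f (S p \<omega> / sqrt (real p)))"
proof -
  have eq: "scaled_inner p (block p True \<omega>, block p False \<omega>) = S p \<omega> / sqrt (real p)" for \<omega>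
    unfolding scaled_inner_def S_def \<xi>_def block_def by simp
  show "(\<integral>z. f (scaled_inner p z) \<partial>Col2 p) = (\<integral>\<omega>. f (S p \<omega> / sqrt (real p)) \<partial>\<Omega>)"
    using assms by (subst distr_blocks[symmetric], subst integral_distr[OF blocks_meas]) (auto simp: eq)
  show "integrable (Col2 p) (\<lambda>z. f (scaled_inner p z)) \<longleftrightarrow> integrable \<Omega> (\<lambda>\<omega>. f (S p \<omega> / sqrt (real p)))"
    using assms by (subst distr_blocks[symmetric], subst integrable_distr_eq[OF blocks_meas]) (auto simp: eq)
qed

lemma scaled_inner_moments:
  assumes p: "0 < p"
  shows "integrable (Col2 p) (\<lambda>z. scaled_inner p z ^ 4)"
    "(\<integral>z. (scaled_inner p z)\<^sup>2 \<partial>Col2 p) = 1"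
    "(\<integral>z. scaled_inner p z ^ 4 \<partial>Col2 p) = 3 + (\<kappa>\<^sup>2 - 3) / real p"
proof -
  have s4: "sqrt (real p) ^ 4 = (real p)\<^sup>2" using real_sqrt_pow2[of "real p"] by (simp add: power4_eq_xxxx power2_eq_square)
  show "integrable (Col2 p) (\<lambda>z. scaled_inner p z ^ 4)"
    using scaled_inner_transfer(2)[of "\<lambda>x. x ^ 4" p] S_moments(1)[of p] by (simp add: power_divide s4)
  show "(\<integral>z. (scaled_inner p z)\<^sup>2 \<partial>Col2 p) = 1"
    using scaled_inner_transfer(1)[of "\<lambda>x. x\<^sup>2" p] S_moments(2)[of p] p by (simp add: power_divide)
  show "(\<integral>z. scaled_inner p z ^ 4 \<partial>Col2 p) = 3 + (\<kappa>\<^sup>2 - 3) / real p"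
    using scaled_inner_transfer(1)[of "\<lambda>x. x ^ 4" p] S_moments(3)[of p] p
    by (simp add: power_divide s4) (simp add: field_simps power2_eq_square)
qed

lemma normal_truncated_fourth_moment:
  "(\<lambda>m. \<integral>x. min (x ^ 4) (real m) \<partial>std_normal_distribution) \<longlonglongrightarrow> 3"
proof -
  have i: "integrable std_normal_distribution (\<lambda>x. x ^ 4)" by (rule integrable_std_normal_distribution_moment)
  have "(\<lambda>m. \<integral>x. min (x ^ 4) (real m) \<partial>std_normal_distribution) \<longlonglongrightarrow> (\<integral>x. x ^ 4 \<partial>std_normal_distribution)"
  proof (rule integral_dominated_convergence[where w = "\<lambda>x. x ^ 4"])
    show "AE x in std_normal_distribution. (\<lambda>m. min (x ^ 4) (real m)) \<longlonglongrightarrow> x ^ 4"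
    proof (rule AE_I2)
      fix x :: real
      obtain N where "x ^ 4 \<le> real N" using real_arch_simple by blast
      then have "min (x ^ 4) (real m) = x ^ 4" if "m \<ge> N" for m
        using that by (simp add: min_def)
      then show "(\<lambda>m. min (x ^ 4) (real m)) \<longlonglongrightarrow> x ^ 4"
        by (intro tendsto_eventually) (auto simp: eventually_sequentially)
    qed
  qed (use i in auto)
  moreover have "(\<integral>x. x ^ 4 \<partial>std_normal_distribution) = (3 :: real)"
    using std_normal_distribution_even_moments(1)[of 2] by (simp add: fact_numeral)
  ultimately show ?thesis by simp
qed

text \<open>
  The truncated fourth moments converge by the central limit theorem and the full ones by explicit
  computation, so the tails converge to the Gaussian tail.
\<close>

lemma scaled_inner_uniformly_integrable:
  assumes e: "0 < e"
  obtains K where "1 \<le> K"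
    "\<forall>\<^sub>F p in sequentially. (\<integral>z. above K (scaled_inner p z ^ 4) \<partial>Col2 p) \<le> e"
proof -
  \<comment> \<open>The truncated and the full moment each deviate from 3 by at most
    \<open>e / 8\<close> in the harmful direction; \<open>tail_excess_le\<close> doubles the sum,
    which stays below \<open>e\<close>.\<close>
  have "\<forall>\<^sub>F m in sequentially. 3 - e / 8 < (\<integral>x. min (x ^ 4) (real m) \<partial>std_normal_distribution)"
    using e by (intro order_tendstoD(1)[OF normal_truncated_fourth_moment]) auto
  moreover have "\<forall>\<^sub>F m in sequentially. 1 \<le> m" by (rule eventually_ge_at_top)
  ultimately obtain m where m: "3 - e / 8 < (\<integral>x. min (x ^ 4) (real m) \<partial>std_normal_distribution)" "1 \<le> m"
    using eventually_happens[OF eventually_conj] by fastforce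
  interpret O: prob_space \<Omega> by (rule prob_space_\<Omega>)
  let ?f = "\<lambda>x::real. min (x ^ 4) (real m)"
  have "(\<lambda>p. \<integral>x. ?f x \<partial>distr \<Omega> borel (\<lambda>\<omega>. S p \<omega> / sqrt (real p))) \<longlonglongrightarrow> (\<integral>x. ?f x \<partial>std_normal_distribution)"
  proof (rule weak_conv_imp_integral_bdd_continuous_conv[OF _ real_dist_normal_dist S_clt])
    show "real_distribution (distr \<Omega> borel (\<lambda>\<omega>. S p \<omega> / sqrt (real p)))" for p
      by (rule O.real_distribution_distr) measurable
    show "isCont ?f x" for x by (intro continuous_intros)
    show "norm (?f x) \<le> real m" for x by (auto simp: min_def)
  qed
  moreover have "(\<integral>z. ?f (scaled_inner p z) \<partial>Col2 p) = (\<integral>x. ?f x \<partial>distr \<Omega> borel (\<lambda>\<omega>. S p \<omega> / sqrt (real p)))" for p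
    using scaled_inner_transfer(1)[of ?f p] by (simp add: integral_distr)
  ultimately have "(\<lambda>p. \<integral>z. ?f (scaled_inner p z) \<partial>Col2 p) \<longlonglongrightarrow> (\<integral>x. ?f x \<partial>std_normal_distribution)"
    by simp
  then have ev1: "\<forall>\<^sub>F p in sequentially. 3 - e / 8 < (\<integral>z. ?f (scaled_inner p z) \<partial>Col2 p)"
    using m(1) by (rule order_tendstoD)
  have "(\<lambda>p. 3 + (\<kappa>\<^sup>2 - 3) / real p) \<longlonglongrightarrow> 3 + 0" by (intro tendsto_intros lim_const_over_n)
  then have ev2: "\<forall>\<^sub>F p in sequentially. 3 + (\<kappa>\<^sup>2 - 3) / real p < 3 + e / 8"
    using e by (intro order_tendstoD(2)) auto
  have "\<forall>\<^sub>F p in sequentially. (\<integral>z. above (2 * real m) (scaled_inner p z ^ 4) \<partial>Col2 p) \<le> e"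
    using ev1 ev2 eventually_gt_at_top[of 0]
  proof eventually_elim
    case (elim p)
    interpret C: prob_space "Col p" by (rule prob_space_Col)
    interpret Q: pair_prob_space "Col p" "Col p" by unfold_locales
    note mom = scaled_inner_moments[OF elim(3)]
    have if1: "integrable (Col2 p) (\<lambda>z. ?f (scaled_inner p z))"
      by (rule Bochner_Integration.integrable_bound[OF mom(1)]) auto
    have "(\<integral>z. above (2 * real m) (scaled_inner p z ^ 4) \<partial>Col2 p)
        \<le> (\<integral>z. 2 * (scaled_inner p z ^ 4 - ?f (scaled_inner p z)) \<partial>Col2 p)"
    proof (rule integral_mono)
      show "integrable (Col2 p) (\<lambda>z. above (2 * real m) (scaled_inner p z ^ 4))"
        by (rule Bochner_Integration.integrable_bound[OF mom(1)]) auto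
      show "integrable (Col2 p) (\<lambda>z. 2 * (scaled_inner p z ^ 4 - ?f (scaled_inner p z)))" using mom(1) if1 by auto
      show "above (2 * real m) (scaled_inner p z ^ 4) \<le> 2 * (scaled_inner p z ^ 4 - ?f (scaled_inner p z))" for z
        by (rule tail_excess_le) auto
    qed
    also have "\<dots> = 2 * ((3 + (\<kappa>\<^sup>2 - 3) / real p) - (\<integral>z. ?f (scaled_inner p z) \<partial>Col2 p))"
      using mom(1,3) if1 by simp
    finally have le: "(\<integral>z. above (2 * real m) (scaled_inner p z ^ 4) \<partial>Col2 p) \<le> \<dots>" .
    have "u \<le> e" if "u \<le> 2 * (a - b)" "3 - e / 8 < b" "a < 3 + e / 8" for u a b :: real
      using that e by argo
    from this[OF le elim(1,2)] show ?case .
  qed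
  moreover have "1 \<le> 2 * real m" using m(2) by simp
  ultimately show ?thesis by (rule that[rotated])
qed

text \<open>The uncentred kernel \<open>F\<close> of the features with scale \<open>p\<close>, as a
  function on pairs and free of the locale of features.\<close>

definition pair_kernel :: "nat \<Rightarrow> (nat \<Rightarrow> real) \<times> (nat \<Rightarrow> real) \<Rightarrow> real" where
  "pair_kernel p z = real p * (\<Sum>a\<in>idx p. feat p a (fst z) * feat p a (snd z))"

abbreviation kernel_tail :: "real \<Rightarrow> nat \<Rightarrow> real" where
  "kernel_tail K p \<equiv> \<integral>z. (if K < \<bar>pair_kernel p z\<bar> then (pair_kernel p z)\<^sup>2 else 0) \<partial>Col2 p"

text \<open>A sum instead of the indicator of the union, so that its integral splits into the two
  marginals.\<close>

definition small_count :: "nat \<Rightarrow> (nat \<Rightarrow> real) \<times> (nat \<Rightarrow> real) \<Rightarrow> real" where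
  "small_count p z = indicator (small p) (fst z) + indicator (small p) (snd z)"

lemma pair_kernel_bounded: "0 < p \<Longrightarrow> (pair_kernel p z)\<^sup>2 \<le> (real p)\<^sup>2"
proof -
  assume p: "0 < p"
  have "(\<Sum>a\<in>idx p. feat p a (fst z) * feat p a (snd z))\<^sup>2 \<le> 1"
    using feat_lin_bounded[OF p, of "fst z" "\<lambda>a. feat p a (snd z)"] feat_norm[OF p, of "snd z"] by linarith
  then show ?thesis unfolding pair_kernel_def power_mult_distrib by (intro mult_left_le) auto
qed

lemma pair_kernel_meas [measurable]: "pair_kernel p \<in> borel_measurable (Col2 p)"
  unfolding pair_kernel_def using feat_meas
  by (intro borel_measurable_times borel_measurable_sum borel_measurable_const
      measurable_compose[OF measurable_fst] measurable_compose[OF measurable_snd]) auto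

lemma pair_kernel_eq:
  assumes "sqn p (fst z) \<noteq> 0" "sqn p (snd z) \<noteq> 0" "0 < p"
  shows "pair_kernel p z = (scaled_inner p z)\<^sup>2 * ((real p)\<^sup>2 / (sqn p (fst z) * sqn p (snd z))) - 1"
proof -
  have "pair_kernel p z = real p * (((\<Sum>k<p. fst z k * snd z k)\<^sup>2 / sqn p (snd z) - sqn p (fst z) / real p) / sqn p (fst z))"
    unfolding pair_kernel_def feat_inner[OF assms(2)] ..
  moreover have "(scaled_inner p z)\<^sup>2 = (\<Sum>k<p. fst z k * snd z k)\<^sup>2 / real p" unfolding scaled_inner_def by (simp add: power_divide)
  moreover have "P * ((w / u - v / P) / v) = w / P * (P\<^sup>2 / (v * u)) - 1" if "u \<noteq> 0" "v \<noteq> 0" "P \<noteq> 0" for P u v w :: real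
    using that by (simp add: field_simps power2_eq_square)
  ultimately show ?thesis using assms by simp
qed

lemma marginal_integral:
  fixes h :: "(nat \<Rightarrow> real) \<Rightarrow> real"
  assumes "integrable (Col p) h"
  shows "integrable (Col2 p) (\<lambda>z. h (fst z))" "integrable (Col2 p) (\<lambda>z. h (snd z))"
    "(\<integral>z. h (fst z) \<partial>Col2 p) = (\<integral>x. h x \<partial>Col p)"
    "(\<integral>z. h (snd z) \<partial>Col2 p) = (\<integral>x. h x \<partial>Col p)"
proof -
  interpret C: prob_space "Col p" by (rule prob_space_Col)
  interpret Q: pair_prob_space "Col p" "Col p" by unfold_locales
  have f: "distr (Col2 p) (Col p) fst = Col p" by (rule C.distr_pair_fst)
  have s: "distr (Col2 p) (Col p) snd = Col p"
  proof -
    have "distr (Col2 p) (Col p) snd = distr (distr (Col2 p) (Col2 p) (\<lambda>(x, y). (y, x))) (Col p) snd"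
      by (subst Q.distr_pair_swap) simp
    also have "\<dots> = distr (Col2 p) (Col p) fst"
      by (subst distr_distr) (auto simp: o_def split_beta intro!: distr_cong)
    finally show ?thesis using f by simp
  qed
  show "integrable (Col2 p) (\<lambda>z. h (fst z))"
    using assms f integrable_distr[of fst "Col2 p" "Col p" h] by simp
  show "integrable (Col2 p) (\<lambda>z. h (snd z))"
    using assms s integrable_distr[of snd "Col2 p" "Col p" h] by simp
  show "(\<integral>z. h (fst z) \<partial>Col2 p) = (\<integral>x. h x \<partial>Col p)"
    using assms integral_distr[of fst "Col2 p" "Col p" h] f by auto
  show "(\<integral>z. h (snd z) \<partial>Col2 p) = (\<integral>x. h x \<partial>Col p)"
    using assms integral_distr[of snd "Col2 p" "Col p" h] s by auto
qed

lemma small_count_integral: "integrable (Col2 p) (small_count p)" "(\<integral>z. small_count p z \<partial>Col2 p) \<le> 2 * tail_prob p"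
  unfolding small_count_def using marginal_integral[OF small_int, of p] small_integral[of p] by auto

text \<open>
  Bounds the error of replacing \<open>|x|\<^sup>2 |y|\<^sup>2\<close> by \<open>p\<^sup>2\<close> by terms that involve a single column each.
\<close>

definition Dev :: "nat \<Rightarrow> (nat \<Rightarrow> real) \<times> (nat \<Rightarrow> real) \<Rightarrow> real" where
  "Dev p z = real p * \<bar>sqn p (fst z) - real p\<bar> + real p * \<bar>sqn p (snd z) - real p\<bar>
     + ((sqn p (fst z) - real p)\<^sup>2 + (sqn p (snd z) - real p)\<^sup>2) / 2"

lemma Dev_ge: "\<bar>(real p)\<^sup>2 - sqn p (fst z) * sqn p (snd z)\<bar> \<le> Dev p z"
proof -
  define a where "a = sqn p (fst z) - real p"
  define b where "b = sqn p (snd z) - real p"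
  have "(real p)\<^sup>2 - sqn p (fst z) * sqn p (snd z) = - (real p * a + real p * b + a * b)"
    unfolding a_def b_def by (simp add: power2_eq_square algebra_simps)
  then have "\<bar>(real p)\<^sup>2 - sqn p (fst z) * sqn p (snd z)\<bar> = \<bar>real p * a + real p * b + a * b\<bar>"
    by (simp only: abs_minus_cancel)
  also have "\<dots> \<le> real p * \<bar>a\<bar> + real p * \<bar>b\<bar> + \<bar>a\<bar> * \<bar>b\<bar>"
    using abs_triangle_ineq[of "real p * a + real p * b" "a * b"] abs_triangle_ineq[of "real p * a" "real p * b"]
    by (simp add: abs_mult)
  also have "\<bar>a\<bar> * \<bar>b\<bar> \<le> (a\<^sup>2 + b\<^sup>2) / 2"
    using zero_le_power2[of "\<bar>a\<bar> - \<bar>b\<bar>"] by (simp add: power2_diff)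
  finally show ?thesis unfolding Dev_def a_def b_def by simp
qed

lemma Dev_integral: "integrable (Col2 p) (Dev p)"
  "(\<integral>z. Dev p z \<partial>Col2 p) \<le> 2 * real p * sqrt ((\<kappa> + 1) * real p) + (\<kappa> + 1) * real p"
proof -
  interpret C: prob_space "Col p" by (rule prob_space_Col)
  let ?Y = "\<lambda>x. sqn p x - real p"
  have i2: "integrable (Col p) (\<lambda>x. (?Y x)\<^sup>2)" by (rule sqn_deviation_int)
  have i1: "integrable (Col p) (\<lambda>x. \<bar>?Y x\<bar>)"
    using C.square_integrable_imp_integrable[OF _ i2] by simp
  note m1 = marginal_integral[OF i1] and m2 = marginal_integral[OF i2]
  show "integrable (Col2 p) (Dev p)" unfolding Dev_def using m1(1,2) m2(1,2) by auto
  have "(\<integral>z. Dev p z \<partial>Col2 p) = 2 * real p * (\<integral>x. \<bar>?Y x\<bar> \<partial>Col p) + (\<integral>x. (?Y x)\<^sup>2 \<partial>Col p)"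
    unfolding Dev_def using m1 m2 by simp
  also have "\<dots> \<le> 2 * real p * sqrt ((\<kappa> + 1) * real p) + (\<kappa> + 1) * real p"
  proof (intro add_mono mult_left_mono sqn_deviation)
    have "(\<integral>x. \<bar>?Y x\<bar> \<partial>Col p) \<le> sqrt (\<integral>x. (?Y x)\<^sup>2 \<partial>Col p)"
      using i2 by (intro C.expectation_abs_le_sqrt) auto
    also have "\<dots> \<le> sqrt ((\<kappa> + 1) * real p)" using sqn_deviation by (intro real_sqrt_le_mono)
    finally show "(\<integral>x. \<bar>?Y x\<bar> \<partial>Col p) \<le> \<dots>" .
  qed auto
  finally show "(\<integral>z. Dev p z \<partial>Col2 p) \<le> \<dots>" .
qed

text \<open>Here \<open>r\<close> is \<open>p^2\<close> over the product of the squared norms, each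
  of which is at least \<open>p / 2\<close>. Its two bounds serve different regions:
  \<open>r \<le> 4\<close> where the inner product is large, closeness to 1 where it is
  bounded.\<close>

lemma good_pointwise:
  assumes p: "0 < p" and z: "z \<in> space (Col2 p)" and g: "fst z \<notin> small p" "snd z \<notin> small p"
  obtains r where "pair_kernel p z = (scaled_inner p z)\<^sup>2 * r - 1" "0 < r" "r \<le> 4" "\<bar>r - 1\<bar> \<le> 4 * Dev p z / (real p)\<^sup>2"
proof -
  define q where "q = sqn p (fst z) * sqn p (snd z)"
  have h: "real p / 2 \<le> sqn p (fst z)" "real p / 2 \<le> sqn p (snd z)"
    using z g by (auto simp: small_def space_pair_measure)
  then have pos: "0 < sqn p (fst z)" "0 < sqn p (snd z)" using p by linarith+
  have "real p / 2 * (real p / 2) \<le> q" unfolding q_def using h pos by (intro mult_mono) auto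
  then have q: "(real p)\<^sup>2 / 4 \<le> q" "0 < q" using pos unfolding q_def by (auto simp: power2_eq_square)
  show ?thesis
  proof (rule that[of "(real p)\<^sup>2 / q"])
    show "pair_kernel p z = (scaled_inner p z)\<^sup>2 * ((real p)\<^sup>2 / q) - 1" unfolding q_def using pos p by (intro pair_kernel_eq) auto
    show "0 < (real p)\<^sup>2 / q" using q p by simp
    show "(real p)\<^sup>2 / q \<le> 4" using q by (simp add: field_simps)
    have "\<bar>(real p)\<^sup>2 / q - 1\<bar> = \<bar>(real p)\<^sup>2 - q\<bar> / q" using q(2) by (simp add: diff_divide_distrib[symmetric] field_simps abs_divide)
    also have "\<dots> \<le> Dev p z / q" using Dev_ge[of p z] q(2) unfolding q_def by (intro divide_right_mono) auto
    also have "\<dots> \<le> Dev p z / ((real p)\<^sup>2 / 4)"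
      using q p order.trans[OF abs_ge_zero Dev_ge[of p z]] by (intro divide_left_mono) auto
    finally show "\<bar>(real p)\<^sup>2 / q - 1\<bar> \<le> 4 * Dev p z / (real p)\<^sup>2" by (simp add: mult.commute)
  qed
qed

lemma small_count_ge_1: "fst z \<in> small p \<or> snd z \<in> small p \<Longrightarrow> 1 \<le> small_count p z"
  unfolding small_count_def by (auto simp: indicator_def)

lemma small_count_nonneg: "0 \<le> small_count p z" unfolding small_count_def by simp

text \<open>The kernel is bounded by \<open>p\<close>, so this disposes of its square on pairs with
  a short column.\<close>

lemma p2_tail_prob_tendsto: "(\<lambda>p. (real p)\<^sup>2 * tail_prob p) \<longlonglongrightarrow> 0"
proof -
  define c where "c = 1 / (8 * \<kappa>)"
  have "0 < c" using \<kappa>_ge_1 by (simp add: c_def)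
  then have "(\<lambda>p. (real p)\<^sup>2 * exp (- c * real p)) \<longlonglongrightarrow> 0" by real_asymp
  then show ?thesis unfolding tail_prob_def c_def by simp
qed

text \<open>Without short columns the squared kernel is at most \<open>32 * X ^ 4 + 2\<close> with
  \<open>X\<close> the scaled inner product, and \<open>X ^ 4\<close> is uniformly
  integrable.\<close>

lemma pair_kernel_uniformly_integrable:
  assumes e: "0 < e"
  obtains K where "0 \<le> K"
    "\<forall>\<^sub>F p in sequentially. kernel_tail K p \<le> e"
proof -
  obtain K where K: "1 \<le> K"
    "\<forall>\<^sub>F p in sequentially. (\<integral>z. above K (scaled_inner p z ^ 4) \<partial>Col2 p) \<le> e / 68"
    using scaled_inner_uniformly_integrable[of "e / 68"] e by auto
  have ev: "\<forall>\<^sub>F p in sequentially. (real p)\<^sup>2 * tail_prob p < e / 4"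
    using e by (intro order_tendstoD(2)[OF p2_tail_prob_tendsto]) auto
  \<comment> \<open>Exceeding this level forces \<open>X ^ 4 > K \<ge> 1\<close>, so the constant 2
    is absorbed into \<open>34 * X ^ 4\<close>. With \<open>e / 68\<close> and \<open>e / 4\<close>
    both parts of the final bound are at most \<open>e / 2\<close>.\<close>
  have "\<forall>\<^sub>F p in sequentially. kernel_tail (sqrt (32 * K + 2)) p \<le> e"
    using K(2) ev eventually_gt_at_top[of 0]
  proof eventually_elim
    case (elim p)
    interpret C: prob_space "Col p" by (rule prob_space_Col)
    interpret Q: pair_prob_space "Col p" "Col p" by unfold_locales
    have iX: "integrable (Col2 p) (\<lambda>z. above K (scaled_inner p z ^ 4))"
      by (rule Bochner_Integration.integrable_bound[OF scaled_inner_moments(1)[OF elim(3)]]) auto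
    have "kernel_tail (sqrt (32 * K + 2)) p
      \<le> (\<integral>z. 34 * above K (scaled_inner p z ^ 4) + (real p)\<^sup>2 * small_count p z \<partial>Col2 p)"
    proof (rule integral_mono)
      show "integrable (Col2 p) (\<lambda>z. if sqrt (32 * K + 2) < \<bar>pair_kernel p z\<bar> then (pair_kernel p z)\<^sup>2 else 0)"
        using pair_kernel_bounded[OF elim(3)] by (intro Q.integrable_const_bound[where B = "(real p)\<^sup>2"]) auto
      show "integrable (Col2 p) (\<lambda>z. 34 * above K (scaled_inner p z ^ 4) + (real p)\<^sup>2 * small_count p z)"
        using iX small_count_integral(1) by (intro Bochner_Integration.integrable_add integrable_mult_right) auto
      fix z assume z: "z \<in> space (Col2 p)"
      show "(if sqrt (32 * K + 2) < \<bar>pair_kernel p z\<bar> then (pair_kernel p z)\<^sup>2 else 0)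
        \<le> 34 * above K (scaled_inner p z ^ 4) + (real p)\<^sup>2 * small_count p z"
      proof (cases "fst z \<in> small p \<or> snd z \<in> small p")
        case True
        then have "(pair_kernel p z)\<^sup>2 \<le> (real p)\<^sup>2 * small_count p z"
          using pair_kernel_bounded[OF elim(3), of z] mult_left_mono[OF small_count_ge_1[OF True], of "(real p)\<^sup>2"] by simp
        moreover have "0 \<le> (real p)\<^sup>2 * small_count p z" using small_count_nonneg by simp
        moreover have "(if P then f else 0) \<le> 34 * above K (scaled_inner p z ^ 4) + b"
          if "f \<le> b" "0 \<le> b" for P and f b :: real
          using that by (auto intro: add_increasing)
        ultimately show ?thesis by blast
      next
        case False
        then obtain r where r: "pair_kernel p z = (scaled_inner p z)\<^sup>2 * r - 1" "0 < r" "r \<le> 4"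
          using good_pointwise[OF elim(3) z] by metis
        have "0 \<le> (scaled_inner p z)\<^sup>2 * r" "(scaled_inner p z)\<^sup>2 * r \<le> (scaled_inner p z)\<^sup>2 * 4"
          using r by (auto intro: mult_left_mono)
        then have "\<bar>pair_kernel p z\<bar> \<le> 4 * (scaled_inner p z)\<^sup>2 + 1" unfolding r(1) by linarith
        then have "(pair_kernel p z)\<^sup>2 \<le> (4 * (scaled_inner p z)\<^sup>2 + 1)\<^sup>2" using power_mono[of "\<bar>pair_kernel p z\<bar>" "4 * (scaled_inner p z)\<^sup>2 + 1" 2] by simp
        also have "\<dots> \<le> 2 * (4 * (scaled_inner p z)\<^sup>2)\<^sup>2 + 2 * 1\<^sup>2"
          using square_diff_le[of "4 * (scaled_inner p z)\<^sup>2" "-1"] by simp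
        finally have F2: "(pair_kernel p z)\<^sup>2 \<le> 32 * scaled_inner p z ^ 4 + 2" by (simp add: power_mult_distrib)
        show ?thesis
        proof (cases "sqrt (32 * K + 2) < \<bar>pair_kernel p z\<bar>")
          case True
          then have "(sqrt (32 * K + 2))\<^sup>2 < \<bar>pair_kernel p z\<bar>\<^sup>2" using K(1) by (intro power_strict_mono) auto
          then have "32 * K + 2 < (pair_kernel p z)\<^sup>2" using K(1) by simp
          with F2 have "K < scaled_inner p z ^ 4" by simp
          then have "(pair_kernel p z)\<^sup>2 \<le> 34 * scaled_inner p z ^ 4" using F2 K(1) by linarith
          moreover have "0 \<le> (real p)\<^sup>2 * small_count p z" using small_count_nonneg by simp
          ultimately show ?thesis using True \<open>K < scaled_inner p z ^ 4\<close> by simp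
        next
          case False
          then show ?thesis using small_count_nonneg[of p z] by simp
        qed
      qed
    qed
    also have "\<dots> = 34 * (\<integral>z. above K (scaled_inner p z ^ 4) \<partial>Col2 p)
        + (real p)\<^sup>2 * (\<integral>z. small_count p z \<partial>Col2 p)"
      using iX small_count_integral(1) by simp
    also have "\<dots> \<le> 34 * (e / 68) + (real p)\<^sup>2 * (2 * tail_prob p)"
      using elim(1) small_count_integral(2) by (intro add_mono mult_left_mono) auto
    also have "\<dots> \<le> e" using elim(2) by simp
    finally show ?case .
  qed
  moreover have "0 \<le> sqrt (32 * K + 2)" using K(1) by simp
  ultimately show ?thesis by (rule that[rotated])
qed

text \<open>With both squared norms replaced by \<open>p\<close>, the second moment is that of
  \<open>X\<^sup>2 - 1\<close>, namely \<open>2 + (\<kappa>\<^sup>2 - 3) / p\<close>. The correction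
  \<open>r - 1\<close> is small only in mean and is therefore paired with a bounded part of
  \<open>X ^ 4\<close>; beyond level \<open>K\<close> the bound \<open>|r - 1| \<le> 3\<close> is
  used.\<close>

lemma pair_kernel_second_moment: "(\<lambda>p. \<integral>z. (pair_kernel p z)\<^sup>2 \<partial>Col2 p) \<longlonglongrightarrow> 2"
proof -
  define V where "V p = (\<integral>z. (pair_kernel p z)\<^sup>2 \<partial>Col2 p)" for p
  define V0 where "V0 p = (\<integral>z. ((scaled_inner p z)\<^sup>2 - 1)\<^sup>2 \<partial>Col2 p)" for p
  have sq: "((scaled_inner p z)\<^sup>2 - 1)\<^sup>2 = scaled_inner p z ^ 4 - 2 * (scaled_inner p z)\<^sup>2 + 1" for p z
    by (simp add: power2_diff)
  have iX2: "integrable (Col2 p) (\<lambda>z. (scaled_inner p z)\<^sup>2)" if "0 < p" for p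
  proof -
    interpret C: prob_space "Col p" by (rule prob_space_Col)
    interpret Q: pair_prob_space "Col p" "Col p" by unfold_locales
    show ?thesis using Q.integrable_power_le4[of "scaled_inner p" 2] scaled_inner_moments(1)[OF that] by simp
  qed
  have V0_eq: "V0 p = 2 + (\<kappa>\<^sup>2 - 3) / real p" if p: "0 < p" for p
  proof -
    interpret C: prob_space "Col p" by (rule prob_space_Col)
    interpret Q: pair_prob_space "Col p" "Col p" by unfold_locales
    show ?thesis unfolding V0_def sq using scaled_inner_moments[OF p] iX2[OF p] by (simp add: Q.prob_space)
  qed
  have "(\<lambda>p. 2 + (\<kappa>\<^sup>2 - 3) / real p) \<longlonglongrightarrow> 2 + 0" by (intro tendsto_intros lim_const_over_n)
  moreover have "\<forall>\<^sub>F p in sequentially. 2 + (\<kappa>\<^sup>2 - 3) / real p = V0 p"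
    using eventually_gt_at_top[of 0] by eventually_elim (simp add: V0_eq)
  ultimately have V0_lim: "V0 \<longlonglongrightarrow> 2" by (auto intro: Lim_transform_eventually)
  have "(\<lambda>p. V p - V0 p) \<longlonglongrightarrow> 0"
  proof (rule LIMSEQ_I)
    fix e :: real assume e: "0 < e"
    obtain K where K: "1 \<le> K"
      "\<forall>\<^sub>F p in sequentially. (\<integral>z. above K (scaled_inner p z ^ 4) \<partial>Col2 p) \<le> e / 76"
      using scaled_inner_uniformly_integrable[of "e / 76"] e by auto
    \<comment> \<open>Collects what vanishes for fixed \<open>K\<close>; the tail of
      \<open>X ^ 4\<close> contributes \<open>19 * e / 76 = e / 4\<close> besides.\<close>
    define E where "E p = (6 * K + 1) * 4 / (real p)\<^sup>2 * (2 * real p * sqrt ((\<kappa> + 1) * real p) + (\<kappa> + 1) * real p)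
        + ((real p)\<^sup>2 + 1 + K) * (2 * tail_prob p)" for p
    have E_lim: "E \<longlonglongrightarrow> 0"
    proof -
      have k: "0 < \<kappa>" "0 < \<kappa> + 1" using \<kappa>_ge_1 by auto
      have "(\<lambda>p. (6 * K + 1) * 4 / (real p)\<^sup>2 * (2 * real p * sqrt ((\<kappa> + 1) * real p) + (\<kappa> + 1) * real p)) \<longlonglongrightarrow> 0"
        using k by real_asymp
      moreover have "(\<lambda>p. tail_prob p) \<longlonglongrightarrow> 0"
      proof -
        define c where "c = 1 / (8 * \<kappa>)"
        have "0 < c" using k by (simp add: c_def)
        then have "(\<lambda>p. exp (- c * real p)) \<longlonglongrightarrow> 0" by real_asymp
        then show ?thesis unfolding tail_prob_def c_def by simp
      qed
      ultimately have "(\<lambda>p. (6 * K + 1) * 4 / (real p)\<^sup>2 * (2 * real p * sqrt ((\<kappa> + 1) * real p) + (\<kappa> + 1) * real p)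
          + (2 * ((real p)\<^sup>2 * tail_prob p) + 2 * (1 + K) * tail_prob p)) \<longlonglongrightarrow> 0 + (2 * 0 + 2 * (1 + K) * 0)"
        using p2_tail_prob_tendsto by (intro tendsto_intros)
      then show ?thesis unfolding E_def by (simp add: algebra_simps)
    qed
    have ev: "\<forall>\<^sub>F p in sequentially. E p < e / 2" using e by (intro order_tendstoD(2)[OF E_lim]) auto
    have "\<forall>\<^sub>F p in sequentially. norm (V p - V0 p - 0) < e"
      using K(2) ev eventually_gt_at_top[of 0]
    proof eventually_elim
      case (elim p)
      interpret C: prob_space "Col p" by (rule prob_space_Col)
      interpret Q: pair_prob_space "Col p" "Col p" by unfold_locales
      let ?T = "\<lambda>z. above K (scaled_inner p z ^ 4)"
      have iT: "integrable (Col2 p) ?T"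
        by (rule Bochner_Integration.integrable_bound[OF scaled_inner_moments(1)[OF elim(3)]]) auto
      have iF: "integrable (Col2 p) (\<lambda>z. (pair_kernel p z)\<^sup>2)"
        using pair_kernel_bounded[OF elim(3)] by (intro Q.integrable_const_bound[where B = "(real p)\<^sup>2"]) auto
      have i0: "integrable (Col2 p) (\<lambda>z. ((scaled_inner p z)\<^sup>2 - 1)\<^sup>2)"
        unfolding sq using scaled_inner_moments(1)[OF elim(3)] iX2[OF elim(3)] by auto
      \<comment> \<open>The 19 covers both kinds of pairs: 18 = 3 times 6 without short columns, 1
        otherwise. The factor \<open>6 * K + 1\<close> arises from \<open>6 * X ^ 4 + 1\<close> when
        \<open>X ^ 4\<close> is bounded by its tail plus \<open>K\<close>.\<close>
      let ?R = "\<lambda>z. 19 * ?T z + (6 * K + 1) * 4 / (real p)\<^sup>2 * Dev p z + ((real p)\<^sup>2 + 1 + K) * small_count p z"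
      have iR: "integrable (Col2 p) ?R"
        using iT Dev_integral(1) small_count_integral(1)
        by (intro Bochner_Integration.integrable_add integrable_mult_right) auto
      have pt: "\<bar>(pair_kernel p z)\<^sup>2 - ((scaled_inner p z)\<^sup>2 - 1)\<^sup>2\<bar> \<le> ?R z" if z: "z \<in> space (Col2 p)" for z
      proof -
        have T: "0 \<le> ?T z" "scaled_inner p z ^ 4 \<le> ?T z + K" using K(1) by (auto simp: zero_le_power_eq)
        have D0: "0 \<le> (6 * K + 1) * 4 / (real p)\<^sup>2 * Dev p z"
          using order.trans[OF abs_ge_zero Dev_ge[of p z]] K(1) by simp
        have x2: "2 * (scaled_inner p z)\<^sup>2 \<le> scaled_inner p z ^ 4 + 1"
          using zero_le_power2[of "(scaled_inner p z)\<^sup>2 - 1"] unfolding sq by simp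
        show ?thesis
        proof (cases "fst z \<in> small p \<or> snd z \<in> small p")
          case True
          have "\<bar>(pair_kernel p z)\<^sup>2 - ((scaled_inner p z)\<^sup>2 - 1)\<^sup>2\<bar> \<le> (pair_kernel p z)\<^sup>2 + ((scaled_inner p z)\<^sup>2 - 1)\<^sup>2"
            using abs_triangle_ineq4[of "(pair_kernel p z)\<^sup>2" "((scaled_inner p z)\<^sup>2 - 1)\<^sup>2"] by simp
          also have "\<dots> \<le> (real p)\<^sup>2 + (scaled_inner p z ^ 4 + 1)"
            using pair_kernel_bounded[OF elim(3), of z] unfolding sq by (intro add_mono) auto
          also have "\<dots> \<le> ?T z + ((real p)\<^sup>2 + 1 + K) * 1" using T(2) by simp
          also have "\<dots> \<le> ?T z + ((real p)\<^sup>2 + 1 + K) * small_count p z"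
            using small_count_ge_1[OF True] K(1) by (intro add_left_mono mult_left_mono) auto
          finally show ?thesis using T(1) D0 by linarith
        next
          case False
          then obtain r where r: "pair_kernel p z = (scaled_inner p z)\<^sup>2 * r - 1" "0 < r" "r \<le> 4" "\<bar>r - 1\<bar> \<le> 4 * Dev p z / (real p)\<^sup>2"
            using good_pointwise[OF elim(3) z] by metis
          define x where "x = (scaled_inner p z)\<^sup>2"
          have x: "0 \<le> x" "x\<^sup>2 = scaled_inner p z ^ 4" by (auto simp: x_def)
          have "(pair_kernel p z)\<^sup>2 - (x - 1)\<^sup>2 = (r - 1) * (x * ((r + 1) * x - 2))"
            unfolding r(1) x_def[symmetric] by (simp add: power2_eq_square algebra_simps)
          then have "\<bar>(pair_kernel p z)\<^sup>2 - (x - 1)\<^sup>2\<bar> = \<bar>r - 1\<bar> * (x * \<bar>(r + 1) * x - 2\<bar>)"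
            using x(1) by (simp add: abs_mult)
          also have "\<dots> \<le> \<bar>r - 1\<bar> * (x * (5 * x + 2))"
          proof (intro mult_left_mono)
            have "0 \<le> (r + 1) * x" "(r + 1) * x \<le> 5 * x" using r x(1) by (auto intro: mult_right_mono)
            then show "\<bar>(r + 1) * x - 2\<bar> \<le> 5 * x + 2" by linarith
          qed (use x in auto)
          also have "\<dots> \<le> \<bar>r - 1\<bar> * (6 * scaled_inner p z ^ 4 + 1)"
          proof (intro mult_left_mono)
            have "x * (5 * x + 2) = 5 * scaled_inner p z ^ 4 + 2 * x" using x(2) by (simp add: power2_eq_square algebra_simps)
            then show "x * (5 * x + 2) \<le> 6 * scaled_inner p z ^ 4 + 1" using x2 unfolding x_def by simp
          qed auto
          also have "\<dots> \<le> \<bar>r - 1\<bar> * (6 * ?T z + (6 * K + 1))"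
            using T(2) by (intro mult_left_mono) auto
          also have "\<dots> = \<bar>r - 1\<bar> * (6 * ?T z) + (6 * K + 1) * \<bar>r - 1\<bar>" by (simp add: distrib_left mult.commute)
          also have "\<dots> \<le> 3 * (6 * ?T z) + (6 * K + 1) * (4 * Dev p z / (real p)\<^sup>2)"
            using r T(1) K(1) by (intro add_mono mult_right_mono mult_left_mono) auto
          also have "\<dots> = 18 * ?T z + (6 * K + 1) * 4 / (real p)\<^sup>2 * Dev p z" by simp
          finally have "\<bar>(pair_kernel p z)\<^sup>2 - (x - 1)\<^sup>2\<bar> \<le> 18 * ?T z + (6 * K + 1) * 4 / (real p)\<^sup>2 * Dev p z" .
          moreover have "0 \<le> ((real p)\<^sup>2 + 1 + K) * small_count p z" using small_count_nonneg K(1) by simp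
          ultimately show ?thesis using T(1) unfolding x_def by linarith
        qed
      qed
      have "V p - V0 p = (\<integral>z. (pair_kernel p z)\<^sup>2 - ((scaled_inner p z)\<^sup>2 - 1)\<^sup>2 \<partial>Col2 p)"
        unfolding V_def V0_def using iF i0 by simp
      also have "\<bar>\<dots>\<bar> \<le> (\<integral>z. \<bar>(pair_kernel p z)\<^sup>2 - ((scaled_inner p z)\<^sup>2 - 1)\<^sup>2\<bar> \<partial>Col2 p)" by (rule integral_abs_bound)
      also have "\<dots> \<le> (\<integral>z. ?R z \<partial>Col2 p)"
        using iF i0 iR pt by (intro integral_mono) auto
      also have "\<dots> = 19 * (\<integral>z. ?T z \<partial>Col2 p) + (6 * K + 1) * 4 / (real p)\<^sup>2 * (\<integral>z. Dev p z \<partial>Col2 p)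
          + ((real p)\<^sup>2 + 1 + K) * (\<integral>z. small_count p z \<partial>Col2 p)"
        using iT Dev_integral(1)[of p] small_count_integral(1)[of p] by simp
      also have "\<dots> \<le> 19 * (e / 76) + (6 * K + 1) * 4 / (real p)\<^sup>2 * (2 * real p * sqrt ((\<kappa> + 1) * real p) + (\<kappa> + 1) * real p)
          + ((real p)\<^sup>2 + 1 + K) * (2 * tail_prob p)"
        using elim(1) Dev_integral(2)[of p] small_count_integral(2)[of p] K(1) by (intro add_mono mult_left_mono) auto
      also have "\<dots> < e" using elim(2) e unfolding E_def by simp
      finally show ?case by simp
    qed
    then show "\<exists>no. \<forall>p\<ge>no. norm (V p - V0 p - 0) < e" by (simp add: eventually_sequentially)
  qed
  from tendsto_add[OF this V0_lim] show ?thesis unfolding V_def by simp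
qed

text \<open>An upper bound for \<open>\<epsilon>\<close> in terms of the constants of a column. The
  summand \<open>1 / real p\<close> keeps it strictly positive, as \<open>v_approx\<close>
  demands.\<close>

definition err :: "nat \<Rightarrow> real" where
  "err p = 3 * (real p)\<^sup>2 * (2 * op_const p * (mean_const p)\<^sup>2 + ((mean_const p)\<^sup>2)\<^sup>2) + 1 / real p"

definition U_stat :: "nat \<Rightarrow> nat \<Rightarrow> (nat \<Rightarrow> nat \<Rightarrow> real) \<Rightarrow> real" where
  "U_stat p n x = (\<Sum>k<n. \<Sum>j<k. pair_kernel p (x j, x k)) / real n"

lemma tail_prob_nonneg: "0 \<le> tail_prob p" by (simp add: tail_prob_def)
lemma op_const_nonneg: "0 \<le> op_const p" unfolding op_const_def using \<kappa>_ge_1 tail_prob_nonneg by simp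
text \<open>The witness \<open>v\<close> is the second moment of the centred kernel, described only
  by its distance from \<open>V\<close> so that the locale of features can be left behind. It
  depends on \<open>p\<close> alone, whence its place before the quantifiers over \<open>t\<close>,
  \<open>n\<close> and \<open>K\<close>. The level \<open>2 * K\<close> is the one of
  \<open>tail_bound\<close>.\<close>

lemma char_U_stat_bound:
  assumes p: "0 < p"
  defines "V \<equiv> \<integral>z. (pair_kernel p z)\<^sup>2 \<partial>Col2 p"
  shows "\<exists>v. 0 \<le> v \<and> \<bar>v - V\<bar> \<le> sqrt (err p) * V + err p + sqrt (err p) \<and>
    (\<forall>t n K. 0 < n \<longrightarrow> 0 \<le> K \<longrightarrow>
      cmod ((CLINT x|PiM {..<n} (\<lambda>_. Col p). iexp (t * U_stat p n x))
        - complex_of_real (exp (- (t\<^sup>2 * (v * (real n - 1) / (2 * real n)) / 2))))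
      \<le> \<bar>t\<bar> * (real p * sqrt (real n * op_const p * (mean_const p)\<^sup>2) + real p * real n * (mean_const p)\<^sup>2 / 2)
       + (t\<^sup>2 / 2 * sqrt (2 * (4 * (real p)\<^sup>2 * op_const p)\<^sup>2 / real n + 4 * ((real p)\<^sup>2 * (op_const p)\<^sup>2 * v))
       + 80 * \<bar>t\<bar> ^ 3 * ((2 * K)\<^sup>2 + (2 * K) ^ 4) / sqrt (real n)
       + 4 * t\<^sup>2 * (4 * kernel_tail K p + 4 * err p)
       + t ^ 4 * v\<^sup>2 / (8 * real n)))"
proof -
  interpret K: feature_kernel "Col p" "idx p" "feat p" "real p" "op_const p" by (rule feature_kernel_Col[OF p])
  have msq: "K.msq \<le> (mean_const p)\<^sup>2" by (rule msq_bound[OF p])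
  have F: "K.F (fst z) (snd z) = pair_kernel p z" for z unfolding K.F_def pair_kernel_def ..
  have eps: "K.\<epsilon> \<le> err p"
  proof -
    have "K.msq\<^sup>2 \<le> ((mean_const p)\<^sup>2)\<^sup>2" using msq K.msq_nonneg by (intro power_mono)
    then have "K.\<epsilon> \<le> 3 * (real p)\<^sup>2 * (2 * op_const p * (mean_const p)\<^sup>2 + ((mean_const p)\<^sup>2)\<^sup>2)"
      unfolding K.\<epsilon>_def using msq op_const_nonneg by (intro mult_left_mono add_mono) auto
    then show ?thesis unfolding err_def by (simp add: add_increasing2)
  qed
  have err0: "0 < err p" unfolding err_def using p op_const_nonneg by (intro add_nonneg_pos) auto
  have V: "V = (\<integral>z. (K.F (fst z) (snd z))\<^sup>2 \<partial>K.Q)" unfolding V_def F ..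
  have v0: "0 \<le> K.deg.v" by (rule K.deg.v_nonneg)
  have W: "K.W n x = U_stat p n x" for n x
    unfolding K.W_def U_stat_def K.F_def pair_kernel_def by simp
  show ?thesis
  proof (intro exI[of _ K.deg.v] conjI allI impI v0)
    show "\<bar>K.deg.v - V\<bar> \<le> sqrt (err p) * V + err p + sqrt (err p)"
      unfolding V by (rule K.v_approx[OF err0 eps])
    fix t :: real and n :: nat and K :: real assume n: "0 < n" and K: "0 \<le> K"
    have 1: "real p * sqrt (real n * op_const p * K.msq) + real p * real n * K.msq / 2
        \<le> real p * sqrt (real n * op_const p * (mean_const p)\<^sup>2) + real p * real n * (mean_const p)\<^sup>2 / 2"
      using msq op_const_nonneg by (intro add_mono mult_left_mono real_sqrt_le_mono divide_right_mono) auto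
    have 2: "sqrt (2 * K.deg.w / real n + 4 * K.deg.g)
        \<le> sqrt (2 * (4 * (real p)\<^sup>2 * op_const p)\<^sup>2 / real n + 4 * ((real p)\<^sup>2 * (op_const p)\<^sup>2 * K.deg.v))"
      using K.w_bound K.g_bound by (intro real_sqrt_le_mono add_mono divide_right_mono mult_left_mono) auto
    have 3: "K.deg.tail (2 * K) \<le> 4 * kernel_tail K p + 4 * err p"
      using K.tail_bound[of K] eps unfolding F by linarith
    show "cmod ((CLINT x|PiM {..<n} (\<lambda>_. Col p). iexp (t * U_stat p n x))
        - complex_of_real (exp (- (t\<^sup>2 * (K.deg.v * (real n - 1) / (2 * real n)) / 2))))
      \<le> \<bar>t\<bar> * (real p * sqrt (real n * op_const p * (mean_const p)\<^sup>2) + real p * real n * (mean_const p)\<^sup>2 / 2)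
       + (t\<^sup>2 / 2 * sqrt (2 * (4 * (real p)\<^sup>2 * op_const p)\<^sup>2 / real n + 4 * ((real p)\<^sup>2 * (op_const p)\<^sup>2 * K.deg.v))
       + 80 * \<bar>t\<bar> ^ 3 * ((2 * K)\<^sup>2 + (2 * K) ^ 4) / sqrt (real n)
       + 4 * t\<^sup>2 * (4 * kernel_tail K p + 4 * err p)
       + t ^ 4 * K.deg.v\<^sup>2 / (8 * real n))"
    proof (rule order.trans[OF K.char_W_bound[OF n, of "2 * K" t, unfolded W]])
      show "0 \<le> 2 * K" using K by simp
    qed (intro add_mono mult_left_mono order_refl 1 2 3; simp)
  qed
qed

text \<open>With \<open>op_const p\<close> of order \<open>p^-2\<close> and
  \<open>mean_const p\<close> of order \<open>p^(-3/2)\<close>, all exponential terms are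
  negligible. The powers of \<open>p\<close> are those that remain in the error bound once
  \<open>n\<close> is written as a multiple of \<open>p\<close>.\<close>

lemma err_tendsto: "err \<longlonglongrightarrow> 0"
  and p3_op_mean_tendsto: "(\<lambda>p. (real p) ^ 3 * op_const p * (mean_const p)\<^sup>2) \<longlonglongrightarrow> 0"
  and p2_mean_tendsto: "(\<lambda>p. (real p)\<^sup>2 * (mean_const p)\<^sup>2) \<longlonglongrightarrow> 0"
  and p2_op_tendsto: "(\<lambda>p. (real p)\<^sup>2 * op_const p) \<longlonglongrightarrow> 16 * (\<kappa> + 1)"
  and p2_op_sq_tendsto: "(\<lambda>p. (real p)\<^sup>2 * (op_const p)\<^sup>2) \<longlonglongrightarrow> 0"
proof -
  define c where "c = 1 / (8 * \<kappa>)"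
  define C where "C = \<kappa> + 1"
  have c: "0 < c" and C: "0 < C" using \<kappa>_ge_1 by (auto simp: c_def C_def)
  have b: "tail_prob p = exp (- c * real p)" for p unfolding tail_prob_def c_def by simp
  have op: "op_const p = 16 * C / (real p)\<^sup>2 + exp (- c * real p)" for p
    unfolding op_const_def b C_def ..
  have mc: "mean_const p = 9 * C * sqrt (real p) / (real p)\<^sup>2 + 2 * exp (- c * real p)" for p
    unfolding mean_const_def b C_def ..
  show "err \<longlonglongrightarrow> 0" unfolding err_def[abs_def] op mc using c C by real_asymp
  show "(\<lambda>p. (real p) ^ 3 * op_const p * (mean_const p)\<^sup>2) \<longlonglongrightarrow> 0" unfolding op mc using c C by real_asymp
  show "(\<lambda>p. (real p)\<^sup>2 * (mean_const p)\<^sup>2) \<longlonglongrightarrow> 0" unfolding mc using c C by real_asymp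
  show "(\<lambda>p. (real p)\<^sup>2 * op_const p) \<longlonglongrightarrow> 16 * (\<kappa> + 1)"
    unfolding op C_def[symmetric] using c C by real_asymp
  show "(\<lambda>p. (real p)\<^sup>2 * (op_const p)\<^sup>2) \<longlonglongrightarrow> 0" unfolding op using c C by real_asymp
qed

section \<open>The regime p / n -> y\<close>

context
  fixes p :: "nat \<Rightarrow> nat" and y :: real
  assumes ratio: "(\<lambda>n. real (p n) / real n) \<longlonglongrightarrow> y" and y_pos: "0 < y"
begin

lemma p_at_top: "filterlim p at_top sequentially"
proof -
  have "filterlim (\<lambda>n. real (p n) / real n * real n) at_top sequentially"
    by (rule filterlim_tendsto_pos_mult_at_top[OF ratio y_pos filterlim_real_sequentially])
  moreover have "\<forall>\<^sub>F n in sequentially. real (p n) / real n * real n = real (p n)"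
    using eventually_gt_at_top[of 0] by eventually_elim simp
  ultimately have "filterlim (\<lambda>n. real (p n)) at_top sequentially"
    by (simp add: filterlim_cong)
  then show ?thesis by (simp add: filterlim_real_sequentially filterlim_sequentially_iff_filterlim_real)
qed

lemma inverse_ratio: "(\<lambda>n. real n / real (p n)) \<longlonglongrightarrow> 1 / y"
  using tendsto_inverse[OF ratio] y_pos by (simp add: inverse_eq_divide)

lemma p_pos: "\<forall>\<^sub>F n in sequentially. 0 < p n"
  by (rule eventually_compose_filterlim[OF eventually_gt_at_top[of 0] p_at_top])

text \<open>The order of limits matters: \<open>K\<close> is chosen first, making the kernel tail
  small for all large \<open>p\<close>; at this fixed level every other error vanishes. The variance
  \<open>v * (n - 1) / (2 * n)\<close> tends to 1 because \<open>v\<close> tends to 2.\<close>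

lemma char_U_stat_tendsto:
  "(\<lambda>n. CLINT x|PiM {..<n} (\<lambda>_. Col (p n)). iexp (t * U_stat (p n) n x)) \<longlonglongrightarrow> complex_of_real (exp (- (t\<^sup>2) / 2))"
proof -
  define V where "V p = (\<integral>z. (pair_kernel p z)\<^sup>2 \<partial>Col2 p)" for p
  define TL where "TL K p = kernel_tail K p" for K p
  define \<phi> where "\<phi> p n = (CLINT x|PiM {..<n} (\<lambda>_. Col p). iexp (t * U_stat p n x))" for p n
  define lim where "lim v n = exp (- (t\<^sup>2 * (v * (real n - 1) / (2 * real n)) / 2))" for v :: real and n :: nat
  define B1 where "B1 p n = \<bar>t\<bar> * (real p * sqrt (real n * op_const p * (mean_const p)\<^sup>2) + real p * real n * (mean_const p)\<^sup>2 / 2)" for p n :: nat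
  define B2 where "B2 p n v = t\<^sup>2 / 2 * sqrt (2 * (4 * (real p)\<^sup>2 * op_const p)\<^sup>2 / real n + 4 * ((real p)\<^sup>2 * (op_const p)\<^sup>2 * v))" for p n :: nat and v :: real
  define B3 where "B3 K n = 80 * \<bar>t\<bar> ^ 3 * ((2 * K)\<^sup>2 + (2 * K) ^ 4) / sqrt (real n)" for K :: real and n :: nat
  \<comment> \<open>The existential stands in front of \<open>0 < p\<close> so that a single
    function \<open>v\<close> of \<open>p\<close> can be chosen.\<close>
  have "\<forall>p. \<exists>v. 0 < p \<longrightarrow> 0 \<le> v \<and> \<bar>v - V p\<bar> \<le> sqrt (err p) * V p + err p + sqrt (err p) \<and>
    (\<forall>n K. 0 < n \<longrightarrow> 0 \<le> K \<longrightarrow> cmod (\<phi> p n - complex_of_real (lim v n))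
      \<le> B1 p n + (B2 p n v + B3 K n + 4 * t\<^sup>2 * (4 * TL K p + 4 * err p) + t ^ 4 * v\<^sup>2 / (8 * real n)))"
    using char_U_stat_bound unfolding V_def TL_def \<phi>_def lim_def B1_def B2_def B3_def by meson
  then obtain v where v: "\<And>p. 0 < p \<Longrightarrow> \<bar>v p - V p\<bar> \<le> sqrt (err p) * V p + err p + sqrt (err p)"
    "\<And>p n K. 0 < p \<Longrightarrow> 0 < n \<Longrightarrow> 0 \<le> K \<Longrightarrow> cmod (\<phi> p n - complex_of_real (lim (v p) n))
      \<le> B1 p n + (B2 p n (v p) + B3 K n + 4 * t\<^sup>2 * (4 * TL K p + 4 * err p) + t ^ 4 * (v p)\<^sup>2 / (8 * real n))"
    by metis
  have V_lim: "V \<longlonglongrightarrow> 2" unfolding V_def by (rule pair_kernel_second_moment)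
  have "(\<lambda>p. sqrt (err p) * V p + err p + sqrt (err p)) \<longlonglongrightarrow> sqrt 0 * 2 + 0 + sqrt 0"
    by (intro tendsto_intros err_tendsto V_lim)
  then have "(\<lambda>p. v p - V p) \<longlonglongrightarrow> 0"
    by (intro Lim_null_comparison[of "\<lambda>p. v p - V p"])
       (use v(1) in \<open>auto intro: eventually_mono[OF eventually_gt_at_top[of 0]]\<close>)
  from tendsto_add[OF this V_lim] have "v \<longlonglongrightarrow> 2" by simp
  then have v_lim: "(\<lambda>n. v (p n)) \<longlonglongrightarrow> 2" by (rule filterlim_compose[OF _ p_at_top])
  have inv_n: "(\<lambda>n. 1 / real n) \<longlonglongrightarrow> 0" by (rule lim_1_over_n)
  have lim_lim: "(\<lambda>n. lim (v (p n)) n) \<longlonglongrightarrow> exp (- (t\<^sup>2) / 2)"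
  proof -
    have "(\<lambda>n. exp (- (t\<^sup>2 * (v (p n) * ((1 - 1 / real n) / 2)) / 2))) \<longlonglongrightarrow> exp (- (t\<^sup>2 * (2 * ((1 - 0) / 2)) / 2))"
      by (intro tendsto_intros v_lim inv_n) auto
    moreover have "\<forall>\<^sub>F n in sequentially. exp (- (t\<^sup>2 * (v (p n) * ((1 - 1 / real n) / 2)) / 2)) = lim (v (p n)) n"
      using eventually_gt_at_top[of 0]
    proof eventually_elim
      case (elim n)
      then have "(1 - 1 / real n) / 2 = (real n - 1) / (2 * real n)" by (simp add: field_simps)
      then show ?case unfolding lim_def by (simp only: times_divide_eq_right)
    qed
    ultimately show ?thesis by (auto intro: Lim_transform_eventually)
  qed
  have B1_lim: "(\<lambda>n. B1 (p n) n) \<longlonglongrightarrow> 0"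
  proof -
    \<comment> \<open>The bound is rewritten as \<open>n / p\<close>, which tends to
      \<open>1 / y\<close>, times quantities in \<open>p\<close> alone, whose limits compose with
      the growth of \<open>p\<close>.\<close>
    have "(\<lambda>n. \<bar>t\<bar> * (sqrt (real n / real (p n) * (real (p n) ^ 3 * op_const (p n) * (mean_const (p n))\<^sup>2))
        + real n / real (p n) * ((real (p n))\<^sup>2 * (mean_const (p n))\<^sup>2) / 2))
      \<longlonglongrightarrow> \<bar>t\<bar> * (sqrt (1 / y * 0) + 1 / y * 0 / 2)"
      by (intro tendsto_intros inverse_ratio filterlim_compose[OF p3_op_mean_tendsto p_at_top]
          filterlim_compose[OF p2_mean_tendsto p_at_top]) auto
    moreover have "\<forall>\<^sub>F n in sequentially. \<bar>t\<bar> * (sqrt (real n / real (p n) * (real (p n) ^ 3 * op_const (p n) * (mean_const (p n))\<^sup>2))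
        + real n / real (p n) * ((real (p n))\<^sup>2 * (mean_const (p n))\<^sup>2) / 2) = B1 (p n) n"
      using p_pos
    proof eventually_elim
      case (elim n)
      have "real n / real (p n) * (real (p n) ^ 3 * op_const (p n) * (mean_const (p n))\<^sup>2)
          = (real (p n))\<^sup>2 * (real n * op_const (p n) * (mean_const (p n))\<^sup>2)"
        using elim by (simp add: power2_eq_square power3_eq_cube)
      then have "sqrt (real n / real (p n) * (real (p n) ^ 3 * op_const (p n) * (mean_const (p n))\<^sup>2))
          = real (p n) * sqrt (real n * op_const (p n) * (mean_const (p n))\<^sup>2)"
        by (simp only: real_sqrt_mult[of "(real (p n))\<^sup>2"] real_sqrt_abs abs_of_nat)
      moreover have "real n / real (p n) * ((real (p n))\<^sup>2 * (mean_const (p n))\<^sup>2) = real (p n) * real n * (mean_const (p n))\<^sup>2"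
        using elim by (simp add: power2_eq_square)
      ultimately show ?case unfolding B1_def by simp
    qed
    ultimately show ?thesis by (auto intro: Lim_transform_eventually)
  qed
  have B2_lim: "(\<lambda>n. B2 (p n) n (v (p n))) \<longlonglongrightarrow> 0"
  proof -
    have "(\<lambda>n. t\<^sup>2 / 2 * sqrt (2 * (4 * ((real (p n))\<^sup>2 * op_const (p n)))\<^sup>2 * (1 / real n)
          + 4 * ((real (p n))\<^sup>2 * (op_const (p n))\<^sup>2 * v (p n))))
        \<longlonglongrightarrow> t\<^sup>2 / 2 * sqrt (2 * (4 * (16 * (\<kappa> + 1)))\<^sup>2 * 0 + 4 * (0 * 2))"
      by (intro tendsto_intros inv_n v_lim filterlim_compose[OF p2_op_tendsto p_at_top]
          filterlim_compose[OF p2_op_sq_tendsto p_at_top])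
    then show ?thesis unfolding B2_def by (simp add: mult.assoc)
  qed
  have B3_lim: "(\<lambda>n. B3 K n) \<longlonglongrightarrow> 0" for K unfolding B3_def by real_asymp
  have B4_lim: "(\<lambda>n. 16 * t\<^sup>2 * err (p n)) \<longlonglongrightarrow> 16 * t\<^sup>2 * 0"
    by (intro tendsto_intros filterlim_compose[OF err_tendsto p_at_top])
  have B5_lim: "(\<lambda>n. t ^ 4 * (v (p n))\<^sup>2 / (8 * real n)) \<longlonglongrightarrow> 0"
  proof -
    have "(\<lambda>n. t ^ 4 * (v (p n))\<^sup>2 / 8 * (1 / real n)) \<longlonglongrightarrow> t ^ 4 * 2\<^sup>2 / 8 * 0"
      by (intro tendsto_intros inv_n v_lim) auto
    then show ?thesis by simp
  qed
  have "(\<lambda>n. \<phi> (p n) n - complex_of_real (lim (v (p n)) n)) \<longlonglongrightarrow> 0"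
  proof (rule LIMSEQ_I)
    fix e :: real assume e: "0 < e"
    \<comment> \<open>Ensures \<open>16 * t\<^sup>2 * d \<le> e / 2\<close>; the added 1 keeps the
      denominator positive at \<open>t = 0\<close>.\<close>
    define d where "d = e / (2 * (16 * t\<^sup>2 + 1))"
    have t1: "0 < 16 * t\<^sup>2 + 1" by (simp add: add_nonneg_pos)
    then have d: "0 < d" using e by (simp add: d_def)
    obtain K where K: "0 \<le> K" "\<forall>\<^sub>F p in sequentially. TL K p \<le> d"
      using pair_kernel_uniformly_integrable[OF d] unfolding TL_def by blast
    have evT: "\<forall>\<^sub>F n in sequentially. TL K (p n) \<le> d"
      using K(2) p_at_top by (rule eventually_compose_filterlim)
    have "(\<lambda>n. B1 (p n) n + B2 (p n) n (v (p n)) + B3 K n + 16 * t\<^sup>2 * err (p n) + t ^ 4 * (v (p n))\<^sup>2 / (8 * real n))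
        \<longlonglongrightarrow> 0 + 0 + 0 + 16 * t\<^sup>2 * 0 + 0"
      by (intro tendsto_add B1_lim B2_lim B3_lim B4_lim B5_lim)
    then have ev: "\<forall>\<^sub>F n in sequentially. B1 (p n) n + B2 (p n) n (v (p n)) + B3 K n + 16 * t\<^sup>2 * err (p n)
        + t ^ 4 * (v (p n))\<^sup>2 / (8 * real n) < e / 2"
      using e by (intro order_tendstoD(2)) auto
    have "\<forall>\<^sub>F n in sequentially. norm (\<phi> (p n) n - complex_of_real (lim (v (p n)) n) - 0) < e"
      using evT ev p_pos eventually_gt_at_top[of 0]
    proof eventually_elim
      case (elim n)
      have "16 * t\<^sup>2 * TL K (p n) \<le> 16 * t\<^sup>2 * d" using elim(1) by (intro mult_left_mono) auto
      also have "\<dots> \<le> (16 * t\<^sup>2 + 1) * d" using d by (intro mult_right_mono) auto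
      also have "\<dots> = e / 2"
      proof -
        have "a * (e / (2 * a)) = e / 2" if "0 < a" for a :: real using that by simp
        from this[OF t1] show ?thesis unfolding d_def .
      qed
      finally have "16 * t\<^sup>2 * TL K (p n) \<le> e / 2" .
      then show ?case using v(2)[OF elim(3,4) K(1)] elim(2) by (simp add: distrib_left)
    qed
    then show "\<exists>no. \<forall>n\<ge>no. norm (\<phi> (p n) n - complex_of_real (lim (v (p n)) n) - 0) < e"
      by (simp add: eventually_sequentially)
  qed
  from tendsto_add[OF this tendsto_of_real[OF lim_lim]] show ?thesis unfolding \<phi>_def by simp
qed

end

section \<open>From the entries of the covariance matrix to the U-statistic\<close>

definition scaled_T :: "nat \<Rightarrow> nat \<Rightarrow> (nat \<Rightarrow> nat \<Rightarrow> real) \<Rightarrow> real" where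
  "scaled_T p n x = (1 / (real p / real n) *
     (\<Sum>k<p. \<Sum>l<p. (real p / real n * (\<Sum>i<n. x i k * x i l / sqn p (x i)))\<^sup>2) - real n - real p + 1) / 2"

text \<open>The squared entries regroup into squared cosines \<open>c i j\<close> of pairs of
  columns. The diagonal pairs, each equal to 1 as no column vanishes, cancel \<open>- p\<close>; the
  \<open>n (n - 1) / 2\<close> others are centred by 1 each, which accounts for
  \<open>- n + 1\<close>. So the shift by 1 in the limit theorem makes this identity exact.\<close>

lemma scaled_T_eq_U_stat:
  assumes np: "0 < n" "0 < p" and q: "\<And>i. i < n \<Longrightarrow> sqn p (x i) \<noteq> 0"
  shows "scaled_T p n x = U_stat p n x"
proof -
  define c where "c i j = (\<Sum>k<p. x i k * x j k)\<^sup>2 / (sqn p (x i) * sqn p (x j))" for i j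
  have c_sym: "c i j = c j i" for i j unfolding c_def by (simp add: mult.commute)
  have c_diag: "c i i = 1" if "i < n" for i
  proof -
    have "(\<Sum>k<p. x i k * x i k) = sqn p (x i)" unfolding sqn_def by (simp add: power2_eq_square)
    then show ?thesis using q[OF that] unfolding c_def by (simp add: power2_eq_square)
  qed
  have "(\<Sum>k<p. \<Sum>l<p. (\<Sum>i<n. x i k * x i l / sqn p (x i))\<^sup>2)
      = (\<Sum>k<p. \<Sum>l<p. \<Sum>i<n. \<Sum>j<n. (x i k * x j k) * (x i l * x j l) / (sqn p (x i) * sqn p (x j)))"
    unfolding power2_eq_square sum_product by (intro sum.cong refl) simp
  also have "\<dots> = (\<Sum>k<p. \<Sum>i<n. \<Sum>l<p. \<Sum>j<n. (x i k * x j k) * (x i l * x j l) / (sqn p (x i) * sqn p (x j)))"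
    by (intro sum.cong refl sum.swap)
  also have "\<dots> = (\<Sum>i<n. \<Sum>k<p. \<Sum>l<p. \<Sum>j<n. (x i k * x j k) * (x i l * x j l) / (sqn p (x i) * sqn p (x j)))"
    by (rule sum.swap)
  also have "\<dots> = (\<Sum>i<n. \<Sum>k<p. \<Sum>j<n. \<Sum>l<p. (x i k * x j k) * (x i l * x j l) / (sqn p (x i) * sqn p (x j)))"
    by (intro sum.cong refl sum.swap)
  also have "\<dots> = (\<Sum>i<n. \<Sum>j<n. \<Sum>k<p. \<Sum>l<p. (x i k * x j k) * (x i l * x j l) / (sqn p (x i) * sqn p (x j)))"
    by (intro sum.cong refl sum.swap)
  also have "\<dots> = (\<Sum>i<n. \<Sum>j<n. c i j)"
    unfolding c_def power2_eq_square sum_product sum_divide_distrib ..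
  finally have s1: "(\<Sum>k<p. \<Sum>l<p. (\<Sum>i<n. x i k * x i l / sqn p (x i))\<^sup>2) = (\<Sum>i<n. \<Sum>j<n. c i j)" .
  have s2: "(\<Sum>i<m. \<Sum>j<m. c i j) = (\<Sum>i<m. c i i) + 2 * (\<Sum>i<m. \<Sum>j<i. c j i)" for m
  proof (induction m)
    case (Suc m)
    have "(\<Sum>i<m. c i m) = (\<Sum>i<m. c m i)" by (simp add: c_sym)
    then show ?case using Suc by (simp add: sum.distrib)
  qed simp
  have "(\<Sum>i<n. c i i) = real n" using c_diag by simp
  then have s3: "(\<Sum>i<n. \<Sum>j<n. c i j) = real n + 2 * (\<Sum>i<n. \<Sum>j<i. c j i)" using s2[of n] by simp
  have Fc: "pair_kernel p (x j, x i) = real p * c j i - 1" if "j < n" "i < n" for i j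
  proof -
    have "(scaled_inner p (x j, x i))\<^sup>2 = (\<Sum>k<p. x j k * x i k)\<^sup>2 / real p" unfolding scaled_inner_def by (simp add: power_divide)
    then show ?thesis
      using pair_kernel_eq[of p "(x j, x i)"] q[OF that(1)] q[OF that(2)] np unfolding c_def by (simp add: power2_eq_square)
  qed
  have "(\<Sum>i<n. \<Sum>j<i. pair_kernel p (x j, x i)) = (\<Sum>i<n. \<Sum>j<i. real p * c j i - 1)"
    by (intro sum.cong refl Fc) auto
  also have "\<dots> = real p * (\<Sum>i<n. \<Sum>j<i. c j i) - (\<Sum>i<n. real i)"
    by (simp add: sum_subtractf sum_distrib_left)
  also have "(\<Sum>i<n. real i) = real n * (real n - 1) / 2" by (induction n) (auto simp: field_simps)
  finally have W: "U_stat p n x = real p / real n * (\<Sum>i<n. \<Sum>j<i. c j i) - (real n - 1) / 2"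
    unfolding U_stat_def using np by (simp add: diff_divide_distrib)
  have "(\<Sum>k<p. \<Sum>l<p. (real p / real n * (\<Sum>i<n. x i k * x i l / sqn p (x i)))\<^sup>2)
      = (real p / real n)\<^sup>2 * (real n + 2 * (\<Sum>i<n. \<Sum>j<i. c j i))"
    unfolding power_mult_distrib sum_distrib_left[symmetric] s1 s3 ..
  then have "scaled_T p n x = (1 / (real p / real n) * ((real p / real n)\<^sup>2 * (real n + 2 * (\<Sum>i<n. \<Sum>j<i. c j i))) - real n - real p + 1) / 2"
    unfolding scaled_T_def by simp
  also have "1 / (real p / real n) * ((real p / real n)\<^sup>2 * (real n + 2 * (\<Sum>i<n. \<Sum>j<i. c j i)))
      = real p / real n * (real n + 2 * (\<Sum>i<n. \<Sum>j<i. c j i))"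
    using np by (simp add: power2_eq_square)
  also have "\<dots> = real p + 2 * (real p / real n * (\<Sum>i<n. \<Sum>j<i. c j i))"
    using np by (simp add: distrib_left)
  finally show ?thesis unfolding W by (simp add: field_simps)
qed

lemma column_meas: "i < n \<Longrightarrow> (\<lambda>x. x i) \<in> measurable (PiM {..<n} (\<lambda>_. Col p)) (Col p)"
  by (rule measurable_component_singleton) simp

lemma scaled_T_meas: "scaled_T p n \<in> borel_measurable (PiM {..<n} (\<lambda>_. Col p))"
proof -
  have "(\<lambda>x. x i k) \<in> borel_measurable (PiM {..<n} (\<lambda>_. Col p))" if "i < n" "k < p" for i k
    using measurable_compose[OF column_meas[OF that(1)] coord_meas[OF that(2)]] .
  moreover have "(\<lambda>x. sqn p (x i)) \<in> borel_measurable (PiM {..<n} (\<lambda>_. Col p))" if "i < n" for i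
    using measurable_compose[OF column_meas[OF that] sqn_meas] .
  ultimately show ?thesis unfolding scaled_T_def
    by (intro borel_measurable_divide borel_measurable_add borel_measurable_diff borel_measurable_times
        borel_measurable_const borel_measurable_sum borel_measurable_power) auto
qed

lemma U_stat_meas: "U_stat p n \<in> borel_measurable (PiM {..<n} (\<lambda>_. Col p))"
  unfolding U_stat_def
  by (intro borel_measurable_divide borel_measurable_sum borel_measurable_const
      measurable_compose[OF measurable_Pair[OF column_meas column_meas] pair_kernel_meas]) auto

text \<open>The two statistics can differ only if some column vanishes, and such a column is short.
  The trivial bound 2 on that event and a union bound over the \<open>n\<close> columns
  suffice.\<close>

lemma char_scaled_T_U_stat:
  assumes np: "0 < n" "0 < p"
  shows "cmod ((CLINT x|PiM {..<n} (\<lambda>_. Col p). iexp (t * scaled_T p n x)) - (CLINT x|PiM {..<n} (\<lambda>_. Col p). iexp (t * U_stat p n x)))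
    \<le> 2 * (real n * tail_prob p)"
proof -
  let ?P = "PiM {..<n} (\<lambda>_. Col p)"
  interpret P: prob_space ?P by (rule prob_space_PiM) (rule prob_space_Col)
  have [measurable]: "scaled_T p n \<in> borel_measurable ?P" "U_stat p n \<in> borel_measurable ?P" by (rule scaled_T_meas U_stat_meas)+
  have iT: "complex_integrable ?P (\<lambda>x. iexp (t * scaled_T p n x))" "complex_integrable ?P (\<lambda>x. iexp (t * U_stat p n x))"
    by (intro P.integrable_const_bound[where B = 1]; simp)+
  have sm: "integrable ?P (\<lambda>x. indicator (small p) (x i) :: real)" "(\<integral>x. indicator (small p) (x i) \<partial>?P) \<le> tail_prob p" if "i < n" for i
  proof -
    have d: "distr ?P (Col p) (\<lambda>x. x i) = Col p"
      using that prob_space_Col by (intro distr_PiM_component) auto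
    show "integrable ?P (\<lambda>x. indicator (small p) (x i) :: real)"
      using integrable_distr[OF column_meas[OF that], of p "indicator (small p) :: _ \<Rightarrow> real"] d small_int by simp
    have "(\<integral>x. indicator (small p) (x i) \<partial>?P) = (\<integral>x. (indicator (small p) x :: real) \<partial>distr ?P (Col p) (\<lambda>x. x i))"
      using column_meas[OF that] by (intro integral_distr[symmetric]) auto
    then show "(\<integral>x. indicator (small p) (x i) \<partial>?P) \<le> tail_prob p" unfolding d using small_integral by simp
  qed
  have "cmod ((CLINT x|?P. iexp (t * scaled_T p n x)) - (CLINT x|?P. iexp (t * U_stat p n x)))
      = cmod (CLINT x|?P. iexp (t * scaled_T p n x) - iexp (t * U_stat p n x))" using iT by simp
  also have "\<dots> \<le> (\<integral>x. cmod (iexp (t * scaled_T p n x) - iexp (t * U_stat p n x)) \<partial>?P)" by (rule integral_norm_bound)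
  also have "\<dots> \<le> (\<integral>x. 2 * (\<Sum>i<n. indicator (small p) (x i)) \<partial>?P)"
  proof (rule integral_mono)
    show "integrable ?P (\<lambda>x. cmod (iexp (t * scaled_T p n x) - iexp (t * U_stat p n x)))" using iT by auto
    show "integrable ?P (\<lambda>x. 2 * (\<Sum>i<n. indicator (small p) (x i) :: real))"
      using sm(1) by (intro integrable_mult_right Bochner_Integration.integrable_sum) auto
    fix x assume x: "x \<in> space ?P"
    show "cmod (iexp (t * scaled_T p n x) - iexp (t * U_stat p n x)) \<le> 2 * (\<Sum>i<n. indicator (small p) (x i))"
    proof (cases "\<exists>i<n. x i \<in> small p")
      case True
      then obtain i where i: "i < n" "x i \<in> small p" by blast
      have "(1::real) \<le> (\<Sum>i<n. indicator (small p) (x i))"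
        using member_le_sum[of i "{..<n}" "\<lambda>i. indicator (small p) (x i) :: real"] i by simp
      moreover have "cmod (iexp (t * scaled_T p n x) - iexp (t * U_stat p n x)) \<le> 2"
        using norm_triangle_ineq4[of "iexp (t * scaled_T p n x)" "iexp (t * U_stat p n x)"] by simp
      ultimately show ?thesis by linarith
    next
      case False
      have "sqn p (x i) \<noteq> 0" if "i < n" for i
      proof -
        have "x i \<in> space (Col p)" using x that by (auto simp: space_PiM)
        then show ?thesis using False that np by (auto simp: small_def)
      qed
      from scaled_T_eq_U_stat[OF np this] show ?thesis by (simp add: sum_nonneg)
    qed
  qed
  also have "\<dots> = 2 * (\<Sum>i<n. \<integral>x. indicator (small p) (x i) \<partial>?P)"
    using sm(1) by (simp add: Bochner_Integration.integral_sum)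
  also have "\<dots> \<le> 2 * (\<Sum>i<n. tail_prob p)" using sm(2) by (intro mult_left_mono sum_mono) auto
  finally show ?thesis by simp
qed

lemma char_scaled_T_tendsto:
  assumes ratio: "(\<lambda>n. real (p n) / real n) \<longlonglongrightarrow> y" and y_pos: "0 < y"
  shows "(\<lambda>n. CLINT x|PiM {..<n} (\<lambda>_. Col (p n)). iexp (t * scaled_T (p n) n x)) \<longlonglongrightarrow> complex_of_real (exp (- (t\<^sup>2) / 2))"
proof -
  let ?T = "\<lambda>n. CLINT x|PiM {..<n} (\<lambda>_. Col (p n)). iexp (t * scaled_T (p n) n x)"
  let ?W = "\<lambda>n. CLINT x|PiM {..<n} (\<lambda>_. Col (p n)). iexp (t * U_stat (p n) n x)"
  have b: "(\<lambda>p. real p * tail_prob p) \<longlonglongrightarrow> 0"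
  proof -
    define c where "c = 1 / (8 * \<kappa>)"
    have "0 < c" using \<kappa>_ge_1 by (simp add: c_def)
    then have "(\<lambda>p. real p * exp (- c * real p)) \<longlonglongrightarrow> 0" by real_asymp
    then show ?thesis unfolding tail_prob_def c_def by simp
  qed
  have "(\<lambda>n. 2 * (real n / real (p n) * (real (p n) * tail_prob (p n)))) \<longlonglongrightarrow> 2 * (1 / y * 0)"
    by (intro tendsto_intros inverse_ratio[OF assms] filterlim_compose[OF b p_at_top[OF assms]])
  then have lim: "(\<lambda>n. 2 * (real n / real (p n) * (real (p n) * tail_prob (p n)))) \<longlonglongrightarrow> 0" by simp
  have "\<forall>\<^sub>F n in sequentially. norm (?T n - ?W n) \<le> 2 * (real n / real (p n) * (real (p n) * tail_prob (p n)))"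
    using p_pos[OF assms] eventually_gt_at_top[of 0]
  proof eventually_elim
    case (elim n)
    then show ?case using char_scaled_T_U_stat[of n "p n" t] by simp
  qed
  then have "(\<lambda>n. ?T n - ?W n) \<longlonglongrightarrow> 0" using lim by (rule Lim_null_comparison)
  from tendsto_add[OF this char_U_stat_tendsto[OF assms, of t]] show ?thesis by simp
qed

end

subsection \<open>The limit law\<close>

text \<open>No column has to be nonzero: both sides treat a zero column by the same convention for
  division by 0.\<close>

lemma (in standardized_entry) T_stat_mat:
  "(T_stat (mat p n (\<lambda>(k, i). x i k)) + 1) / 2 = scaled_T p n x"
proof -
  let ?Z = "mat p n (\<lambda>(k, i). x i k)"
  let ?S = "self_normalized_cov ?Z"
  have col: "(col_norm ?Z i)\<^sup>2 = sqn p (x i)" if "i < n" for i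
  proof -
    have "col_norm ?Z i = sqrt (sqn p (x i))"
      unfolding col_norm_def L2_set_def sqn_def using that by (auto intro!: arg_cong[where f = sqrt] sum.cong)
    then show ?thesis by (simp add: sqn_nonneg)
  qed
  have S: "?S $$ (k, l) = real p / real n * (\<Sum>i<n. x i k * x i l / sqn p (x i))" if "k < p" "l < p" for k l
    using that col unfolding self_normalized_cov_def by (auto intro!: sum.cong)
  have dim: "?S \<in> carrier_mat p p" unfolding self_normalized_cov_def by simp
  have sym: "?S $$ (k, l) = ?S $$ (l, k)" if "k < p" "l < p" for k l
    using that by (simp add: S mult.commute)
  have "(\<Sum>\<^sub># (image_mset (\<lambda>x. x\<^sup>2) (eigenvalues_mset ?S))) = (\<Sum>k<p. \<Sum>l<p. (?S $$ (k, l))\<^sup>2)"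
    by (rule sum_squares_eigenvalues[OF dim sym])
  also have "\<dots> = (\<Sum>k<p. \<Sum>l<p. (real p / real n * (\<Sum>i<n. x i k * x i l / sqn p (x i)))\<^sup>2)"
    by (intro sum.cong refl) (simp add: S)
  finally show ?thesis unfolding T_stat_def scaled_T_def Let_def by simp
qed

context standardized_entry begin

text \<open>Restrictions of independent coordinates to disjoint index sets are independent, so an
  array of independent entries may be regrouped by columns.\<close>

lemma
  fixes p n :: nat
  shows distr_columns: "distr (PiM ({..<p} \<times> {..<n}) (\<lambda>_. D)) (PiM {..<n} (\<lambda>_. Col p)) (\<lambda>w. \<lambda>i\<in>{..<n}. \<lambda>k\<in>{..<p}. w (k, i))
     = PiM {..<n} (\<lambda>_. Col p)"
  (is "distr ?P ?C ?f = ?C")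
    and columns_meas: "(\<lambda>w. \<lambda>i\<in>{..<n}. \<lambda>k\<in>{..<p}. w (k, i)) \<in> measurable (PiM ({..<p} \<times> {..<n}) (\<lambda>_. D)) (PiM {..<n} (\<lambda>_. Col p))"
proof -
  interpret P: prob_space ?P by (rule prob_space_PiM) unfold_locales
  show m: "?f \<in> measurable ?P ?C"
    by (intro measurable_restrict measurable_component_singleton) auto
  show "distr ?P ?C ?f = ?C"
  proof (cases "n = 0")
    \<comment> \<open>Over the empty index set the product measure is the point mass at the
      undefined function; the characterization by joint laws used in the other case needs a nonempty
      set.\<close>
    case True
    have "distr ?P ?C ?f = ?C"
    proof (rule measure_eqI)
      fix A assume "A \<in> sets (distr ?P ?C ?f)"
      then have "A = {} \<or> A = {\<lambda>_. undefined}" using True by (auto simp: sets_PiM_empty)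
      then show "emeasure (distr ?P ?C ?f) A = emeasure ?C A"
      proof
        assume A: "A = {\<lambda>_. undefined}"
        have "?f -` A \<inter> space ?P = space ?P" unfolding A using True by auto
        moreover have "A \<in> sets ?C" unfolding A using True by (simp add: sets_PiM_empty)
        ultimately have "emeasure (distr ?P ?C ?f) A = 1" using m by (simp add: emeasure_distr P.emeasure_space_1)
        moreover have "emeasure ?C A = 1" unfolding A using True by (simp add: PiM_empty)
        ultimately show ?thesis by simp
      qed simp
    qed simp
    then show ?thesis .
  next
    case False
    let ?K = "\<lambda>i. {..<p} \<times> {i}"
    have ind: "P.indep_vars (\<lambda>i. PiM (?K i) (\<lambda>_. D)) (\<lambda>i w. restrict (\<lambda>a. w a) (?K i)) {..<n}"
      by (rule P.indep_vars_restrict[OF indep_vars_PiM_coordinates])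
         (auto simp: disjoint_family_on_def intro: prob_space_axioms)
    have ind2: "P.indep_vars (\<lambda>_. Col p) (\<lambda>i w. (\<lambda>u. \<lambda>k\<in>{..<p}. u (k, i)) (restrict (\<lambda>a. w a) (?K i))) {..<n}"
      by (rule P.indep_vars_compose2[OF ind], rule measurable_restrict, rule measurable_component_singleton) auto
    have ind3: "P.indep_vars (\<lambda>_. Col p) (\<lambda>i w. \<lambda>k\<in>{..<p}. w (k, i)) {..<n}"
    proof -
      have "(\<lambda>(i::nat) (w :: nat \<times> nat \<Rightarrow> real). (\<lambda>u. \<lambda>k\<in>{..<p}. u (k, i)) (restrict (\<lambda>a. w a) (?K i))) = (\<lambda>i w. \<lambda>k\<in>{..<p}. w (k, i))"
        by (auto simp: fun_eq_iff restrict_def)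
      then show ?thesis using ind2 by (simp only:)
    qed
    have marg: "distr ?P (Col p) (\<lambda>w. \<lambda>k\<in>{..<p}. w (k, i)) = Col p" if "i < n" for i
      using distr_PiM_reindex[where K = "{..<p} \<times> {..<n}" and M = "\<lambda>_. D" and f = "\<lambda>k. (k, i)" and I = "{..<p}"] that
      by (auto simp: inj_on_def intro: prob_space_axioms)
    have "distr ?P ?C ?f = PiM {..<n} (\<lambda>i. distr ?P (Col p) (\<lambda>w. \<lambda>k\<in>{..<p}. w (k, i)))"
      using ind3 by (subst (asm) P.indep_vars_iff_distr_eq_PiM')
        (use False in \<open>auto intro!: measurable_restrict measurable_component_singleton\<close>)
    also have "\<dots> = ?C" using marg by (intro PiM_cong) auto
    finally show ?thesis .
  qed
qed

end

text \<open>Only the law of the array matters, so each \<open>M n\<close> is pushed forward to the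
  product space of columns, where the characteristic functions converge; Levy's continuity theorem
  then yields weak convergence.\<close>

theorem proposition2:
  fixes M :: "nat \<Rightarrow> 'a measure"
    and Z :: "nat \<Rightarrow> nat \<Rightarrow> nat \<Rightarrow> 'a \<Rightarrow> real"
    and D :: "real measure"
    and p :: "nat \<Rightarrow> nat"
    and y :: real
  assumes prob: "\<And>n. prob_space (M n)"
    and indep: "\<And>n. prob_space.indep_vars (M n) (\<lambda>_. borel) (\<lambda>(i, j). Z n i j) ({..<p n} \<times> {..<n})"
    and law: "\<And>n i j. i < p n \<Longrightarrow> j < n \<Longrightarrow> distr (M n) borel (Z n i j) = D"
    and D: "real_distribution D"
    and mean: "integrable D (\<lambda>x. x)" "(\<integral>x. x \<partial>D) = 0"
    and second_moment: "integrable D (\<lambda>x. x\<^sup>2)" "(\<integral>x. x\<^sup>2 \<partial>D) = 1"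
    and fourth_moment: "integrable D (\<lambda>x. x ^ 4)"
    and ratio: "(\<lambda>n. real (p n) / real n) \<longlonglongrightarrow> y"
    and y_pos: "0 < y"
  shows "weak_conv_m
    (\<lambda>n. distr (M n) borel (\<lambda>\<omega>. (T_stat (mat (p n) n (\<lambda>(i, j). Z n i j \<omega>)) + 1) / 2))
    std_normal_distribution"
proof -
  interpret D: standardized_entry D
    using D mean second_moment fourth_moment
    by (simp add: standardized_entry_def standardized_entry_axioms_def)
  define cols where "cols n \<omega> = (\<lambda>i\<in>{..<n}. \<lambda>k\<in>{..<p n}. Z n k i \<omega>)" for n \<omega>
  have T: "(T_stat (mat (p n) n (\<lambda>(i, j). Z n i j \<omega>)) + 1) / 2 = D.scaled_T (p n) n (cols n \<omega>)" for n \<omega>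
  proof -
    have "mat (p n) n (\<lambda>(i, j). Z n i j \<omega>) = mat (p n) n (\<lambda>(k, i). cols n \<omega> i k)"
      by (rule cong_mat) (auto simp: cols_def)
    then show ?thesis using D.T_stat_mat by simp
  qed
  \<comment> \<open>Measurability is claimed for every \<open>n\<close>, since Levy's theorem asks
    for distributions throughout. The law is identified only for nonempty arrays, which is the case
    for all large \<open>n\<close>.\<close>
  have cols: "cols n \<in> measurable (M n) (PiM {..<n} (\<lambda>_. D.Col (p n)))"
    "0 < n \<Longrightarrow> 0 < p n \<Longrightarrow> distr (M n) (PiM {..<n} (\<lambda>_. D.Col (p n))) (cols n) = PiM {..<n} (\<lambda>_. D.Col (p n))" for n
  proof -
    interpret Mn: prob_space "M n" by (rule prob)
    let ?I = "{..<p n} \<times> {..<n}"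
    let ?g = "\<lambda>\<omega>. \<lambda>a\<in>?I. (\<lambda>(i, j). Z n i j) a \<omega>"
    let ?f = "\<lambda>w. \<lambda>i\<in>{..<n}. \<lambda>k\<in>{..<p n}. w (k, i)"
    have ind: "Mn.indep_vars (\<lambda>_. D) (\<lambda>(i, j). Z n i j) ?I"
    proof -
      have "Mn.indep_vars (\<lambda>_. D) (\<lambda>a \<omega>. (\<lambda>x. x) ((\<lambda>(i, j). Z n i j) a \<omega>)) ?I"
        by (rule Mn.indep_vars_compose2[OF indep]) (auto simp: measurable_def)
      then show ?thesis by (simp add: case_prod_unfold)
    qed
    have rv: "(\<lambda>(i, j). Z n i j) a \<in> measurable (M n) D" if "a \<in> ?I" for a
      using ind that unfolding Mn.indep_vars_def by blast
    have g: "?g \<in> measurable (M n) (PiM ?I (\<lambda>_. D))" using rv by (intro measurable_restrict) auto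
    have fg: "cols n = (\<lambda>\<omega>. ?f (?g \<omega>))" unfolding cols_def by (auto simp: fun_eq_iff restrict_def)
    show "cols n \<in> measurable (M n) (PiM {..<n} (\<lambda>_. D.Col (p n)))"
      unfolding fg by (rule measurable_compose[OF g D.columns_meas])
    assume "0 < n" "0 < p n"
    then have ne: "?I \<noteq> {}" by auto
    have lawD: "distr (M n) D ((\<lambda>(i, j). Z n i j) a) = D" if "a \<in> ?I" for a
    proof -
      have "distr (M n) D ((\<lambda>(i, j). Z n i j) a) = distr (M n) borel ((\<lambda>(i, j). Z n i j) a)"
        by (intro distr_cong) auto
      then show ?thesis using that law by auto
    qed
    have "distr (M n) (PiM ?I (\<lambda>_. D)) ?g = PiM ?I (\<lambda>a. distr (M n) D ((\<lambda>(i, j). Z n i j) a))"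
      using ind Mn.indep_vars_iff_distr_eq_PiM'[OF ne rv] by simp
    also have "\<dots> = PiM ?I (\<lambda>_. D)" using lawD by (intro PiM_cong) auto
    finally have gd: "distr (M n) (PiM ?I (\<lambda>_. D)) ?g = PiM ?I (\<lambda>_. D)" .
    have "distr (M n) (PiM {..<n} (\<lambda>_. D.Col (p n))) (cols n)
        = distr (distr (M n) (PiM ?I (\<lambda>_. D)) ?g) (PiM {..<n} (\<lambda>_. D.Col (p n))) ?f"
      unfolding fg by (subst distr_distr[OF D.columns_meas g]) (simp add: o_def)
    then show "distr (M n) (PiM {..<n} (\<lambda>_. D.Col (p n))) (cols n) = PiM {..<n} (\<lambda>_. D.Col (p n))"
      unfolding gd D.distr_columns .
  qed
  have T_meas: "(\<lambda>\<omega>. D.scaled_T (p n) n (cols n \<omega>)) \<in> borel_measurable (M n)" for n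
    by (rule measurable_compose[OF cols(1) D.scaled_T_meas])
  show ?thesis unfolding T
  proof (rule levy_continuity)
    show "real_distribution (distr (M n) borel (\<lambda>\<omega>. D.scaled_T (p n) n (cols n \<omega>)))" for n
      using T_meas by (intro prob_space.real_distribution_distr prob) auto
    show "real_distribution std_normal_distribution" by (rule real_dist_normal_dist)
    fix t :: real
    have "\<forall>\<^sub>F n in sequentially. (CLINT x|PiM {..<n} (\<lambda>_. D.Col (p n)). iexp (t * D.scaled_T (p n) n x))
        = char (distr (M n) borel (\<lambda>\<omega>. D.scaled_T (p n) n (cols n \<omega>))) t"
      using D.p_pos[OF ratio y_pos] eventually_gt_at_top[of 0]
    proof eventually_elim
      case (elim n)
      have [measurable]: "D.scaled_T (p n) n \<in> borel_measurable (PiM {..<n} (\<lambda>_. D.Col (p n)))" by (rule D.scaled_T_meas)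
      have "char (distr (M n) borel (\<lambda>\<omega>. D.scaled_T (p n) n (cols n \<omega>))) t = (CLINT \<omega>|M n. iexp (t * D.scaled_T (p n) n (cols n \<omega>)))"
        unfolding char_def using T_meas by (subst integral_distr) auto
      also have "\<dots> = (CLINT x|distr (M n) (PiM {..<n} (\<lambda>_. D.Col (p n))) (cols n). iexp (t * D.scaled_T (p n) n x))"
        using cols(1) by (subst integral_distr) auto
      finally show ?case using cols(2) elim by simp
    qed
    then show "(\<lambda>n. char (distr (M n) borel (\<lambda>\<omega>. D.scaled_T (p n) n (cols n \<omega>))) t) \<longlonglongrightarrow> char std_normal_distribution t"
      unfolding char_std_normal_distribution
      by (rule Lim_transform_eventually[OF D.char_scaled_T_tendsto[OF ratio y_pos]])
  qed
qed

end
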